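(* Let $d\ge2$ and let $F=(F_1,\dots,F_d)$ be an infinitely differentiable vector field on $\mathbb{R}^d$ whose components all belong to the Schwartz class $\mathcal{S}(\mathbb{R}^d)$. For each $\omega\in\mathbb{S}^{d-1}$ let $(\omega,\omega_1,\dots,\omega_{d-1})$, with $\omega_k=\omega_k(\omega)$, be an arbitrarily chosen orthonormal basis of $\mathbb{R}^d$ extending $\omega$. Then: (1) the divergence $\Phi=\operatorname{div}F$ can be reconstructed from the transversal transform $\mathcal{D}^{\perp}F$ by $$\Phi(x)=\left[\mathcal{R}^{-1}\left(\frac{\partial}{\partial p}\mathcal{D}^{\perp}F\right)\right](x),\qquad x\in\mathbb{R}^d;$$ (2) the componentwise Radon transform of $F$ can be reconstructed from $\mathcal{D}^{\perp}F$ and the weighted transversal transforms $\mathcal{W}_k^{\perp}F$, $k=1,\dots,d-1$, by $$[\mathfrak{R}F](\omega,p)=\omega\,[\mathcal{D}^{\perp}F](\omega,p)+\sum_{k=1}^{d-1}\omega_k\left(\frac{\partial}{\partial p}[\mathcal{W}_k^{\perp}F](\omega,p)-[\mathcal{R}\{(\omega_k\cdot x)\Phi(x)\}](\omega,p)\right),\qquad(\omega,p)\in\mathbb{S}^{d-1}\times\mathbb{R};$$ (3) the field $F$ is recovered by inverting $\mathfrak{R}F$ componentwise: $$F_j(x)=\left[\mathcal{R}^{-1}\left(e_j\cdot\mathfrak{R}F\right)\right](x),\qquad x\in\mathbb{R}^d,\quad j=1,\dots,d,$$ where $e_1,\dots,e_d$ is the canonical orthonormal basis of $\mathbb{R}^d$.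 Here $\mathcal{R}^{-1}$ denotes the filtration/backprojection operator (with any fixed real $\alpha<d$) $\mathcal{R}^{-1}g=\frac12(2\pi)^{1-d}I^{-\alpha}\mathcal{R}^{\#}I^{\alpha-d+1}g$.
   Context: For $(\omega,p)\in\mathbb{S}^{d-1}\times\mathbb{R}$ let $\Pi(\omega,p)=\{x\in\mathbb{R}^d:\omega\cdot x=p\}$, with standard area element $dA_\Pi$. The Radon transform of a continuous function $f$ that decays fast enough is $[\mathcal{R}f](\omega,p)=\int_{\Pi(\omega,p)}f(x)\,dA_\Pi(x)$; when the integrand depends on $\omega_k=\omega_k(\omega)$, as in $\mathcal{R}\{(\omega_k\cdot x)\Phi(x)\}$, the value at $(\omega,p)$ is computed with $\omega_k=\omega_k(\omega)$ for that same $\omega$. For a vector field $F$: - componentwise Radon transform: $[\mathfrak{R}F](\omega,p)=([\mathcal{R}F_1](\omega,p),\dots,[\mathcal{R}F_d](\omega,p))$; - transversal Radon transform: $[\mathcal{D}^{\perp}F](\omega,p)=\int_{\Pi(\omega,p)}\omega\cdot F(x)\,dA_\Pi(x)$; - weighted transversal transforms: $[\mathcal{W}_k^{\perp}F](\omega,p)=\int_{\Pi(\omega,p)}(\omega_k\cdot x)\,(F(x)\cdot\omega)\,dA_\Pi(x)$, $k=1,\dots,d-1$. Inversion operator: the dual Radon transform is $[\mathcal{R}^{\#}g](x)=\int_{\mathbb{S}^{d-1}}g(\omega,\omega\cdot x)\,d\omega$. The Riesz potential is $I^{\beta}f=\mathcal{F}^{-1}(|\xi|^{-\beta}\mathcal{F}f)$,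 where $\mathcal{F}$ is the Fourier transform with kernel $e^{-ix\cdot\xi}$; in $\mathcal{R}^{-1}g=\frac12(2\pi)^{1-d}I^{-\alpha}\mathcal{R}^{\#}I^{\alpha-d+1}g$ the inner $I^{\alpha-d+1}$ acts on the one-dimensional variable $p$ of $g(\omega,p)$ and the outer $I^{-\alpha}$ acts on functions on $\mathbb{R}^d$. It is a classical fact that $\mathcal{R}^{-1}\mathcal{R}f=f$ for $f\in\mathcal{S}(\mathbb{R}^d)$. *)

theory Defs
  imports "HOL-Analysis.Analysis"
begin

subsection \<open>Smooth and Schwartz functions\<close>

text \<open>
  \<open>iterated_deriv [v\<^sub>1, \<dots>, v\<^sub>m] f\<close> is \<open>\<partial>\<^bsub>v\<^sub>1\<^esub> \<dots> \<partial>\<^bsub>v\<^sub>m\<^esub> f\<close>. Lists over \<open>Basis\<close> play the role of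
  multi-indices. Since \<open>frechet_derivative\<close> is a junk value where the function is not
  differentiable, \<open>smooth\<close> demands (total) differentiability of every iterated partial
  derivative; this is equivalent to being infinitely differentiable.
\<close>

fun iterated_deriv :: "'a list \<Rightarrow> ('a::euclidean_space \<Rightarrow> 'b::real_normed_vector) \<Rightarrow> 'a \<Rightarrow> 'b" where
  "iterated_deriv [] f = f"
| "iterated_deriv (v # vs) f = (\<lambda>x. frechet_derivative (iterated_deriv vs f) (at x) v)"

definition smooth :: "('a::euclidean_space \<Rightarrow> 'b::real_normed_vector) \<Rightarrow> bool" where
  "smooth f \<longleftrightarrow> (\<forall>vs \<in> lists Basis. \<forall>x. iterated_deriv vs f differentiable (at x))"

definition schwartz :: "('a::euclidean_space \<Rightarrow> 'b::real_normed_vector) \<Rightarrow> bool" where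
  "schwartz f \<longleftrightarrow> smooth f \<and>
     (\<forall>vs \<in> lists Basis. \<forall>m::nat. \<exists>C. \<forall>x. norm x ^ m * norm (iterated_deriv vs f x) \<le> C)"

definition divergence :: "(real^'n \<Rightarrow> real^'n) \<Rightarrow> real^'n \<Rightarrow> real" where
  "divergence F x = (\<Sum>j\<in>UNIV. frechet_derivative (\<lambda>y. F y $ j) (at x) (axis j 1))"

subsection \<open>Hyperplanes and the Radon transform\<close>

text \<open>The vectors of an orthonormal basis are \<open>b 0, \<dots>, b (d - 1)\<close> with \<open>d = DIM('a)\<close>.\<close>

definition orthonormal_basis :: "(nat \<Rightarrow> 'a::euclidean_space) \<Rightarrow> bool" where
  "orthonormal_basis b \<longleftrightarrow>
     (\<forall>i<DIM('a). \<forall>j<DIM('a). b i \<bullet> b j = (if i = j then 1 else 0)) \<and>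
     span (b ` {..<DIM('a)}) = UNIV"

definition hyperplane :: "'a::euclidean_space \<Rightarrow> real \<Rightarrow> 'a set" where
  "hyperplane \<omega> p = {x. \<omega> \<bullet> x = p}"

text \<open>
  The standard area of a hyperplane with unit normal \<open>\<omega>\<close> is the image of Lebesgue measure on
  \<open>\<real>\<^sup>d\<^sup>-\<^sup>1\<close> under the isometric parametrization \<open>t \<mapsto> p \<omega> + t\<^sub>1 b\<^sub>1 + \<dots> + t\<^bsub>d-1\<^esub> b\<^bsub>d-1\<^esub>\<close>, where
  \<open>(\<omega>, b\<^sub>1, \<dots>, b\<^bsub>d-1\<^esub>)\<close> is an orthonormal basis; it does not depend on the basis chosen.
\<close>

definition hyperplane_area :: "'a::euclidean_space \<Rightarrow> real \<Rightarrow> 'a measure" where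
  "hyperplane_area \<omega> p =
     (let b = (SOME b. orthonormal_basis b \<and> b 0 = \<omega>) in
      distr (\<Pi>\<^sub>M k\<in>{1..DIM('a) - 1}. lborel) (restrict_space borel (hyperplane \<omega> p))
        (\<lambda>t. p *\<^sub>R \<omega> + (\<Sum>k = 1..DIM('a) - 1. t k *\<^sub>R b k)))"

definition radon ::
    "('a::euclidean_space \<Rightarrow> 'b::{banach, second_countable_topology}) \<Rightarrow> 'a \<Rightarrow> real \<Rightarrow> 'b" where
  "radon f \<omega> p = (\<integral>x. f x \<partial>hyperplane_area \<omega> p)"

definition componentwise_radon :: "(real^'n \<Rightarrow> real^'n) \<Rightarrow> real^'n \<Rightarrow> real \<Rightarrow> real^'n" where
  "componentwise_radon F \<omega> p = (\<chi> j. radon (\<lambda>x. F x $ j) \<omega> p)"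

definition transversal_radon :: "(real^'n \<Rightarrow> real^'n) \<Rightarrow> real^'n \<Rightarrow> real \<Rightarrow> real" where
  "transversal_radon F \<omega> p = radon (\<lambda>x. \<omega> \<bullet> F x) \<omega> p"

text \<open>Here \<open>e \<omega> k\<close> is the \<open>k\<close>-th vector \<open>\<omega>\<^sub>k(\<omega>)\<close> of the frame attached to \<open>\<omega>\<close>.\<close>

definition weighted_transversal_radon ::
    "(real^'n \<Rightarrow> nat \<Rightarrow> real^'n) \<Rightarrow> nat \<Rightarrow> (real^'n \<Rightarrow> real^'n) \<Rightarrow> real^'n \<Rightarrow> real \<Rightarrow> real" where
  "weighted_transversal_radon e k F \<omega> p = radon (\<lambda>x. (e \<omega> k \<bullet> x) * (F x \<bullet> \<omega>)) \<omega> p"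

subsection \<open>The dual Radon transform\<close>

text \<open>
  Surface measure on the unit sphere: the area of \<open>A\<close> is \<open>d\<close> times the Lebesgue measure of the
  cone \<open>{r \<theta> | 0 < r \<le> 1, \<theta> \<in> A}\<close>. It is not normalized.
\<close>

definition sphere_measure :: "'a::euclidean_space measure" where
  "sphere_measure =
     scale_measure (of_nat DIM('a))
       (distr (restrict_space lborel (cball 0 1 - {0})) (restrict_space borel (sphere 0 1)) sgn)"

definition dual_radon :: "('a::euclidean_space \<Rightarrow> real \<Rightarrow> complex) \<Rightarrow> 'a \<Rightarrow> complex" where
  "dual_radon g x = (\<integral>\<omega>. g \<omega> (\<omega> \<bullet> x) \<partial>sphere_measure)"

subsection \<open>Fourier transform and Riesz potential\<close>

definition fourier :: "('a::euclidean_space \<Rightarrow> complex) \<Rightarrow> 'a \<Rightarrow> complex" where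
  "fourier f \<xi> = (\<integral>x. exp (- \<i> * of_real (x \<bullet> \<xi>)) * f x \<partial>lborel)"

definition inverse_fourier :: "('a::euclidean_space \<Rightarrow> complex) \<Rightarrow> 'a \<Rightarrow> complex" where
  "inverse_fourier u x =
     of_real (1 / (2 * pi) ^ DIM('a)) * (\<integral>\<xi>. exp (\<i> * of_real (x \<bullet> \<xi>)) * u \<xi> \<partial>lborel)"

text \<open>
  \<open>has_fourier_transform f u\<close>: the Fourier transform of the tempered distribution \<open>f\<close> is
  the function \<open>u\<close>. The distributional sense is needed because the backprojection of a function
  need not be integrable (for \<open>0 < \<alpha> < d\<close> it decays in general only like \<open>\<bar>x\<bar>\<^sup>\<alpha>\<^sup>-\<^sup>d\<close>). For integrable
  \<open>f\<close> the function \<open>fourier f\<close> qualifies, and \<open>u\<close> is unique almost everywhere.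
\<close>

definition has_fourier_transform ::
    "('a::euclidean_space \<Rightarrow> complex) \<Rightarrow> ('a \<Rightarrow> complex) \<Rightarrow> bool" where
  "has_fourier_transform f u \<longleftrightarrow>
     (\<forall>\<phi>. schwartz \<phi> \<longrightarrow>
        integrable lborel (\<lambda>x. f x * fourier \<phi> x) \<and>
        integrable lborel (\<lambda>\<xi>. u \<xi> * \<phi> \<xi>) \<and>
        (\<integral>x. f x * fourier \<phi> x \<partial>lborel) = (\<integral>\<xi>. u \<xi> * \<phi> \<xi> \<partial>lborel))"

text \<open>
  \<open>\<F>\<^sup>-\<^sup>1(\<bar>\<xi>\<bar>\<^sup>-\<^sup>\<beta> \<F> f)\<close>. The choice of \<open>u\<close> within its almost-everywhere class is immaterial, and
  so is the value of \<open>powr\<close> at \<open>0\<close>.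
\<close>

definition riesz_potential :: "real \<Rightarrow> ('a::euclidean_space \<Rightarrow> complex) \<Rightarrow> 'a \<Rightarrow> complex" where
  "riesz_potential \<beta> f =
     inverse_fourier (\<lambda>\<xi>. of_real (norm \<xi> powr (- \<beta>)) * (SOME u. has_fourier_transform f u) \<xi>)"

text \<open>The inner potential acts on functions on \<open>\<real>\<close>, the outer one on functions on \<open>'a\<close>.\<close>

definition radon_inverse ::
    "real \<Rightarrow> ('a::euclidean_space \<Rightarrow> real \<Rightarrow> complex) \<Rightarrow> 'a \<Rightarrow> complex" where
  "radon_inverse \<alpha> g x =
     of_real (1 / 2 * (2 * pi) powr (1 - real DIM('a))) *
     riesz_potential (- \<alpha>)
       (dual_radon (\<lambda>\<omega>. riesz_potential (\<alpha> - real DIM('a) + 1) (g \<omega>))) x"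

end

theory Submission
  imports Defs "HOL-Probability.Sinc_Integral" "HOL-Probability.Characteristic_Functions"
begin

text \<open>
  Differentiating under the integral gives \<open>\<partial>\<^sub>p R f = R (\<partial>\<^sub>\<omega> f)\<close>, and translation invariance
  gives \<open>R (\<partial>\<^sub>v f) = 0\<close> for \<open>v\<close> orthogonal to \<open>\<omega>\<close>. Computing the divergence as a trace in the frame
  \<open>(\<omega>, \<omega>\<^sub>1, \<dots>)\<close> therefore leaves only the \<open>\<omega>\<close>-term under \<open>R\<close>, and with the weight \<open>\<omega>\<^sub>k \<bullet> x\<close>
  it leaves in addition \<open>- R (\<omega>\<^sub>k \<bullet> F)\<close>. The inversion formula follows from the Fourier slice
  theorem, polar coordinates and Fourier inversion; since \<open>riesz_potential\<close> picks some
  distributional Fourier transform, one also needs that it is unique almost everywhere.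
\<close>

text \<open>The basis inside \<open>hyperplane_area\<close> is picked by SOME and is unrelated to
  the given frame \<open>e \<omega>\<close>, so hyperplane integrals cannot be computed in that
  frame. The two are kept apart: integrals are taken in the hidden basis, and the frame enters only
  through coordinate-free facts, namely that derivatives along any \<open>v\<close> orthogonal to
  \<open>\<omega>\<close> integrate to zero and that a trace may be taken in any orthonormal basis.
  The measure-theoretic input is that Lebesgue measure is a product measure in every orthonormal
  basis; splitting off coordinate 0 gives Fubini over parallel hyperplanes.

  The constant in the inversion operator balances as follows. One-dimensional inversion supplies
  1/(2 pi) where dimension d needs (2 pi)^(-d), an excess of (2 pi)^(d-1); every frequency is
  reached twice, from (\<omega>, s) and (-\<omega>, -s), which gives the 2. The condition \<alpha> <
  d is local integrability of |\<xi>|^(-\<alpha>); it makes the backprojection an absolutely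
  convergent inverse Fourier integral, although it need not be integrable itself.\<close>

abbreviation (input) leb_prod :: "nat set \<Rightarrow> (nat \<Rightarrow> real) measure" where
  "leb_prod I \<equiv> PiM I (\<lambda>_. lborel)"

abbreviation (input) frame_sum :: "(nat \<Rightarrow> 'a::real_vector) \<Rightarrow> nat set \<Rightarrow> (nat \<Rightarrow> real) \<Rightarrow> 'a" where
  "frame_sum b I t \<equiv> (\<Sum>k\<in>I. t k *\<^sub>R b k)"

section \<open>Lebesgue measure in orthonormal coordinates\<close>

interpretation lebprod: product_sigma_finite "\<lambda>_::nat. lborel :: real measure"
  by standard

lemma sigma_finite_leb_prod: "finite I \<Longrightarrow> sigma_finite_measure (leb_prod I)"
  by (rule lebprod.sigma_finite)

lemma measurable_frame_sum [measurable]: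
  fixes b :: "nat \<Rightarrow> 'a::euclidean_space"
  shows "frame_sum b I \<in> borel_measurable (leb_prod I)"
  by (intro borel_measurable_sum borel_measurable_scaleR measurable_component_singleton) auto

lemma emeasure_lborel_translate:
  assumes "A \<in> sets borel"
  shows "emeasure lborel ((\<lambda>x::'a::euclidean_space. x + c) -` A) = emeasure lborel A"
proof -
  have "emeasure lborel A = emeasure (distr lborel borel ((+) c)) A"
    by (simp add: lborel_distr_plus)
  also have "\<dots> = emeasure lborel ((+) c -` A)"
    using assms by (subst emeasure_distr) auto
  also have "(+) c = (\<lambda>x. x + c)"
    by (auto simp: add.commute)
  finally show ?thesis ..
qed

text \<open>Product measures are determined by boxes, where the claim is translation invariance in
  each coordinate. The restriction to \<open>I\<close> keeps the image among the extensional
  functions, which form the space of \<open>leb_prod I\<close>.\<close>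

lemma distr_leb_prod_translate:
  assumes [simp]: "finite I"
  shows "distr (leb_prod I) (leb_prod I) (\<lambda>t. \<lambda>k\<in>I. t k + a k) = leb_prod I"
proof (rule lebprod.PiM_eqI)
  fix A :: "nat \<Rightarrow> real set" assume A: "\<And>i. i \<in> I \<Longrightarrow> A i \<in> sets lborel"
  have meas: "(\<lambda>t. \<lambda>k\<in>I. t k + a k) \<in> leb_prod I \<rightarrow>\<^sub>M leb_prod I"
    by (intro measurable_restrict) simp
  have "emeasure (distr (leb_prod I) (leb_prod I) (\<lambda>t. \<lambda>k\<in>I. t k + a k)) (Pi\<^sub>E I A)
      = emeasure (leb_prod I) ((\<lambda>t. \<lambda>k\<in>I. t k + a k) -` Pi\<^sub>E I A \<inter> space (leb_prod I))"
    using A by (intro emeasure_distr meas sets_PiM_I_finite) auto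
  also have "(\<lambda>t. \<lambda>k\<in>I. t k + a k) -` Pi\<^sub>E I A \<inter> space (leb_prod I)
      = Pi\<^sub>E I (\<lambda>k. (\<lambda>x. x + a k) -` A k)"
    by (auto simp: space_PiM PiE_iff)
  also have "emeasure (leb_prod I) \<dots> = (\<Prod>k\<in>I. emeasure lborel ((\<lambda>x. x + a k) -` A k))"
  proof (rule lebprod.emeasure_PiM)
    fix k assume "k \<in> I"
    then have "A k \<in> sets borel"
      using A by simp
    then show "(\<lambda>x. x + a k) -` A k \<in> sets lborel"
      using measurable_sets[of "\<lambda>x. x + a k" borel borel "A k"] by simp
  qed simp
  also have "\<dots> = (\<Prod>k\<in>I. emeasure lborel (A k))"
    using A by (intro prod.cong emeasure_lborel_translate) auto
  finally show "emeasure (distr (leb_prod I) (leb_prod I) (\<lambda>t. \<lambda>k\<in>I. t k + a k)) (Pi\<^sub>E I A)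
      = (\<Prod>k\<in>I. emeasure lborel (A k))" .
qed simp_all

lemma orthonormal_basis_inner:
  fixes b :: "nat \<Rightarrow> 'a::euclidean_space"
  assumes "orthonormal_basis b" "i < DIM('a)" "j < DIM('a)"
  shows "b i \<bullet> b j = (if i = j then 1 else 0)"
  using assms by (simp add: orthonormal_basis_def)

lemma norm_frame_sum:
  fixes b :: "nat \<Rightarrow> 'a::euclidean_space"
  assumes "orthonormal_basis b" "I \<subseteq> {..<DIM('a)}"
  shows "(norm (frame_sum b I t))\<^sup>2 = (\<Sum>k\<in>I. (t k)\<^sup>2)"
proof -
  have fin: "finite I"
    using assms(2) finite_subset by blast
  have "(norm (frame_sum b I t))\<^sup>2 = (\<Sum>i\<in>I. \<Sum>j\<in>I. (t i * t j) * (b i \<bullet> b j))"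
    unfolding power2_norm_eq_inner by (simp add: inner_sum_left inner_sum_right sum_distrib_left mult_ac inner_commute)
  also have "\<dots> = (\<Sum>i\<in>I. \<Sum>j\<in>I. if i = j then (t i * t j) else 0)"
    using assms by (intro sum.cong refl) (auto simp: orthonormal_basis_def subset_eq)
  also have "\<dots> = (\<Sum>k\<in>I. (t k)\<^sup>2)"
    using fin by (simp add: power2_eq_square)
  finally show ?thesis .
qed

text \<open>
  Uniqueness of Haar measure. Integrating \<open>f x * g (y + x)\<close> against \<open>\<mu>\<close> and Lebesgue measure in
  either order gives \<open>(\<integral> f d\<mu>) (\<integral> g dx) = (\<integral> f dx) (\<integral> g d\<mu>)\<close> for even \<open>f\<close>; a Gaussian \<open>f\<close> has
  finite, nonzero integrals.
\<close>

lemma translation_invariant_eq_lborel: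
  fixes \<mu> :: "'a::euclidean_space measure"
  defines "G \<equiv> (\<lambda>x::'a. ennreal (exp (- (norm x)\<^sup>2)))"
  assumes sets [measurable_cong]: "sets \<mu> = sets borel"
    and inv: "\<And>c. distr \<mu> borel ((+) c) = \<mu>"
    and gauss: "(\<integral>\<^sup>+x. G x \<partial>\<mu>) = (\<integral>\<^sup>+x. G x \<partial>lborel)"
    and fin: "(\<integral>\<^sup>+x. G x \<partial>lborel) \<noteq> \<infinity>" 
  shows "\<mu> = lborel"
proof (rule measure_eqI)
  have G[measurable]: "G \<in> borel_measurable borel"
    unfolding G_def by measurable
  have space: "space \<mu> = UNIV"
    using sets_eq_imp_space_eq[OF sets] by simp
  \<comment> \<open>Fubini requires this. On the ball of radius n the Gaussian is at least exp (-
    n^2), so its finite integral bounds the measure of the ball.\<close>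
  have "sigma_finite_measure \<mu>"
  proof
    have "emeasure \<mu> (cball 0 (real n)) \<noteq> \<infinity>" for n
    proof -
      have "emeasure \<mu> (cball 0 (real n)) = (\<integral>\<^sup>+x. indicator (cball 0 (real n)) x \<partial>\<mu>)"
        by (simp add: sets)
      also have "\<dots> \<le> (\<integral>\<^sup>+x. ennreal (exp ((real n)\<^sup>2)) * G x \<partial>\<mu>)"
        unfolding G_def
        by (intro nn_integral_mono)
          (auto simp: indicator_def dist_norm ennreal_mult[symmetric] exp_add[symmetric] power_mono
            simp flip: ennreal_1 intro!: ennreal_leI)
      also have "\<dots> = ennreal (exp ((real n)\<^sup>2)) * (\<integral>\<^sup>+x. G x \<partial>\<mu>)"
        by (intro nn_integral_cmult) simp
      also have "\<dots> < \<infinity>"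
        using gauss fin by (simp add: ennreal_mult_less_top top.not_eq_extremum)
      finally show ?thesis by simp
    qed
    moreover have "(\<Union>n. cball (0::'a) (real n)) = UNIV"
      by (auto simp: real_arch_simple)
    ultimately show "\<exists>A. countable A \<and> A \<subseteq> sets \<mu> \<and> \<Union> A = space \<mu> \<and> (\<forall>a\<in>A. emeasure \<mu> a \<noteq> \<infinity>)"
      by (intro exI[of _ "range (\<lambda>n. cball 0 (real n))"]) (auto simp: space sets)
  qed
  then interpret \<mu>: sigma_finite_measure \<mu> .
  interpret pair_sigma_finite \<mu> lborel ..
  define c where "c = (\<integral>\<^sup>+x. G x \<partial>lborel)"
  have c0: "c \<noteq> 0"
  proof
    assume "c = 0"
    then have "AE x in lborel. G x = 0"
      unfolding c_def by (subst (asm) nn_integral_0_iff_AE) auto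
    then have "AE x in lborel :: 'a measure. False"
      by (simp add: G_def)
    then show False
      by (simp add: eventually_False ae_filter_eq_bot_iff)
  qed
  have shift_nu: "(\<integral>\<^sup>+y. h (y + x) \<partial>lborel) = (\<integral>\<^sup>+y. h y \<partial>lborel)"
    if [measurable]: "h \<in> borel_measurable borel" for h and x :: 'a
    by (subst (2) lborel_distr_plus[of x, symmetric], subst nn_integral_distr) (auto simp: add.commute)
  have shift_mu: "(\<integral>\<^sup>+x. h (y + x) \<partial>\<mu>) = (\<integral>\<^sup>+x. h x \<partial>\<mu>)"
    if [measurable]: "h \<in> borel_measurable borel" for h and y :: 'a
    by (subst (2) inv[of y, symmetric], subst nn_integral_distr) auto
  fix A assume "A \<in> sets \<mu>"
  then have [measurable]: "A \<in> sets borel" by (simp add: sets)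
  let ?g = "indicator A :: 'a \<Rightarrow> ennreal"
  have "c * emeasure lborel A = (\<integral>\<^sup>+x. G x * (\<integral>\<^sup>+y. ?g (y + x) \<partial>lborel) \<partial>\<mu>)"
    by (subst shift_nu) (auto simp: nn_integral_multc gauss c_def)
  also have "\<dots> = (\<integral>\<^sup>+x. (\<integral>\<^sup>+y. G x * ?g (y + x) \<partial>lborel) \<partial>\<mu>)"
    by (simp add: nn_integral_cmult)
  also have "\<dots> = (\<integral>\<^sup>+y. (\<integral>\<^sup>+x. G x * ?g (y + x) \<partial>\<mu>) \<partial>lborel)"
    by (rule Fubini'[symmetric]) measurable
  also have "\<dots> = (\<integral>\<^sup>+y. (\<integral>\<^sup>+x. G (x - y) * ?g x \<partial>\<mu>) \<partial>lborel)"
  proof (rule nn_integral_cong)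
    fix y
    show "(\<integral>\<^sup>+x. G x * ?g (y + x) \<partial>\<mu>) = (\<integral>\<^sup>+x. G (x - y) * ?g x \<partial>\<mu>)"
      using shift_mu[of "\<lambda>x. G (x - y) * ?g x" y] by simp
  qed
  also have "\<dots> = (\<integral>\<^sup>+x. (\<integral>\<^sup>+y. G (x - y) * ?g x \<partial>lborel) \<partial>\<mu>)"
    by (rule Fubini') measurable
  also have "\<dots> = (\<integral>\<^sup>+x. (\<integral>\<^sup>+y. G (y + (- x)) \<partial>lborel) * ?g x \<partial>\<mu>)"
    by (subst nn_integral_multc[symmetric]) (auto simp: G_def norm_minus_commute)
  also have "\<dots> = c * emeasure \<mu> A"
    by (subst shift_nu) (auto simp: nn_integral_cmult c_def sets)
  finally show "emeasure \<mu> A = emeasure lborel A"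
    using c0 fin by (auto simp: c_def ennreal_mult_cancel_left)
qed (use sets in simp)

lemma norm_square_Basis: "(norm x)\<^sup>2 = (\<Sum>i\<in>Basis. (x \<bullet> i)\<^sup>2)"
  unfolding power2_norm_eq_inner by (subst euclidean_inner) (simp add: power2_eq_square)

lemma nn_integral_exp_square_finite: "(\<integral>\<^sup>+x. ennreal (exp (- x\<^sup>2)) \<partial>(lborel::real measure)) \<noteq> \<infinity>"
proof -
  have "integrable lborel (\<lambda>x::real. exp (- x\<^sup>2))"
    using gaussian_moment_0 has_bochner_integral_even_function[of "\<lambda>x. exp (- x\<^sup>2)"]
    by (auto simp: has_bochner_integral_iff)
  then show ?thesis
    by (auto simp: integrable_iff_bounded)
qed

text \<open>Rotation invariance without determinants. The image measure is translation invariant,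
  because a translation by \<open>c\<close> is a shift of the coordinates by those of
  \<open>c\<close>; and by \<open>norm_frame_sum\<close> the Gaussian factors into the same
  one-dimensional integrals in both coordinate systems, which fixes the normalisation.\<close>

lemma distr_frame_sum_eq_lborel:
  fixes b :: "nat \<Rightarrow> 'a::euclidean_space"
  assumes b: "orthonormal_basis b"
  shows "distr (leb_prod {..<DIM('a)}) borel (frame_sum b {..<DIM('a)}) = lborel"
    (is "?\<mu> = _")
proof (rule translation_invariant_eq_lborel)
  let ?I = "{..<DIM('a)}"
  show "sets ?\<mu> = sets borel" by simp
  show "distr ?\<mu> borel ((+) c) = ?\<mu>" for c :: 'a
  proof -
    have "c \<in> span (b ` ?I)"
      using b by (simp add: orthonormal_basis_def)
    moreover have "inj_on b ?I"
    proof (rule inj_onI)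
      fix i j assume ij: "i \<in> ?I" "j \<in> ?I" "b i = b j"
      then have "b i \<bullet> b j = 1"
        using orthonormal_basis_inner[OF b, of j j] by simp
      then show "i = j"
        using orthonormal_basis_inner[OF b, of i j] ij by (simp split: if_splits)
    qed
    ultimately obtain a where a: "c = frame_sum b ?I a"
      by (auto simp: span_finite sum.reindex)
    have "distr ?\<mu> borel ((+) c) = distr (leb_prod ?I) borel (\<lambda>t. c + frame_sum b ?I t)"
      by (subst distr_distr) (auto simp: comp_def)
    also have "\<dots> = distr (leb_prod ?I) borel (\<lambda>t. frame_sum b ?I (\<lambda>k\<in>?I. t k + a k))"
      by (auto simp: a scaleR_add_left sum.distrib add.commute)
    also have "\<dots> = distr (distr (leb_prod ?I) (leb_prod ?I) (\<lambda>t. \<lambda>k\<in>?I. t k + a k)) borel (frame_sum b ?I)"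
      by (subst distr_distr) (auto simp: comp_def intro!: measurable_restrict)
    also have "\<dots> = ?\<mu>"
      by (subst distr_leb_prod_translate) auto
    finally show ?thesis .
  qed
  let ?c = "\<integral>\<^sup>+x. ennreal (exp (- x\<^sup>2)) \<partial>(lborel::real measure)"
  have lb: "(\<integral>\<^sup>+(x::'a). ennreal (exp (- (norm x)\<^sup>2)) \<partial>lborel) = ?c ^ DIM('a)"
  proof -
    have "(\<integral>\<^sup>+(x::'a). ennreal (exp (- (norm x)\<^sup>2)) \<partial>lborel)
        = (\<integral>\<^sup>+(x::'a). (\<Prod>i\<in>Basis. ennreal (exp (- (x \<bullet> i)\<^sup>2))) \<partial>lborel)"
      by (simp add: prod_ennreal exp_sum[symmetric] sum_negf norm_square_Basis)
    also have "\<dots> = ?c ^ DIM('a)"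
      by (subst nn_integral_lborel_prod) auto
    finally show ?thesis .
  qed
  have "(\<integral>\<^sup>+x. ennreal (exp (- (norm x)\<^sup>2)) \<partial>?\<mu>)
      = (\<integral>\<^sup>+t. ennreal (exp (- (norm (frame_sum b ?I t))\<^sup>2)) \<partial>leb_prod ?I)"
    by (subst nn_integral_distr) auto
  also have "\<dots> = (\<integral>\<^sup>+t. (\<Prod>k\<in>?I. ennreal (exp (- (t k)\<^sup>2))) \<partial>leb_prod ?I)"
    by (simp add: norm_frame_sum[OF b] prod_ennreal exp_sum[symmetric] sum_negf)
  also have "\<dots> = ?c ^ DIM('a)"
    by (subst lebprod.product_nn_integral_prod) auto
  finally show "(\<integral>\<^sup>+x. ennreal (exp (- (norm x)\<^sup>2)) \<partial>?\<mu>) = (\<integral>\<^sup>+(x::'a). ennreal (exp (- (norm x)\<^sup>2)) \<partial>lborel)"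
    by (simp add: lb)
  show "(\<integral>\<^sup>+(x::'a). ennreal (exp (- (norm x)\<^sup>2)) \<partial>lborel) \<noteq> \<infinity>"
    using nn_integral_exp_square_finite by (simp add: lb power_eq_top_ennreal)
qed

subsection \<open>Hyperplane integrals of rapidly decaying functions\<close>

lemma orthonormal_basis_exists:
  fixes \<omega> :: "'a::euclidean_space"
  assumes "norm \<omega> = 1"
  obtains b where "orthonormal_basis b" "b 0 = \<omega>"
proof -
  obtain S where S: "\<omega> \<in> S" "pairwise orthogonal S" "\<And>x. x \<in> S \<Longrightarrow> norm x = 1"
    "independent S" "card S = DIM('a)" "span S = UNIV"
    using vector_in_orthonormal_basis[OF assms] by metis
  have "finite S"
    using S(5) DIM_positive by (metis card.infinite less_irrefl)
  then obtain h where h: "bij_betw h {0..<DIM('a)} S"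
    using ex_bij_betw_nat_finite S(5) by metis
  then obtain i where i: "i < DIM('a)" "h i = \<omega>"
    using S(1) by (auto simp: bij_betw_def image_iff)
  define b where "b = h \<circ> Transposition.transpose 0 i"
  have "bij_betw (Transposition.transpose 0 i) {0..<DIM('a)} {0..<DIM('a)}"
    using i by (intro permutes_imp_bij permutes_swap_id) auto
  then have b: "bij_betw b {0..<DIM('a)} S"
    unfolding b_def using h by (rule bij_betw_trans)
  show ?thesis
  proof
    have "b j \<bullet> b k = (if j = k then 1 else 0)" if "j < DIM('a)" "k < DIM('a)" for j k
    proof (cases "j = k")
      case True
      then show ?thesis
        using S(3)[of "b k"] b that by (auto simp: bij_betw_def norm_eq_1)
    next
      case False
      then have "b j \<noteq> b k"
        using b that by (auto simp: bij_betw_def inj_on_def)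
      then show ?thesis
        using S(2) b that False by (auto simp: bij_betw_def pairwise_def orthogonal_def)
    qed
    moreover have "b ` {..<DIM('a)} = S"
      using b by (simp add: bij_betw_def atLeast0LessThan)
    ultimately show "orthonormal_basis b"
      using S(6) by (simp add: orthonormal_basis_def)
    show "b 0 = \<omega>"
      using i by (simp add: b_def)
  qed
qed

text \<open>The exponent is the full dimension, so that the weight is dominated by the product of 1
  / (1 + t_k^2) over any set of coordinates. One majorant thus serves the whole space and all
  hyperplanes.\<close>

definition weight :: "'a::euclidean_space \<Rightarrow> real" where
  "weight x = 1 / (1 + (norm x)\<^sup>2) ^ DIM('a)"

lemma weight_pos [simp]: "0 < weight x"
  by (simp add: weight_def add_pos_nonneg)

lemma weight_nonneg [simp]: "0 \<le> weight x"
  by (simp add: less_imp_le)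

lemma continuous_on_weight [continuous_intros]: "continuous_on S weight"
  unfolding weight_def
  by (intro continuous_intros ballI power_not_zero) (smt (verit) zero_le_power2)

lemma borel_measurable_weight [measurable]: "weight \<in> borel_measurable borel"
  by (intro borel_measurable_continuous_onI continuous_intros)

text \<open>Peetre's inequality: moving the argument costs a factor that depends only on the
  displacement. Bounds at \<open>x + s *\<^sub>R v\<close> can therefore be replaced by bounds at
  \<open>x\<close>, uniformly for bounded \<open>s\<close>, as dominated convergence
  demands.\<close>

lemma weight_add_le:
  fixes y z :: "'a::euclidean_space"
  shows "weight (y + z) \<le> (2 * (1 + (norm y)\<^sup>2)) ^ DIM('a) * weight z"
proof -
  have "norm z \<le> norm y + norm (y + z)"
    by (metis add_diff_cancel_left' norm_triangle_ineq4 add.commute)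
  then have "(norm z)\<^sup>2 \<le> (norm y + norm (y + z))\<^sup>2"
    by (simp add: power_mono)
  also have "\<dots> \<le> 2 * (norm y)\<^sup>2 + 2 * (norm (y + z))\<^sup>2"
    using zero_le_power2[of "norm y - norm (y + z)"] by (simp add: power2_eq_square algebra_simps)
  finally have "(norm z)\<^sup>2 \<le> 2 * (norm y)\<^sup>2 + 2 * (norm (y + z))\<^sup>2" .
  then have "1 + (norm z)\<^sup>2 \<le> (2 * (1 + (norm y)\<^sup>2)) * (1 + (norm (y + z))\<^sup>2)"
  proof -
    have "(2 * (1 + (norm y)\<^sup>2)) * (1 + (norm (y + z))\<^sup>2)
        = 2 + 2 * (norm y)\<^sup>2 + 2 * (norm (y + z))\<^sup>2 + 2 * ((norm y)\<^sup>2 * (norm (y + z))\<^sup>2)"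
      by (simp add: algebra_simps)
    moreover have "0 \<le> (norm y)\<^sup>2 * (norm (y + z))\<^sup>2"
      by simp
    ultimately show ?thesis
      using \<open>(norm z)\<^sup>2 \<le> 2 * (norm y)\<^sup>2 + 2 * (norm (y + z))\<^sup>2\<close> by linarith
  qed
  then have "(1 + (norm z)\<^sup>2) ^ DIM('a) \<le> ((2 * (1 + (norm y)\<^sup>2)) * (1 + (norm (y + z))\<^sup>2)) ^ DIM('a)"
    by (intro power_mono) (auto intro: add_nonneg_nonneg)
  moreover have "0 < (1 + (norm z)\<^sup>2) ^ DIM('a)" "0 < (1 + (norm (y + z))\<^sup>2) ^ DIM('a)"
    by (auto intro!: zero_less_power add_pos_nonneg)
  ultimately show ?thesis
    unfolding weight_def power_mult_distrib[of "2 * (1 + (norm y)\<^sup>2)"]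
    by (simp only: divide_simps) (simp add: mult_ac)
qed

lemma integrable_inverse_one_plus_square: "integrable lborel (\<lambda>t::real. 1 / (1 + t\<^sup>2))"
  using integrable_inverse_1_plus_square
  by (simp add: set_integrable_def einterval_def inverse_eq_divide)

lemma integrable_weight_frame:
  fixes b :: "nat \<Rightarrow> 'a::euclidean_space"
  assumes b: "orthonormal_basis b" and I: "I \<subseteq> {..<DIM('a)}"
  shows "integrable (leb_prod I) (\<lambda>t. weight (y + frame_sum b I t))"
proof (rule Bochner_Integration.integrable_bound)
  have fin: "finite I"
    using I finite_subset by blast
  let ?C = "(2 * (1 + (norm y)\<^sup>2)) ^ DIM('a)"
  show "integrable (leb_prod I) (\<lambda>t. ?C * (\<Prod>k\<in>I. 1 / (1 + (t k)\<^sup>2)))"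
    by (intro integrable_mult_right lebprod.product_integrable_prod fin integrable_inverse_one_plus_square)
  show "(\<lambda>t. weight (y + frame_sum b I t)) \<in> borel_measurable (leb_prod I)"
    by measurable
  have "weight (y + frame_sum b I t) \<le> ?C * (\<Prod>k\<in>I. 1 / (1 + (t k)\<^sup>2))" for t
  proof -
    let ?n = "(norm (frame_sum b I t))\<^sup>2"
    have "(\<Prod>k\<in>I. 1 + (t k)\<^sup>2) \<le> (\<Prod>k\<in>I. 1 + ?n)"
      using fin by (intro prod_mono) (auto simp: norm_frame_sum[OF b I] intro: member_le_sum)
    also have "\<dots> = (1 + ?n) ^ card I"
      by simp
    also have "\<dots> \<le> (1 + ?n) ^ DIM('a)"
      using card_mono[OF _ I] by (intro power_increasing) auto
    finally have "weight (frame_sum b I t) \<le> (\<Prod>k\<in>I. 1 / (1 + (t k)\<^sup>2))"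
      unfolding weight_def prod_dividef
      by (simp, intro divide_left_mono mult_pos_pos)
        (auto intro!: prod_pos add_pos_nonneg zero_less_power)
    then show ?thesis
      by (intro order_trans[OF weight_add_le] mult_left_mono) auto
  qed
  then show "AE t in leb_prod I. norm (weight (y + frame_sum b I t))
      \<le> norm (?C * (\<Prod>k\<in>I. 1 / (1 + (t k)\<^sup>2)))"
    by (smt (verit) AE_I2 real_norm_def weight_nonneg)
qed

text \<open>A working class between Schwartz and integrable functions. It also contains Schwartz
  functions times a linear weight and Fourier transforms of Schwartz functions, for which only decay
  is established here. Continuity supplies measurability.\<close>

definition decaying :: "('a::euclidean_space \<Rightarrow> 'b::real_normed_vector) \<Rightarrow> bool" where
  "decaying f \<longleftrightarrow> continuous_on UNIV f \<and> (\<exists>C. \<forall>x. norm (f x) \<le> C * weight x)"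

lemma decayingE:
  assumes "decaying f"
  obtains C where "0 \<le> C" "\<And>x. norm (f x) \<le> C * weight x"
proof -
  obtain C where C: "\<And>x. norm (f x) \<le> C * weight x"
    using assms by (auto simp: decaying_def)
  have "0 \<le> C * weight (0::'a)"
    using C[of 0] norm_ge_zero order_trans by blast
  then have "0 \<le> C"
    using weight_pos[of "0::'a"] by (simp add: zero_le_mult_iff not_le[symmetric] del: weight_pos)
  then show ?thesis
    using C that by blast
qed

lemma decaying_measurable: "decaying f \<Longrightarrow> f \<in> borel_measurable borel"
  by (simp add: decaying_def borel_measurable_continuous_onI)

lemma decaying_bounded_linear:
  assumes "bounded_linear T" "decaying f"
  shows "decaying (\<lambda>x. T (f x))"
proof -
  obtain C where C: "\<And>x. norm (f x) \<le> C * weight x"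
    using assms(2) by (auto simp: decaying_def)
  obtain K where K: "0 \<le> K" "\<And>x. norm (T x) \<le> norm x * K"
    using bounded_linear.nonneg_bounded[OF assms(1)] by blast
  have "norm (T (f x)) \<le> (C * K) * weight x" for x
    using order_trans[OF K(2) mult_right_mono[OF C K(1)]] by (simp add: mult_ac)
  moreover have "continuous_on UNIV (\<lambda>x. T (f x))"
    using assms by (auto simp: decaying_def intro: bounded_linear.continuous_on)
  ultimately show ?thesis
    by (auto simp: decaying_def)
qed

lemma decaying_add:
  assumes "decaying f" "decaying g"
  shows "decaying (\<lambda>x. f x + g x)"
proof -
  obtain C D where "\<And>x. norm (f x) \<le> C * weight x" "\<And>x. norm (g x) \<le> D * weight x"
    using assms by (auto simp: decaying_def)
  then have "norm (f x + g x) \<le> (C + D) * weight x" for x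
    by (intro order_trans[OF norm_triangle_ineq]) (simp add: distrib_right add_mono)
  then show ?thesis
    using assms by (auto simp: decaying_def intro!: continuous_intros)
qed

lemma integrable_decaying_frame:
  fixes b :: "nat \<Rightarrow> 'a::euclidean_space"
    and f :: "'a \<Rightarrow> 'b::{banach, second_countable_topology}"
  assumes "orthonormal_basis b" "I \<subseteq> {..<DIM('a)}" "decaying f"
  shows "integrable (leb_prod I) (\<lambda>t. f (y + frame_sum b I t))"
proof -
  obtain C where C: "0 \<le> C" "\<And>x. norm (f x) \<le> C * weight x"
    using decayingE[OF assms(3)] by metis
  have [measurable]: "f \<in> borel_measurable borel"
    by (rule decaying_measurable) fact
  show ?thesis
  proof (rule Bochner_Integration.integrable_bound)
    show "integrable (leb_prod I) (\<lambda>t. C * weight (y + frame_sum b I t))"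
      by (intro integrable_mult_right integrable_weight_frame assms)
  qed (use C in auto)
qed

lemma integrable_decaying:
  fixes f :: "'a::euclidean_space \<Rightarrow> 'b::{banach, second_countable_topology}"
  assumes "decaying f"
  shows "integrable lborel f"
proof -
  obtain b :: "nat \<Rightarrow> 'a" where b: "orthonormal_basis b"
    using orthonormal_basis_exists[of "SOME i. i \<in> Basis"] norm_some_Basis by metis
  have [measurable]: "f \<in> borel_measurable borel"
    by (rule decaying_measurable) fact
  show ?thesis
    using integrable_decaying_frame[OF b order_refl assms, of 0]
    by (subst distr_frame_sum_eq_lborel[OF b, symmetric], subst integrable_distr_eq) auto
qed

text \<open>Brings derivatives into the form of a limit of difference quotients, to which dominated
  convergence applies.\<close>

lemma has_vector_derivative_at_iff_quotient:
  "(f has_vector_derivative D) (at x) \<longleftrightarrow> ((\<lambda>h. (1 / h) *\<^sub>R (f (x + h) - f x)) \<longlongrightarrow> D) (at 0)"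
proof -
  have "((\<lambda>h. norm (f (x + h) - f x - h *\<^sub>R D) / norm h) \<longlongrightarrow> 0) (at 0)
      \<longleftrightarrow> ((\<lambda>h. norm ((1 / h) *\<^sub>R (f (x + h) - f x) - D)) \<longlongrightarrow> 0) (at 0)"
  proof (rule filterlim_cong[OF refl refl])
    have "norm (f (x + h) - f x - h *\<^sub>R D) / norm h = norm ((1 / h) *\<^sub>R (f (x + h) - f x) - D)"
      if "h \<noteq> 0" for h
    proof -
      have "(1 / h) *\<^sub>R (f (x + h) - f x) - D = (1 / h) *\<^sub>R (f (x + h) - f x - h *\<^sub>R D)"
        using that by (simp add: scaleR_diff_right)
      then show ?thesis
        by simp
    qed
    then show "\<forall>\<^sub>F h in at 0. norm (f (x + h) - f x - h *\<^sub>R D) / norm h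
        = norm ((1 / h) *\<^sub>R (f (x + h) - f x) - D)"
      by (auto simp: eventually_at_filter)
  qed
  then show ?thesis
    by (simp add: has_vector_derivative_def has_derivative_at bounded_linear_scaleR_left
        tendsto_norm_zero_iff Lim_null[of _ D])
qed

text \<open>Differentiation under the integral sign, by dominated convergence of difference quotients.\<close>

lemma has_vector_derivative_frame_integral:
  fixes b :: "nat \<Rightarrow> 'a::euclidean_space"
    and f :: "'a \<Rightarrow> 'b::{banach, second_countable_topology}"
  assumes b: "orthonormal_basis b" and I: "I \<subseteq> {..<DIM('a)}"
    and f: "decaying f" and f': "\<And>x. (f has_derivative f' x) (at x)"
    and dec: "decaying (\<lambda>x. f' x v)"
  shows "((\<lambda>s. \<integral>t. f (y + s *\<^sub>R v + frame_sum b I t) \<partial>leb_prod I) has_vector_derivative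
           (\<integral>t. f' (y + s0 *\<^sub>R v + frame_sum b I t) v \<partial>leb_prod I)) (at s0)"
proof -
  define x where "x t = y + s0 *\<^sub>R v + frame_sum b I t" for t
  let ?M = "leb_prod I"
  have [measurable]: "x \<in> borel_measurable ?M"
    unfolding x_def by measurable
  have [measurable]: "f \<in> borel_measurable borel" "(\<lambda>x. f' x v) \<in> borel_measurable borel"
    using f dec by (auto intro: decaying_measurable)
  obtain C where C: "0 \<le> C" "\<And>x. norm (f' x v) \<le> C * weight x"
    using decayingE[OF dec] by metis
  \<comment> \<open>The factor is that of \<open>weight_add_le\<close> for displacements of norm at
    most \<open>norm v\<close>. The mean value inequality along the segment then bounds all
    difference quotients with step at most 1 by a single multiple of
    \<open>weight z\<close>.\<close>
  define K where "K = C * (2 * (1 + (norm v)\<^sup>2)) ^ DIM('a)"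
  have bound: "norm (f (z + s *\<^sub>R v) - f z) \<le> \<bar>s\<bar> * (K * weight z)" if "\<bar>s\<bar> \<le> 1" for s z
  proof -
    define g where "g r = f (z + r *\<^sub>R v)" for r
    have "norm (g s - g 0) \<le> (K * weight z) * norm (s - 0)"
    proof (rule differentiable_bound)
      show "convex {-1..1::real}" by simp
      fix r :: real assume r: "r \<in> {-1..1}"
      show "(g has_derivative (\<lambda>h. h *\<^sub>R f' (z + r *\<^sub>R v) v)) (at r within {-1..1})"
      proof -
        have "((\<lambda>r. z + r *\<^sub>R v) has_derivative (\<lambda>h. h *\<^sub>R v)) (at r within {-1..1})"
          by (auto intro!: derivative_eq_intros)
        from has_derivative_compose[OF this f']
        show ?thesis
          unfolding g_def using linear_scale[OF has_derivative_linear[OF f']] by simp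
      qed
      have "norm (f' (z + r *\<^sub>R v) v) \<le> C * weight (r *\<^sub>R v + z)"
        using C(2)[of "z + r *\<^sub>R v"] by (simp add: add.commute)
      also have "\<dots> \<le> C * ((2 * (1 + (norm (r *\<^sub>R v))\<^sup>2)) ^ DIM('a) * weight z)"
        by (intro mult_left_mono weight_add_le C)
      also have "\<dots> \<le> C * ((2 * (1 + (norm v)\<^sup>2)) ^ DIM('a) * weight z)"
      proof -
        have "norm (r *\<^sub>R v) \<le> norm v"
          using r by (auto intro!: mult_left_le_one_le)
        then have "(norm (r *\<^sub>R v))\<^sup>2 \<le> (norm v)\<^sup>2"
          by (intro power_mono) auto
        then show ?thesis
          by (intro mult_left_mono mult_right_mono power_mono) (auto simp: C)
      qed
      finally have "norm (f' (z + r *\<^sub>R v) v) \<le> C * ((2 * (1 + (norm v)\<^sup>2)) ^ DIM('a) * weight z)" .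
      then show "onorm (\<lambda>h. h *\<^sub>R f' (z + r *\<^sub>R v) v) \<le> K * weight z"
      proof (intro onorm_le)
        fix h :: real
        assume "norm (f' (z + r *\<^sub>R v) v) \<le> C * ((2 * (1 + (norm v)\<^sup>2)) ^ DIM('a) * weight z)"
        then have "\<bar>h\<bar> * norm (f' (z + r *\<^sub>R v) v) \<le> \<bar>h\<bar> * (K * weight z)"
          by (intro mult_left_mono) (simp_all add: K_def mult_ac)
        then show "norm (h *\<^sub>R f' (z + r *\<^sub>R v) v) \<le> K * weight z * norm h"
          by (simp add: mult_ac)
      qed
    qed (use that in auto)
    then show ?thesis
      by (simp add: g_def mult_ac)
  qed
  have intf: "integrable ?M (\<lambda>t. f (z + frame_sum b I t))" for z
    by (rule integrable_decaying_frame[OF b I f])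
  \<comment> \<open>Steps are confined to (-1, 1) so that \<open>bound\<close> covers every term of
    the sequence; at the interior point 0 this does not change the limit.\<close>
  have "((\<lambda>h. (1 / h) *\<^sub>R ((\<integral>t. f (x t + h *\<^sub>R v) \<partial>?M) - (\<integral>t. f (x t) \<partial>?M)))
      \<longlongrightarrow> (\<integral>t. f' (x t) v \<partial>?M)) (at 0 within {-1<..<1})"
    unfolding tendsto_at_iff_sequentially
  proof (intro allI impI)
    fix X :: "nat \<Rightarrow> real" assume X: "\<forall>i. X i \<in> {-1<..<1} - {0}" "X \<longlonglongrightarrow> 0"
    have "(\<lambda>i. \<integral>t. (1 / X i) *\<^sub>R (f (x t + X i *\<^sub>R v) - f (x t)) \<partial>?M) \<longlonglongrightarrow> (\<integral>t. f' (x t) v \<partial>?M)"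
    proof (rule integral_dominated_convergence)
      show "integrable ?M (\<lambda>t. K * weight (x t))"
        unfolding x_def by (intro integrable_mult_right integrable_weight_frame b I)
      show "AE t in ?M. (\<lambda>i. (1 / X i) *\<^sub>R (f (x t + X i *\<^sub>R v) - f (x t))) \<longlonglongrightarrow> f' (x t) v"
      proof (rule AE_I2)
        fix t
        have "((\<lambda>h. f (x t + h *\<^sub>R v)) has_vector_derivative f' (x t) v) (at 0)"
        proof -
          have "((\<lambda>h. x t + h *\<^sub>R v) has_derivative (\<lambda>h. h *\<^sub>R v)) (at 0)"
            by (auto intro!: derivative_eq_intros)
          from has_derivative_compose[OF this f']
          show ?thesis
            using linear_scale[OF has_derivative_linear[OF f']] 
            by (simp add: has_vector_derivative_def)
        qed
        then have "((\<lambda>h. (1 / h) *\<^sub>R (f (x t + h *\<^sub>R v) - f (x t))) \<longlongrightarrow> f' (x t) v) (at 0)"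
          by (simp add: has_vector_derivative_at_iff_quotient)
        then show "(\<lambda>i. (1 / X i) *\<^sub>R (f (x t + X i *\<^sub>R v) - f (x t))) \<longlonglongrightarrow> f' (x t) v"
          by (rule filterlim_compose)
            (use X in \<open>auto simp: filterlim_at eventually_sequentially\<close>)
      qed
      show "AE t in ?M. norm ((1 / X i) *\<^sub>R (f (x t + X i *\<^sub>R v) - f (x t))) \<le> K * weight (x t)" for i
      proof (rule AE_I2)
        fix t
        have "X i \<noteq> 0" "\<bar>X i\<bar> \<le> 1"
          using X(1) by (auto simp: abs_le_iff less_imp_le dest: spec[of _ i])
        then show "norm ((1 / X i) *\<^sub>R (f (x t + X i *\<^sub>R v) - f (x t))) \<le> K * weight (x t)"
          using bound[of "X i" "x t"]
          by (simp add: divide_le_eq mult_ac del: scaleR_diff_right)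
      qed
    qed measurable
    moreover have "(\<integral>t. f (x t + X i *\<^sub>R v) - f (x t) \<partial>?M)
        = (\<integral>t. f (x t + X i *\<^sub>R v) \<partial>?M) - (\<integral>t. f (x t) \<partial>?M)" for i
      using intf[of "y + s0 *\<^sub>R v + X i *\<^sub>R v"] intf[of "y + s0 *\<^sub>R v"]
      by (simp add: x_def add_ac)
    ultimately show "((\<lambda>h. (1 / h) *\<^sub>R ((\<integral>t. f (x t + h *\<^sub>R v) \<partial>?M) - (\<integral>t. f (x t) \<partial>?M))) \<circ> X)
        \<longlonglongrightarrow> (\<integral>t. f' (x t) v \<partial>?M)"
      by (simp add: comp_def)
  qed
  then have lim: "((\<lambda>h. (1 / h) *\<^sub>R ((\<integral>t. f (x t + h *\<^sub>R v) \<partial>?M) - (\<integral>t. f (x t) \<partial>?M)))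
      \<longlongrightarrow> (\<integral>t. f' (x t) v \<partial>?M)) (at 0)"
    by (simp add: at_within_open[of 0 "{-1<..<1}"])
  show ?thesis
    using lim by (simp add: has_vector_derivative_at_iff_quotient x_def algebra_simps)
qed

lemma measurable_insert_leb_prod:
  "(\<lambda>(p, t). \<lambda>k\<in>insert i J. if k = i then p else t k)
    \<in> lborel \<Otimes>\<^sub>M leb_prod J \<rightarrow>\<^sub>M leb_prod (insert i J)"
  unfolding split_beta'
proof (rule measurable_restrict)
  fix k assume k: "k \<in> insert i J"
  show "(\<lambda>x. if k = i then fst x else snd x k) \<in> lborel \<Otimes>\<^sub>M leb_prod J \<rightarrow>\<^sub>M lborel"
  proof (cases "k = i")
    case False
    then have "(\<lambda>t. t k) \<in> leb_prod J \<rightarrow>\<^sub>M lborel"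
      using k by (intro measurable_component_singleton) auto
    then show ?thesis
      using False measurable_compose[OF measurable_snd] by simp
  qed simp
qed

lemma distr_pair_leb_prod:
  assumes "finite J" "i \<notin> J"
  shows "distr (lborel \<Otimes>\<^sub>M leb_prod J) (leb_prod (insert i J))
      (\<lambda>(p, t). \<lambda>k\<in>insert i J. if k = i then p else t k) = leb_prod (insert i J)"
    (is "distr ?P ?Q ?T = _")
proof (rule lebprod.PiM_eqI)
  interpret J: sigma_finite_measure "leb_prod J"
    by (simp add: sigma_finite_leb_prod assms)
  fix A :: "nat \<Rightarrow> real set" assume A: "\<And>k. k \<in> insert i J \<Longrightarrow> A k \<in> sets lborel"
  have "?T -` Pi\<^sub>E (insert i J) A \<inter> space ?P = A i \<times> Pi\<^sub>E J A"
    using assms(2) by (auto simp: space_pair_measure space_PiM PiE_iff) metis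
  moreover have "emeasure (distr ?P ?Q ?T) (Pi\<^sub>E (insert i J) A)
      = emeasure ?P (?T -` Pi\<^sub>E (insert i J) A \<inter> space ?P)"
    using A assms(1) by (intro emeasure_distr measurable_insert_leb_prod sets_PiM_I_finite) auto
  ultimately have "emeasure (distr ?P ?Q ?T) (Pi\<^sub>E (insert i J) A) = emeasure ?P (A i \<times> Pi\<^sub>E J A)"
    by simp
  also have "\<dots> = emeasure lborel (A i) * emeasure (leb_prod J) (Pi\<^sub>E J A)"
    using A assms by (intro J.emeasure_pair_measure_Times sets_PiM_I_finite) auto
  also have "emeasure (leb_prod J) (Pi\<^sub>E J A) = (\<Prod>k\<in>J. emeasure lborel (A k))"
    using A assms by (intro lebprod.emeasure_PiM) auto
  also have "emeasure lborel (A i) * \<dots> = (\<Prod>k\<in>insert i J. emeasure lborel (A k))"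
    using assms by simp
  finally show "emeasure (distr ?P ?Q ?T) (Pi\<^sub>E (insert i J) A) = (\<Prod>k\<in>insert i J. emeasure lborel (A k))" .
qed (use assms in auto)

text \<open>Fubini over the parallel hyperplanes orthogonal to \<open>b 0\<close>: coordinate 0 is
  split off as \<open>p\<close> and the remaining ones carry the area. The Fourier slice theorem
  rests on this.\<close>

lemma distr_hyperplanes_eq_lborel:
  fixes b :: "nat \<Rightarrow> 'a::euclidean_space"
  assumes b: "orthonormal_basis b"
  shows "distr (lborel \<Otimes>\<^sub>M leb_prod {1..DIM('a) - 1}) borel
    (\<lambda>(p, t). p *\<^sub>R b 0 + frame_sum b {1..DIM('a) - 1} t) = lborel"
proof -
  define J where "J = {1..DIM('a) - 1}"
  have J: "{..<DIM('a)} = insert 0 J" "finite J" "0 \<notin> J"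
    using DIM_positive[where 'a='a] by (auto simp: J_def)
  let ?T = "\<lambda>(p, t). \<lambda>k\<in>insert 0 J. if k = 0 then p else t k"
  have "lborel = distr (leb_prod (insert 0 J)) borel (frame_sum b (insert 0 J))"
    using distr_frame_sum_eq_lborel[OF b, symmetric] by (simp only: J)
  also have "leb_prod (insert 0 J) = distr (lborel \<Otimes>\<^sub>M leb_prod J) (leb_prod (insert 0 J)) ?T"
    by (rule distr_pair_leb_prod[symmetric]) fact+
  also have "distr \<dots> borel (frame_sum b (insert 0 J))
      = distr (lborel \<Otimes>\<^sub>M leb_prod J) borel (frame_sum b (insert 0 J) \<circ> ?T)"
    by (rule distr_distr[OF measurable_frame_sum measurable_insert_leb_prod])
  also have "frame_sum b (insert 0 J) \<circ> ?T = (\<lambda>(p, t). p *\<^sub>R b 0 + frame_sum b J t)"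
  proof -
    have "(\<Sum>k\<in>J. (if k = 0 then p else t k) *\<^sub>R b k) = frame_sum b J t" for p t
      using J(3) by (intro sum.cong) auto
    then show ?thesis
      using J(2,3) by (auto simp: fun_eq_iff)
  qed
  finally show ?thesis
    by (simp only: J_def)
qed

subsection \<open>Schwartz functions\<close>

text \<open>The head of a list is the last derivative taken, so the derivatives of a derivative of
  \<open>f\<close> belong to lists extended at their end. Closure of the Schwartz class under
  differentiation is read off from this.\<close>

lemma iterated_deriv_append: "iterated_deriv (us @ vs) f = iterated_deriv us (iterated_deriv vs f)"
  by (induction us) auto

lemma schwartzI:
  assumes "\<And>vs x. vs \<in> lists Basis \<Longrightarrow> iterated_deriv vs f differentiable (at x)"
    and "\<And>vs m. vs \<in> lists Basis \<Longrightarrow> \<exists>C. \<forall>x. norm x ^ m * norm (iterated_deriv vs f x) \<le> C"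
  shows "schwartz f"
  using assms by (auto simp: schwartz_def smooth_def)

lemma schwartz_differentiable:
  "schwartz f \<Longrightarrow> vs \<in> lists Basis \<Longrightarrow> iterated_deriv vs f differentiable (at x)"
  by (auto simp: schwartz_def smooth_def)

lemma schwartz_bound:
  assumes "schwartz f" "vs \<in> lists Basis"
  obtains C where "\<And>x. norm x ^ m * norm (iterated_deriv vs f x) \<le> C"
proof -
  have "\<exists>C. \<forall>x. norm x ^ m * norm (iterated_deriv vs f x) \<le> C"
    using assms by (simp add: schwartz_def)
  then show ?thesis
    using that by blast
qed

lemma schwartz_has_derivative:
  "schwartz f \<Longrightarrow> (f has_derivative frechet_derivative f (at x)) (at x)"
  using schwartz_differentiable[of f "[]"] by (simp add: frechet_derivative_works)

lemma schwartz_frechet_derivative: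
  fixes f :: "'a::euclidean_space \<Rightarrow> 'b::real_normed_vector"
  assumes "schwartz f" "v \<in> Basis"
  shows "schwartz (\<lambda>x. frechet_derivative f (at x) v)"
proof -
  have eq: "iterated_deriv vs (\<lambda>x. frechet_derivative f (at x) v) = iterated_deriv (vs @ [v]) f" for vs
    by (simp add: iterated_deriv_append)
  show ?thesis
  proof (rule schwartzI; unfold eq)
    fix vs x m assume "vs \<in> lists (Basis :: 'a set)"
    then have vs: "vs @ [v] \<in> lists Basis"
      using assms(2) by simp
    show "iterated_deriv (vs @ [v]) f differentiable at x"
      by (rule schwartz_differentiable[OF assms(1) vs])
    show "\<exists>C. \<forall>x. norm x ^ m * norm (iterated_deriv (vs @ [v]) f x) \<le> C"
      using schwartz_bound[OF assms(1) vs] by metis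
  qed
qed

lemma iterated_deriv_bounded_linear:
  assumes "bounded_linear T" "schwartz f" "vs \<in> lists Basis"
  shows "iterated_deriv vs (\<lambda>x. T (f x)) = (\<lambda>x. T (iterated_deriv vs f x))"
  using assms(3)
proof (induction vs)
  case (Cons v vs)
  then have vs: "vs \<in> lists Basis"
    by simp
  have "((\<lambda>x. T (iterated_deriv vs f x)) has_derivative
      (\<lambda>h. T (frechet_derivative (iterated_deriv vs f) (at x) h))) (at x)" for x
    using schwartz_differentiable[OF assms(2) vs]
    by (intro bounded_linear.has_derivative[OF assms(1)]) (auto simp: frechet_derivative_works)
  from frechet_derivative_at[OF this, symmetric] show ?case
    by (simp add: Cons.IH)
qed simp

lemma schwartz_bounded_linear:
  fixes f :: "'a::euclidean_space \<Rightarrow> 'b::real_normed_vector"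
  assumes T: "bounded_linear T" and f: "schwartz f"
  shows "schwartz (\<lambda>x. T (f x))"
proof (rule schwartzI)
  fix vs x m assume vs: "vs \<in> lists (Basis :: 'a set)"
  show "iterated_deriv vs (\<lambda>x. T (f x)) differentiable at x"
    unfolding iterated_deriv_bounded_linear[OF T f vs]
    using schwartz_differentiable[OF f vs] bounded_linear.has_derivative[OF T]
    unfolding differentiable_def by blast
  obtain K where K: "0 \<le> K" "\<And>x. norm (T x) \<le> norm x * K"
    using bounded_linear.nonneg_bounded[OF T] by blast
  obtain C where C: "\<And>x. norm x ^ m * norm (iterated_deriv vs f x) \<le> C"
    using schwartz_bound[OF f vs] by metis
  have "norm x ^ m * norm (T (iterated_deriv vs f x)) \<le> C * K" for x
  proof -
    have "norm x ^ m * norm (T (iterated_deriv vs f x)) \<le> norm x ^ m * (norm (iterated_deriv vs f x) * K)"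
      by (intro mult_left_mono K) auto
    also have "\<dots> \<le> C * K"
      using mult_right_mono[OF C K(1)] by (simp add: mult_ac)
    finally show ?thesis .
  qed
  then show "\<exists>C. \<forall>x. norm x ^ m * norm (iterated_deriv vs (\<lambda>x. T (f x)) x) \<le> C"
    unfolding iterated_deriv_bounded_linear[OF T f vs] by blast
qed

lemma iterated_deriv_add:
  assumes "schwartz f" "schwartz g" "vs \<in> lists Basis"
  shows "iterated_deriv vs (\<lambda>x. f x + g x) = (\<lambda>x. iterated_deriv vs f x + iterated_deriv vs g x)"
  using assms(3)
proof (induction vs)
  case (Cons v vs)
  then have vs: "vs \<in> lists Basis"
    by simp
  have "((\<lambda>x. iterated_deriv vs f x + iterated_deriv vs g x) has_derivative
      (\<lambda>h. frechet_derivative (iterated_deriv vs f) (at x) h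
          + frechet_derivative (iterated_deriv vs g) (at x) h)) (at x)" for x
    using schwartz_differentiable[OF assms(1) vs] schwartz_differentiable[OF assms(2) vs]
    by (intro has_derivative_add) (auto simp: frechet_derivative_works)
  from frechet_derivative_at[OF this, symmetric] show ?case
    by (simp add: Cons.IH)
qed simp

lemma schwartz_add:
  fixes f :: "'a::euclidean_space \<Rightarrow> 'b::real_normed_vector"
  assumes f: "schwartz f" and g: "schwartz g"
  shows "schwartz (\<lambda>x. f x + g x)"
proof (rule schwartzI)
  fix vs x m assume vs: "vs \<in> lists (Basis :: 'a set)"
  show "iterated_deriv vs (\<lambda>x. f x + g x) differentiable at x"
    unfolding iterated_deriv_add[OF f g vs]
    using schwartz_differentiable[OF f vs] schwartz_differentiable[OF g vs] by simp
  obtain C where C: "\<And>x. norm x ^ m * norm (iterated_deriv vs f x) \<le> C"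
    using schwartz_bound[OF f vs] by metis
  obtain D where D: "\<And>x. norm x ^ m * norm (iterated_deriv vs g x) \<le> D"
    using schwartz_bound[OF g vs] by metis
  have "norm x ^ m * norm (iterated_deriv vs f x + iterated_deriv vs g x) \<le> C + D" for x
  proof -
    have "norm x ^ m * norm (iterated_deriv vs f x + iterated_deriv vs g x)
        \<le> norm x ^ m * (norm (iterated_deriv vs f x) + norm (iterated_deriv vs g x))"
      by (intro mult_left_mono norm_triangle_ineq) auto
    also have "\<dots> \<le> C + D"
      using add_mono[OF C D] by (simp add: distrib_left)
    finally show ?thesis .
  qed
  then show "\<exists>C. \<forall>x. norm x ^ m * norm (iterated_deriv vs (\<lambda>x. f x + g x) x) \<le> C"
    unfolding iterated_deriv_add[OF f g vs] by blast
qed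

lemma iterated_deriv_0: "iterated_deriv vs (\<lambda>x. 0) = (\<lambda>x. 0)"
proof (induction vs)
  case (Cons v vs)
  then show ?case
    by (simp only: iterated_deriv.simps frechet_derivative_const)
qed simp

lemma schwartz_0: "schwartz (\<lambda>x. 0)"
  by (rule schwartzI) (auto simp: iterated_deriv_0)

lemma schwartz_sum: "(\<And>i. i \<in> A \<Longrightarrow> schwartz (f i)) \<Longrightarrow> schwartz (\<lambda>x. \<Sum>i\<in>A. f i x)"
  by (induction A rule: infinite_finite_induct) (auto simp: schwartz_0 schwartz_add)

text \<open>Trades the weight for the two monomials, of degree 0 and 2d, that a Schwartz bound
  controls.\<close>

lemma one_plus_square_power_le:
  fixes r :: real
  assumes "0 \<le> r"
  shows "(1 + r\<^sup>2) ^ d \<le> 2 ^ d * (1 + r ^ (2 * d))"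
proof (cases "r \<le> 1")
  case True
  then have "r\<^sup>2 \<le> 1"
    using assms by (simp add: power_le_one)
  then have "(1 + r\<^sup>2) ^ d \<le> 2 ^ d"
    by (intro power_mono) auto
  also have "\<dots> \<le> 2 ^ d * (1 + r ^ (2 * d))"
    using assms by simp
  finally show ?thesis .
next
  case False
  then have "1 \<le> r\<^sup>2"
    by simp
  then have "(1 + r\<^sup>2) ^ d \<le> (2 * r\<^sup>2) ^ d"
    by (intro power_mono) auto
  also have "\<dots> \<le> 2 ^ d * (1 + r ^ (2 * d))"
    by (simp add: power_mult_distrib power_mult)
  finally show ?thesis .
qed

text \<open>Only the size of the function enters, not that of its derivatives; hence the criterion
  also covers Fourier transforms and products with a linear weight.\<close>

lemma decaying_if_rapid:
  fixes f :: "'a::euclidean_space \<Rightarrow> 'b::real_normed_vector"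
  assumes "continuous_on UNIV f" and bound: "\<And>m. \<exists>C. \<forall>x. norm x ^ m * norm (f x) \<le> C"
  shows "decaying f"
proof -
  obtain C where C: "\<And>x. norm x ^ 0 * norm (f x) \<le> C"
    using bound[of 0] by blast
  obtain D where D: "\<And>x. norm x ^ (2 * DIM('a)) * norm (f x) \<le> D"
    using bound[of "2 * DIM('a)"] by blast
  have "norm (f x) \<le> (2 ^ DIM('a) * (C + D)) * weight x" for x
  proof -
    have "(1 + (norm x)\<^sup>2) ^ DIM('a) * norm (f x) \<le> (2 ^ DIM('a) * (1 + norm x ^ (2 * DIM('a)))) * norm (f x)"
      by (intro mult_right_mono one_plus_square_power_le) auto
    also have "\<dots> = 2 ^ DIM('a) * (norm x ^ 0 * norm (f x) + norm x ^ (2 * DIM('a)) * norm (f x))"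
      by (simp add: algebra_simps)
    also have "\<dots> \<le> 2 ^ DIM('a) * (C + D)"
      by (intro mult_left_mono add_mono C D) auto
    finally have "(1 + (norm x)\<^sup>2) ^ DIM('a) * norm (f x) \<le> 2 ^ DIM('a) * (C + D)" .
    moreover have "0 < (1 + (norm x)\<^sup>2) ^ DIM('a)"
      by (intro zero_less_power add_pos_nonneg) auto
    ultimately show ?thesis
      by (simp add: weight_def pos_le_divide_eq mult.commute)
  qed
  then show ?thesis
    using assms(1) by (auto simp: decaying_def)
qed

lemma schwartz_continuous: "schwartz f \<Longrightarrow> continuous_on S f"
  by (intro continuous_at_imp_continuous_on ballI has_derivative_continuous[OF schwartz_has_derivative])

lemma schwartz_decaying:
  assumes "schwartz f"
  shows "decaying f"
proof (rule decaying_if_rapid)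
  show "\<exists>C. \<forall>x. norm x ^ m * norm (f x) \<le> C" for m
    using schwartz_bound[OF assms, of "[]" m] by auto
qed (rule schwartz_continuous[OF assms])

lemma schwartz_decaying_linear:
  fixes f :: "'a::euclidean_space \<Rightarrow> real"
  assumes f: "schwartz f"
  shows "decaying (\<lambda>x. (c \<bullet> x) * f x)"
proof (rule decaying_if_rapid)
  show "continuous_on UNIV (\<lambda>x. (c \<bullet> x) * f x)"
    by (intro continuous_intros schwartz_continuous f)
  fix m
  obtain C where C: "\<And>x. norm x ^ Suc m * norm (f x) \<le> C"
    using schwartz_bound[OF f, of "[]" "Suc m"] by auto
  have "norm x ^ m * norm ((c \<bullet> x) * f x) \<le> norm c * C" for x
  proof -
    have "norm x ^ m * norm ((c \<bullet> x) * f x) \<le> norm x ^ m * ((norm c * norm x) * norm (f x))"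
      unfolding norm_mult by (intro mult_left_mono mult_right_mono) (auto simp: Cauchy_Schwarz_ineq2)
    also have "\<dots> = norm c * (norm x ^ Suc m * norm (f x))"
      by simp
    also have "\<dots> \<le> norm c * C"
      by (intro mult_left_mono C) auto
    finally show ?thesis .
  qed
  then show "\<exists>C. \<forall>x. norm x ^ m * norm ((c \<bullet> x) * f x) \<le> C"
    by blast
qed

text \<open>The Schwartz class is defined by derivatives along \<open>Basis\<close>, whereas the
  vectors of a frame point anywhere; linearity of the derivative in its direction closes the
  gap.\<close>

lemma schwartz_frechet_derivative_direction:
  fixes f :: "'a::euclidean_space \<Rightarrow> 'b::real_normed_vector"
  assumes "schwartz f"
  shows "schwartz (\<lambda>x. frechet_derivative f (at x) v)"
proof -
  have "frechet_derivative f (at x) v = (\<Sum>i\<in>Basis. (v \<bullet> i) *\<^sub>R frechet_derivative f (at x) i)" for x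
  proof -
    have lin: "linear (frechet_derivative f (at x))"
      using schwartz_has_derivative[OF assms] has_derivative_linear by blast
    have "frechet_derivative f (at x) v = frechet_derivative f (at x) (\<Sum>i\<in>Basis. (v \<bullet> i) *\<^sub>R i)"
      by (simp add: euclidean_representation)
    then show ?thesis
      by (simp add: linear_sum[OF lin] linear_scale[OF lin])
  qed
  moreover have "schwartz (\<lambda>x. \<Sum>i\<in>Basis. (v \<bullet> i) *\<^sub>R frechet_derivative f (at x) i)"
  proof (rule schwartz_sum)
    fix i :: 'a assume "i \<in> Basis"
    from schwartz_bounded_linear[OF bounded_linear_scaleR_right schwartz_frechet_derivative[OF assms this]]
    show "schwartz (\<lambda>x. (v \<bullet> i) *\<^sub>R frechet_derivative f (at x) i)" .
  qed
  ultimately show ?thesis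
    by simp
qed

subsection \<open>Differentiating the Radon transform\<close>

text \<open>The difference of the two sides is orthogonal to all basis vectors and lies in their
  span, so it is orthogonal to itself.\<close>

lemma orthonormal_basis_expansion:
  fixes b :: "nat \<Rightarrow> 'a::euclidean_space"
  assumes b: "orthonormal_basis b"
  shows "v = frame_sum b {..<DIM('a)} (\<lambda>k. v \<bullet> b k)"
proof -
  have "v - frame_sum b {..<DIM('a)} (\<lambda>k. v \<bullet> b k) = 0" (is "?w = 0")
  proof -
    have "orthogonal ?w x" if x: "x \<in> b ` {..<DIM('a)}" for x
    proof -
      obtain j where j: "j < DIM('a)" "x = b j"
        using x by auto
      have "frame_sum b {..<DIM('a)} (\<lambda>k. v \<bullet> b k) \<bullet> b j = (\<Sum>k<DIM('a). if k = j then v \<bullet> b j else 0)"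
        unfolding inner_sum_left
        by (intro sum.cong) (use j in \<open>auto simp: orthonormal_basis_inner[OF b]\<close>)
      then show ?thesis
        using j by (simp add: orthogonal_def inner_diff_left)
    qed
    moreover have "?w \<in> span (b ` {..<DIM('a)})"
      using b by (simp add: orthonormal_basis_def)
    ultimately have "orthogonal ?w ?w"
      using orthogonal_to_span by blast
    then show ?thesis
      by (simp add: orthogonal_def)
  qed
  then show ?thesis
    by simp
qed

lemma integral_leb_prod_translate:
  fixes h :: "(nat \<Rightarrow> real) \<Rightarrow> 'b::{banach, second_countable_topology}"
  assumes "finite I" "h \<in> borel_measurable (leb_prod I)"
  shows "(\<integral>t. h (\<lambda>k\<in>I. t k + a k) \<partial>leb_prod I) = (\<integral>t. h t \<partial>leb_prod I)"
proof -
  have "(\<integral>t. h t \<partial>leb_prod I)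
      = (\<integral>t. h t \<partial>distr (leb_prod I) (leb_prod I) (\<lambda>t. \<lambda>k\<in>I. t k + a k))"
    by (simp only: distr_leb_prod_translate[OF assms(1)])
  also have "\<dots> = (\<integral>t. h (\<lambda>k\<in>I. t k + a k) \<partial>leb_prod I)"
    by (rule integral_distr[OF _ assms(2)]) (intro measurable_restrict, simp)
  finally show ?thesis ..
qed

text \<open>
  Translating \<open>t\<close> shows that the integral of \<open>f\<close> does not change when \<open>y\<close> moves along the frame.
\<close>

lemma integral_tangential_derivative_eq_0:
  fixes b :: "nat \<Rightarrow> 'a::euclidean_space"
    and f :: "'a \<Rightarrow> 'b::{banach, second_countable_topology}"
  assumes b: "orthonormal_basis b" and I: "I \<subseteq> {..<DIM('a)}"
    and f: "decaying f" and f': "\<And>x. (f has_derivative f' x) (at x)"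
    and dec: "decaying (\<lambda>x. f' x v)" and v: "v = frame_sum b I a"
  shows "(\<integral>t. f' (y + frame_sum b I t) v \<partial>leb_prod I) = 0"
proof -
  have fin: "finite I"
    using I finite_subset by blast
  have [measurable]: "f \<in> borel_measurable borel"
    by (rule decaying_measurable[OF f])
  have "(\<integral>t. f (y + s *\<^sub>R v + frame_sum b I t) \<partial>leb_prod I) = (\<integral>t. f (y + frame_sum b I t) \<partial>leb_prod I)" for s
  proof -
    have "y + s *\<^sub>R v + frame_sum b I t = y + frame_sum b I (\<lambda>k\<in>I. t k + s * a k)" for t
      by (simp add: v scaleR_sum_right scaleR_add_left sum.distrib add_ac)
    then have "(\<integral>t. f (y + s *\<^sub>R v + frame_sum b I t) \<partial>leb_prod I)
        = (\<integral>t. f (y + frame_sum b I (\<lambda>k\<in>I. t k + s * a k)) \<partial>leb_prod I)"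
      by (simp only:)
    also have "\<dots> = (\<integral>t. f (y + frame_sum b I t) \<partial>leb_prod I)"
      by (rule integral_leb_prod_translate[OF fin, where a = "\<lambda>k. s * a k"]) measurable
    finally show ?thesis .
  qed
  with has_vector_derivative_frame_integral[OF b I f f' dec, where y = y and ?s0.0 = 0]
  have "((\<lambda>s. \<integral>t. f (y + frame_sum b I t) \<partial>leb_prod I) has_vector_derivative
      (\<integral>t. f' (y + frame_sum b I t) v \<partial>leb_prod I)) (at 0)"
    by simp
  then show ?thesis
    using vector_derivative_unique_at has_vector_derivative_const by blast
qed

text \<open>With a full frame every direction is tangential. This is the integration by parts behind
  the Fourier transform of a derivative.\<close>

lemma integral_lborel_derivative_eq_0:
  fixes f :: "'a::euclidean_space \<Rightarrow> 'b::{banach, second_countable_topology}"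
  assumes f: "decaying f" and f': "\<And>x. (f has_derivative f' x) (at x)"
    and dec: "decaying (\<lambda>x. f' x v)"
  shows "(\<integral>x. f' x v \<partial>lborel) = 0"
proof -
  obtain b :: "nat \<Rightarrow> 'a" where b: "orthonormal_basis b"
    using orthonormal_basis_exists[of "SOME i. i \<in> Basis"] norm_some_Basis by metis
  have [measurable]: "(\<lambda>x. f' x v) \<in> borel_measurable borel"
    by (rule decaying_measurable[OF dec])
  have "(\<integral>x. f' x v \<partial>lborel) = (\<integral>t. f' (0 + frame_sum b {..<DIM('a)} t) v \<partial>leb_prod {..<DIM('a)})"
    by (subst distr_frame_sum_eq_lborel[OF b, symmetric], subst integral_distr) auto
  also have "\<dots> = 0"
    by (rule integral_tangential_derivative_eq_0[OF b order_refl f f' dec orthonormal_basis_expansion[OF b]])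
  finally show ?thesis .
qed

text \<open>Exposes the basis selected inside \<open>hyperplane_area\<close>. The selection depends
  on \<open>\<omega>\<close> alone, so one basis serves all \<open>p\<close> and all integrands,
  which is what permits differentiating in \<open>p\<close> and adding integrands.\<close>

lemma radon_eq_frame_integral:
  fixes \<omega> :: "'a::euclidean_space"
  assumes "norm \<omega> = 1"
  obtains b where "orthonormal_basis b" "b 0 = \<omega>"
    "\<And>(f :: 'a \<Rightarrow> real) p. f \<in> borel_measurable borel \<Longrightarrow> radon f \<omega> p
      = (\<integral>t. f (p *\<^sub>R \<omega> + frame_sum b {1..DIM('a) - 1} t) \<partial>leb_prod {1..DIM('a) - 1})"
proof -
  define b where "b = (SOME b. orthonormal_basis b \<and> b 0 = \<omega>)"
  have "\<exists>b. orthonormal_basis b \<and> b 0 = \<omega>"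
    using orthonormal_basis_exists[OF assms] by metis
  then have "orthonormal_basis b \<and> b 0 = \<omega>"
    unfolding b_def by (rule someI_ex[of "\<lambda>b. orthonormal_basis b \<and> b 0 = \<omega>"])
  then have b: "orthonormal_basis b" "b 0 = \<omega>" by auto
  show thesis
  proof (rule that[OF b])
    fix f :: "'a \<Rightarrow> real" and p assume f: "f \<in> borel_measurable borel"
    let ?J = "{1..DIM('a) - 1}"
    have "\<omega> \<bullet> (p *\<^sub>R \<omega> + frame_sum b ?J t) = p" for t
    proof -
      have "\<omega> \<bullet> frame_sum b ?J t = (\<Sum>k\<in>?J. t k * (b 0 \<bullet> b k))"
        by (simp add: inner_sum_right b)
      also have "\<dots> = 0"
        by (intro sum.neutral) (auto simp: orthonormal_basis_inner[OF b(1)])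
      finally show ?thesis
        using assms by (simp add: inner_add_right norm_eq_1)
    qed
    then have T: "(\<lambda>t. p *\<^sub>R \<omega> + frame_sum b ?J t)
        \<in> leb_prod ?J \<rightarrow>\<^sub>M restrict_space borel (hyperplane \<omega> p)"
      by (intro measurable_restrict_space2) (auto simp: hyperplane_def)
    show "radon f \<omega> p = (\<integral>t. f (p *\<^sub>R \<omega> + frame_sum b ?J t) \<partial>leb_prod ?J)"
      unfolding radon_def hyperplane_area_def Let_def
      by (fold b_def, rule integral_distr[OF T]) (rule measurable_restrict_space1[OF f])
  qed
qed

lemma radon_has_derivative:
  fixes f :: "'a::euclidean_space \<Rightarrow> real"
  assumes \<omega>: "norm \<omega> = 1"
    and f: "decaying f" and f': "\<And>x. (f has_derivative f' x) (at x)"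
    and dec: "decaying (\<lambda>x. f' x \<omega>)"
  shows "(radon f \<omega> has_real_derivative radon (\<lambda>x. f' x \<omega>) \<omega> p) (at p)"
proof -
  obtain b where b: "orthonormal_basis b" "b 0 = \<omega>"
    "\<And>(f :: 'a \<Rightarrow> real) p. f \<in> borel_measurable borel \<Longrightarrow> radon f \<omega> p
      = (\<integral>t. f (p *\<^sub>R \<omega> + frame_sum b {1..DIM('a) - 1} t) \<partial>leb_prod {1..DIM('a) - 1})"
    using radon_eq_frame_integral[OF \<omega>] by blast
  have "{1..DIM('a) - 1} \<subseteq> {..<DIM('a)}"
    using DIM_positive[where 'a='a] by auto
  from has_vector_derivative_frame_integral[OF b(1) this f f' dec, where y = 0 and ?s0.0 = p]
  moreover have "radon f \<omega> = (\<lambda>p. \<integral>t. f (p *\<^sub>R \<omega> + frame_sum b {1..DIM('a) - 1} t) \<partial>leb_prod {1..DIM('a) - 1})"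
    by (intro ext b(3) decaying_measurable[OF f])
  ultimately show ?thesis
    by (simp add: has_real_derivative_iff_has_vector_derivative b(3)[OF decaying_measurable[OF dec]])
qed

text \<open>In the hidden basis \<open>v\<close> has no component on \<open>b 0\<close>, hence is a
  combination of the vectors that span the hyperplane. Since \<open>v\<close> can be any vector
  orthogonal to \<open>\<omega>\<close>, the frame attached to \<open>\<omega>\<close> may be chosen
  independently of the hidden basis.\<close>

lemma radon_tangential_derivative_eq_0:
  fixes f :: "'a::euclidean_space \<Rightarrow> real"
  assumes \<omega>: "norm \<omega> = 1" and v: "v \<bullet> \<omega> = 0"
    and f: "decaying f" and f': "\<And>x. (f has_derivative f' x) (at x)"
    and dec: "decaying (\<lambda>x. f' x v)"
  shows "radon (\<lambda>x. f' x v) \<omega> p = 0"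
proof -
  obtain b where b: "orthonormal_basis b" "b 0 = \<omega>"
    "\<And>(f :: 'a \<Rightarrow> real) p. f \<in> borel_measurable borel \<Longrightarrow> radon f \<omega> p
      = (\<integral>t. f (p *\<^sub>R \<omega> + frame_sum b {1..DIM('a) - 1} t) \<partial>leb_prod {1..DIM('a) - 1})"
    using radon_eq_frame_integral[OF \<omega>] by blast
  have J: "{..<DIM('a)} = insert 0 {1..DIM('a) - 1}"
    using DIM_positive[where 'a='a] by auto
  have "v = frame_sum b (insert 0 {1..DIM('a) - 1}) (\<lambda>k. v \<bullet> b k)"
    using orthonormal_basis_expansion[OF b(1), of v] by (simp only: J)
  also have "\<dots> = frame_sum b {1..DIM('a) - 1} (\<lambda>k. v \<bullet> b k)"
    using v b(2) by (subst sum.insert) auto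
  finally have exp: "v = frame_sum b {1..DIM('a) - 1} (\<lambda>k. v \<bullet> b k)" .
  have "{1..DIM('a) - 1} \<subseteq> {..<DIM('a)}"
    unfolding J by auto
  from integral_tangential_derivative_eq_0[OF b(1) this f f' dec exp]
  show ?thesis
    by (simp add: b(3)[OF decaying_measurable[OF dec]])
qed

lemma radon_sum:
  fixes f :: "'i \<Rightarrow> 'a::euclidean_space \<Rightarrow> real"
  assumes \<omega>: "norm \<omega> = 1" and f: "\<And>i. i \<in> A \<Longrightarrow> decaying (f i)"
  shows "radon (\<lambda>x. \<Sum>i\<in>A. f i x) \<omega> p = (\<Sum>i\<in>A. radon (f i) \<omega> p)"
proof -
  obtain b where b: "orthonormal_basis b" "b 0 = \<omega>"
    "\<And>(f :: 'a \<Rightarrow> real) p. f \<in> borel_measurable borel \<Longrightarrow> radon f \<omega> p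
      = (\<integral>t. f (p *\<^sub>R \<omega> + frame_sum b {1..DIM('a) - 1} t) \<partial>leb_prod {1..DIM('a) - 1})"
    using radon_eq_frame_integral[OF \<omega>] by blast
  have J: "{1..DIM('a) - 1} \<subseteq> {..<DIM('a)}"
    using DIM_positive[where 'a='a] by auto
  have "radon (\<lambda>x. \<Sum>i\<in>A. f i x) \<omega> p
      = (\<integral>t. (\<Sum>i\<in>A. f i (p *\<^sub>R \<omega> + frame_sum b {1..DIM('a) - 1} t)) \<partial>leb_prod {1..DIM('a) - 1})"
    by (rule b(3)) (intro borel_measurable_sum decaying_measurable f)
  also have "\<dots> = (\<Sum>i\<in>A. \<integral>t. f i (p *\<^sub>R \<omega> + frame_sum b {1..DIM('a) - 1} t) \<partial>leb_prod {1..DIM('a) - 1})"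
    by (intro Bochner_Integration.integral_sum integrable_decaying_frame b(1) J f)
  also have "\<dots> = (\<Sum>i\<in>A. radon (f i) \<omega> p)"
    by (intro sum.cong refl b(3)[symmetric] decaying_measurable f)
  finally show ?thesis .
qed

lemma radon_cmult: "radon (\<lambda>x. c * f x) \<omega> p = c * (radon f \<omega> p :: real)"
  by (simp add: radon_def)

subsection \<open>Vector fields\<close>

text \<open>The Jacobian applied to \<open>h\<close>, assembled from the components because the
  Schwartz hypothesis is componentwise.\<close>

definition field_derivative :: "(real^'n \<Rightarrow> real^'n) \<Rightarrow> real^'n \<Rightarrow> real^'n \<Rightarrow> real^'n" where
  "field_derivative F x h = (\<chi> j. frechet_derivative (\<lambda>y. F y $ j) (at x) h)"

locale schwartz_field =
  fixes F :: "real^'n \<Rightarrow> real^'n"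
  assumes schwartz_component: "\<And>j. schwartz (\<lambda>x. F x $ j)"
begin

lemma linear_field_derivative: "linear (field_derivative F x)"
  using has_derivative_linear[OF schwartz_has_derivative[OF schwartz_component]]
  by (auto simp: linear_iff field_derivative_def vec_eq_iff)

lemma schwartz_inner: "schwartz (\<lambda>x. u \<bullet> F x)"
  unfolding inner_vec_def
  using schwartz_bounded_linear[OF bounded_linear_mult_right schwartz_component]
  by (intro schwartz_sum) simp

lemma has_derivative_inner_field:
  "((\<lambda>x. u \<bullet> F x) has_derivative (\<lambda>h. u \<bullet> field_derivative F x h)) (at x)"
  unfolding inner_vec_def field_derivative_def
  by (auto intro!: derivative_eq_intros schwartz_has_derivative schwartz_component)

lemma schwartz_inner_derivative: "schwartz (\<lambda>x. u \<bullet> field_derivative F x h)"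
proof -
  have "u \<bullet> field_derivative F x h = frechet_derivative (\<lambda>x. u \<bullet> F x) (at x) h" for x
    using frechet_derivative_at[OF has_derivative_inner_field, of u x] by (metis (no_types))
  then show ?thesis
    using schwartz_frechet_derivative_direction[OF schwartz_inner, of u h] by simp
qed

lemma divergence_eq_field_derivative:
  "divergence F x = (\<Sum>j\<in>UNIV. axis j 1 \<bullet> field_derivative F x (axis j 1))"
  by (simp add: divergence_def field_derivative_def inner_axis')

lemma schwartz_divergence: "schwartz (divergence F)"
  unfolding divergence_eq_field_derivative by (intro schwartz_sum schwartz_inner_derivative)

text \<open>Basis independence of the trace: one copy of \<open>b k\<close> is expanded in the
  canonical axes, the sums are exchanged, and the remaining copies of \<open>b k\<close> recombine
  to an axis.\<close>

lemma divergence_eq_trace: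
  assumes b: "orthonormal_basis b"
  shows "divergence F x = (\<Sum>k<CARD('n). b k \<bullet> field_derivative F x (b k))"
proof -
  let ?L = "field_derivative F x"
  have "(\<Sum>k<CARD('n). b k \<bullet> ?L (b k)) = (\<Sum>k<CARD('n). \<Sum>j\<in>UNIV. (b k $ j) * (b k \<bullet> ?L (axis j 1)))"
  proof (rule sum.cong[OF refl])
    fix k
    have "b k = (\<Sum>j\<in>UNIV. (b k $ j) *\<^sub>R axis j 1)"
      using basis_expansion[of "b k"] by (simp add: scalar_mult_eq_scaleR)
    then have "?L (b k) = (\<Sum>j\<in>UNIV. (b k $ j) *\<^sub>R ?L (axis j 1))"
      using linear_sum[OF linear_field_derivative] linear_scale[OF linear_field_derivative]
      by (metis (no_types, lifting) sum.cong)
    then show "b k \<bullet> ?L (b k) = (\<Sum>j\<in>UNIV. (b k $ j) * (b k \<bullet> ?L (axis j 1)))"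
      by (simp add: inner_sum_right)
  qed
  also have "\<dots> = (\<Sum>j\<in>UNIV. frame_sum b {..<CARD('n)} (\<lambda>k. axis j 1 \<bullet> b k) \<bullet> ?L (axis j 1))"
    by (subst sum.swap) (simp add: inner_sum_left inner_axis')
  also have "\<dots> = divergence F x"
    using orthonormal_basis_expansion[OF b, of "axis j 1" for j]
    by (simp add: divergence_eq_field_derivative)
  finally show ?thesis ..
qed

lemma transversal_radon_has_derivative:
  assumes "norm \<omega> = 1"
  shows "(transversal_radon F \<omega> has_real_derivative radon (\<lambda>x. \<omega> \<bullet> field_derivative F x \<omega>) \<omega> p) (at p)"
  using radon_has_derivative[OF assms schwartz_decaying[OF schwartz_inner] has_derivative_inner_field
      schwartz_decaying[OF schwartz_inner_derivative], of \<omega> p]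
  unfolding transversal_radon_def[abs_def] by (simp add: eta_contract_eq)

lemma radon_tangential_field_derivative:
  assumes "norm \<omega> = 1" "v \<bullet> \<omega> = 0"
  shows "radon (\<lambda>x. u \<bullet> field_derivative F x v) \<omega> p = 0"
  using radon_tangential_derivative_eq_0[OF assms schwartz_decaying[OF schwartz_inner] has_derivative_inner_field
      schwartz_decaying[OF schwartz_inner_derivative]] .

lemma has_derivative_weighted:
  "((\<lambda>x. (c \<bullet> x) * (u \<bullet> F x)) has_derivative
    (\<lambda>h. (c \<bullet> h) * (u \<bullet> F x) + (c \<bullet> x) * (u \<bullet> field_derivative F x h))) (at x)"
  by (rule has_derivative_eq_rhs[OF has_derivative_mult[OF
        bounded_linear.has_derivative[OF bounded_linear_inner_right has_derivative_ident] has_derivative_inner_field]])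
     (simp add: fun_eq_iff)

lemma decaying_weighted:
  "decaying (\<lambda>x. (c \<bullet> x) * (u \<bullet> F x))"
  "decaying (\<lambda>x. (c \<bullet> x) * (u \<bullet> field_derivative F x h))"
  "decaying (\<lambda>x. (c \<bullet> h) * (u \<bullet> F x) + (c \<bullet> x) * (u \<bullet> field_derivative F x h))"
  by (intro decaying_add schwartz_decaying_linear schwartz_inner schwartz_inner_derivative
      decaying_bounded_linear[OF bounded_linear_mult_right] schwartz_decaying)+

context
  fixes \<omega> :: "real^'n" and b :: "nat \<Rightarrow> real^'n"
  assumes b: "orthonormal_basis b" and b0: "b 0 = \<omega>"
begin

lemma norm_normal: "norm \<omega> = 1"
  using orthonormal_basis_inner[OF b, of 0 0] by (simp add: b0 norm_eq_1)

lemma frame_indices: "{..<CARD('n)} = insert 0 {1..CARD('n) - 1}"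
  using zero_less_card_finite[where 'a='n] by auto

lemma radon_divergence:
  "radon (divergence F) \<omega> p = radon (\<lambda>x. \<omega> \<bullet> field_derivative F x \<omega>) \<omega> p"
proof -
  have "radon (divergence F) \<omega> p = radon (\<lambda>x. \<Sum>k<CARD('n). b k \<bullet> field_derivative F x (b k)) \<omega> p"
    using divergence_eq_trace[OF b] by presburger
  also have "\<dots> = (\<Sum>k<CARD('n). radon (\<lambda>x. b k \<bullet> field_derivative F x (b k)) \<omega> p)"
    by (intro radon_sum norm_normal schwartz_decaying schwartz_inner_derivative)
  also have "\<dots> = radon (\<lambda>x. \<omega> \<bullet> field_derivative F x \<omega>) \<omega> p
      + (\<Sum>k\<in>{1..CARD('n) - 1}. radon (\<lambda>x. b k \<bullet> field_derivative F x (b k)) \<omega> p)"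
    unfolding frame_indices by (subst sum.insert) (auto simp: b0)
  also have "(\<Sum>k\<in>{1..CARD('n) - 1}. radon (\<lambda>x. b k \<bullet> field_derivative F x (b k)) \<omega> p) = 0"
  proof (rule sum.neutral, rule ballI)
    fix k assume "k \<in> {1..CARD('n) - 1}"
    then have "b k \<bullet> \<omega> = 0"
      using orthonormal_basis_inner[OF b, of k 0] by (auto simp: b0)
    then show "radon (\<lambda>x. b k \<bullet> field_derivative F x (b k)) \<omega> p = 0"
      by (rule radon_tangential_field_derivative[OF norm_normal])
  qed
  finally show ?thesis
    by simp
qed

lemma radon_weighted_divergence:
  assumes k: "k \<in> {1..CARD('n) - 1}"
  shows "radon (\<lambda>x. (b k \<bullet> x) * divergence F x) \<omega> p
    = radon (\<lambda>x. (b k \<bullet> x) * (\<omega> \<bullet> field_derivative F x \<omega>)) \<omega> p - radon (\<lambda>x. b k \<bullet> F x) \<omega> p"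
proof -
  define g where "g j x = (b k \<bullet> x) * (b j \<bullet> field_derivative F x (b j))" for j x
  have "radon (\<lambda>x. (b k \<bullet> x) * divergence F x) \<omega> p = radon (\<lambda>x. \<Sum>j<CARD('n). g j x) \<omega> p"
    by (simp add: divergence_eq_trace[OF b] g_def sum_distrib_left)
  also have "\<dots> = (\<Sum>j<CARD('n). radon (g j) \<omega> p)"
    unfolding g_def by (intro radon_sum norm_normal decaying_weighted)
  also have "\<dots> = radon (g 0) \<omega> p + (\<Sum>j\<in>{1..CARD('n) - 1}. radon (g j) \<omega> p)"
    unfolding frame_indices by (subst sum.insert) auto
  also have "(\<Sum>j\<in>{1..CARD('n) - 1}. radon (g j) \<omega> p)
      = (\<Sum>j\<in>{1..CARD('n) - 1}. if j = k then - radon (\<lambda>x. b k \<bullet> F x) \<omega> p else 0)"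
  proof (rule sum.cong[OF refl])
    fix j assume "j \<in> {1..CARD('n) - 1}"
    then have j: "b j \<bullet> \<omega> = 0" "b k \<bullet> b j = (if j = k then 1 else 0)"
      using orthonormal_basis_inner[OF b, of j 0] orthonormal_basis_inner[OF b, of k j] k
      by (auto simp: b0)
    \<comment> \<open>The integrand is the derivative along \<open>b j\<close> of
      \<open>(b k \<bullet> x) * (b j \<bullet> F x)\<close>. Differentiating the weight produces
      the first summand, which survives only for \<open>j = k\<close>.\<close>
    have "radon (\<lambda>x. (b k \<bullet> b j) * (b j \<bullet> F x) + g j x) \<omega> p = 0"
      using radon_tangential_derivative_eq_0[OF norm_normal j(1) decaying_weighted(1)
          has_derivative_weighted decaying_weighted(3)]
      unfolding g_def .
    \<comment> \<open>A Boolean index turns the sum of two integrands into an instance of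
      \<open>radon_sum\<close>.\<close>
    moreover have "radon (\<lambda>x. \<Sum>i\<in>{True, False}. if i then (b k \<bullet> b j) * (b j \<bullet> F x) else g j x) \<omega> p
        = (\<Sum>i\<in>{True, False}. radon (\<lambda>x. if i then (b k \<bullet> b j) * (b j \<bullet> F x) else g j x) \<omega> p)"
    proof (rule radon_sum[OF norm_normal])
      fix i
      have "decaying (\<lambda>x. (b k \<bullet> b j) * (b j \<bullet> F x))" "decaying (g j)"
        unfolding g_def
        by (intro decaying_weighted decaying_bounded_linear[OF bounded_linear_mult_right]
            schwartz_decaying schwartz_inner)+
      then show "decaying (\<lambda>x. if i then (b k \<bullet> b j) * (b j \<bullet> F x) else g j x)"
        by (cases i) auto
    qed
    ultimately show "radon (g j) \<omega> p = (if j = k then - radon (\<lambda>x. b k \<bullet> F x) \<omega> p else 0)"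
      by (auto simp: j(2) radon_cmult)
  qed
  also have "\<dots> = - radon (\<lambda>x. b k \<bullet> F x) \<omega> p"
    using k by (subst sum.delta) auto
  finally show ?thesis
    by (simp add: g_def[abs_def] b0)
qed

text \<open>As \<open>b k\<close> is orthogonal to \<open>\<omega>\<close>, the weight is constant
  in the direction \<open>\<omega>\<close>, and the product rule leaves a single term.\<close>

lemma weighted_transversal_has_derivative:
  assumes k: "k \<in> {1..CARD('n) - 1}"
  shows "(radon (\<lambda>x. (b k \<bullet> x) * (F x \<bullet> \<omega>)) \<omega> has_real_derivative
    radon (\<lambda>x. (b k \<bullet> x) * (\<omega> \<bullet> field_derivative F x \<omega>)) \<omega> p) (at p)"
proof -
  have "b k \<bullet> \<omega> = 0"
    using orthonormal_basis_inner[OF b, of k 0] k by (auto simp: b0)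
  then show ?thesis
    using radon_has_derivative[OF norm_normal decaying_weighted(1) has_derivative_weighted
        decaying_weighted(3), of "b k" \<omega> p]
    by (simp add: inner_commute[of "F _"])
qed

text \<open>Linearity lets the inner product with a fixed \<open>u\<close> pass through the
  transform, so the coefficients of the transformed vector in the frame are scalar Radon
  transforms.\<close>

lemma componentwise_radon_expansion:
  "componentwise_radon F \<omega> p = transversal_radon F \<omega> p *\<^sub>R \<omega>
    + (\<Sum>k = 1..CARD('n) - 1. radon (\<lambda>x. b k \<bullet> F x) \<omega> p *\<^sub>R b k)"
proof -
  have "u \<bullet> componentwise_radon F \<omega> p = radon (\<lambda>x. u \<bullet> F x) \<omega> p" for u
  proof -
    have "radon (\<lambda>x. u \<bullet> F x) \<omega> p = (\<Sum>j\<in>UNIV. radon (\<lambda>x. u $ j * F x $ j) \<omega> p)"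
      unfolding inner_vec_def inner_real_def
      by (intro radon_sum norm_normal decaying_bounded_linear[OF bounded_linear_mult_right]
          schwartz_decaying schwartz_component)
    then show ?thesis
      by (simp add: componentwise_radon_def inner_vec_def radon_cmult)
  qed
  then have "componentwise_radon F \<omega> p = frame_sum b {..<CARD('n)} (\<lambda>k. radon (\<lambda>x. b k \<bullet> F x) \<omega> p)"
    using orthonormal_basis_expansion[OF b, of "componentwise_radon F \<omega> p"]
    by (simp add: inner_commute)
  also have "\<dots> = transversal_radon F \<omega> p *\<^sub>R \<omega>
    + (\<Sum>k = 1..CARD('n) - 1. radon (\<lambda>x. b k \<bullet> F x) \<omega> p *\<^sub>R b k)"
    unfolding frame_indices by (subst sum.insert) (auto simp: b0 transversal_radon_def)
  finally show ?thesis .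
qed

end

end

subsection \<open>Polar coordinates\<close>

lemma space_sphere_measure [simp]: "space (sphere_measure :: 'a::euclidean_space measure) = sphere 0 1"
  by (simp add: sphere_measure_def space_scale_measure space_restrict_space)

lemma sets_sphere_measure [measurable_cong]:
  "sets (sphere_measure :: 'a::euclidean_space measure) = sets (restrict_space borel (sphere 0 1))"
  by (simp add: sphere_measure_def)

lemma sets_sphere_measureD:
  assumes "A \<in> sets (sphere_measure :: 'a::euclidean_space measure)"
  shows "A \<in> sets borel" "A \<subseteq> sphere 0 1"
proof -
  have "A \<in> sets (restrict_space borel (sphere 0 1))"
    using assms by (simp add: sets_sphere_measure)
  then show "A \<in> sets borel" "A \<subseteq> sphere 0 1"
    by (auto simp: sets_restrict_space_iff)
qed

definition cone_part :: "'a::euclidean_space set \<Rightarrow> real \<Rightarrow> 'a set" where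
  "cone_part A r = {x. x \<noteq> 0 \<and> norm x \<le> r \<and> sgn x \<in> A}"

lemma sets_polar_rectangle [measurable]:
  fixes A :: "'a::euclidean_space set"
  assumes "A \<in> sets borel" "B \<in> sets borel"
  shows "{x. x \<noteq> 0 \<and> sgn x \<in> A \<and> norm x \<in> B} \<in> sets borel"
proof -
  have "{x. x \<noteq> 0 \<and> sgn x \<in> A \<and> norm x \<in> B} = (sgn -` A \<inter> norm -` B) - {0}"
    by auto
  moreover have "sgn -` A \<in> sets borel" "norm -` B \<in> sets (borel :: 'a measure)"
    using assms measurable_sets[OF borel_measurable_sgn, of A]
      measurable_sets[of norm "borel :: 'a measure" borel B] by auto
  ultimately show ?thesis
    by auto
qed

lemma cone_part_eq: "cone_part A r = {x. x \<noteq> 0 \<and> sgn x \<in> A \<and> norm x \<in> {..r}}"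
  by (auto simp: cone_part_def)

lemma sets_cone_part [measurable]: "A \<in> sets borel \<Longrightarrow> cone_part A r \<in> sets borel"
  unfolding cone_part_eq by (intro sets_polar_rectangle) auto

lemma emeasure_sphere_measure:
  assumes A: "A \<in> sets (sphere_measure :: 'a::euclidean_space measure)"
  shows "emeasure sphere_measure A = of_nat DIM('a) * emeasure lborel (cone_part A 1)"
proof -
  have "sgn \<in> restrict_space lborel (cball 0 1 - {0}) \<rightarrow>\<^sub>M restrict_space borel (sphere 0 1 :: 'a set)"
    by (intro measurable_restrict_space3) (auto simp: norm_sgn)
  then have "emeasure sphere_measure A
      = of_nat DIM('a) * emeasure (restrict_space lborel (cball 0 1 - {0})) (sgn -` A \<inter> (cball 0 1 - {0}))"
    unfolding sphere_measure_def using A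
    by (simp add: emeasure_distr space_restrict_space sets_sphere_measure)
  also have "emeasure (restrict_space lborel (cball 0 1 - {0})) (sgn -` A \<inter> (cball 0 1 - {0}))
      = emeasure lborel (sgn -` A \<inter> (cball 0 1 - {0}))"
    by (intro emeasure_restrict_space) auto
  also have "sgn -` A \<inter> (cball 0 1 - {0}) = cone_part A 1"
    by (auto simp: cone_part_def)
  finally show ?thesis .
qed

lemma finite_sphere_measure: "finite_measure (sphere_measure :: 'a::euclidean_space measure)"
proof
  have eq: "emeasure (sphere_measure :: 'a measure) (space sphere_measure)
      = of_nat DIM('a) * emeasure lborel (cone_part (sphere 0 1) (1::real) :: 'a set)"
    using sets.top[of "sphere_measure :: 'a measure"] by (simp add: emeasure_sphere_measure)
  have "emeasure lborel (cone_part (sphere 0 1) (1::real) :: 'a set) \<le> emeasure lborel (cball 0 1 :: 'a set)"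
    by (intro emeasure_mono) (auto simp: cone_part_def)
  also have "\<dots> < \<infinity>"
    by (rule emeasure_lborel_cball_finite)
  finally have "emeasure lborel (cone_part (sphere 0 1) (1::real) :: 'a set) < \<infinity>" .
  with eq show "emeasure (sphere_measure :: 'a measure) (space sphere_measure) \<noteq> \<infinity>"
    by (auto simp: ennreal_mult_eq_top_iff less_top[symmetric])
qed

lemma emeasure_cone_part:
  fixes A :: "'a::euclidean_space set"
  assumes [measurable]: "A \<in> sets borel" and r: "0 < r"
  shows "emeasure lborel (cone_part A r) = ennreal (r ^ DIM('a)) * emeasure lborel (cone_part A 1)"
proof -
  have "emeasure lborel (cone_part A r)
      = emeasure (density (distr lborel borel (\<lambda>x. 0 + r *\<^sub>R x)) (\<lambda>_. \<bar>r\<bar> ^ DIM('a))) (cone_part A r)"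
    using lborel_affine[of r "0::'a"] r by simp
  also have "\<dots> = ennreal (r ^ DIM('a)) * emeasure lborel ((\<lambda>x. r *\<^sub>R x) -` cone_part A r)"
    using r by (subst emeasure_density) (auto simp: nn_integral_cmult_indicator emeasure_distr)
  also have "(\<lambda>x. r *\<^sub>R x) -` cone_part A r = cone_part A 1"
    using r by (auto simp: cone_part_def sgn_scaleR)
  finally show ?thesis .
qed

text \<open>The Jacobian is built into a measure, so that polar coordinates become an equality with
  a product measure and Fubini applies directly.\<close>

definition radial_measure :: "nat \<Rightarrow> real measure" where
  "radial_measure d = density lborel (\<lambda>r. ennreal (indicator {0<..} r * r ^ (d - 1)))"

lemma sets_radial_measure [simp, measurable_cong]: "sets (radial_measure d) = sets borel"
  by (simp add: radial_measure_def)

lemma space_radial_measure [simp]: "space (radial_measure d) = UNIV"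
  by (simp add: radial_measure_def)

lemma sigma_finite_radial_measure: "sigma_finite_measure (radial_measure d)"
  unfolding radial_measure_def by (subst sigma_finite_measure.sigma_finite_iff_density_finite[OF sigma_finite_lborel]) auto

lemma emeasure_radial_measure_atMost:
  assumes "0 < d"
  shows "emeasure (radial_measure d) {..r} = (if r \<le> 0 then 0 else ennreal (r ^ d / d))"
proof (cases "r \<le> 0")
  case True
  then have "(\<lambda>x. ennreal (indicator {0<..} x * x ^ (d - 1)) * indicator {..r} x) = (\<lambda>x. 0)"
    by (auto simp: fun_eq_iff split: split_indicator)
  then have "emeasure (radial_measure d) {..r} = (\<integral>\<^sup>+(x::real). 0 \<partial>lborel)"
    unfolding radial_measure_def by (subst emeasure_density) auto
  then show ?thesis
    using True by simp
next
  case False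
  have "emeasure (radial_measure d) {..r} = (\<integral>\<^sup>+x. ennreal (indicator {0<..} x * x ^ (d - 1)) * indicator {..r} x \<partial>lborel)"
    unfolding radial_measure_def by (subst emeasure_density) auto
  also have "\<dots> = (\<integral>\<^sup>+x. ennreal (x ^ (d - 1)) * indicator {0..r} x \<partial>lborel)"
    using AE_lborel_singleton[of "0::real"]
    by (intro nn_integral_cong_AE) (auto split: split_indicator)
  also have "\<dots> = ennreal (r ^ d / d - 0 ^ d / d)"
  proof (rule nn_integral_FTC_Icc)
    fix x :: real
    show "((\<lambda>x. x ^ d / real d) has_real_derivative x ^ (d - 1)) (at x)"
      using assms
      by (auto intro!: derivative_eq_intros)
  qed (use False in auto)
  finally show ?thesis
    using False assms by (simp add: zero_power)
qed

text \<open>The two sides agree on half-lines because cones of radius \<open>r\<close> scale with \<open>r\<^sup>d\<close>.\<close>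

lemma sphere_measure_times_radial_measure:
  fixes A :: "'a::euclidean_space set"
  assumes A: "A \<in> sets sphere_measure" and B: "B \<in> sets borel"
  shows "emeasure sphere_measure A * emeasure (radial_measure DIM('a)) B
    = emeasure lborel {x. x \<noteq> 0 \<and> sgn x \<in> A \<and> norm x \<in> B}"
proof -
  have [measurable]: "A \<in> sets borel"
    using sets_sphere_measureD[OF A] by simp
  let ?c = "emeasure sphere_measure A"
  \<comment> \<open>For fixed \<open>A\<close> this makes the right-hand side a measure in
    \<open>B\<close>, so that comparison on a generating family of half-lines suffices.\<close>
  define N where "N = distr (restrict_space lborel {x::'a. x \<noteq> 0 \<and> sgn x \<in> A}) borel norm"
  have R: "{x::'a. x \<noteq> 0 \<and> sgn x \<in> A} \<in> sets borel"
    using sets_polar_rectangle[of A UNIV] by simp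
  have N: "emeasure N B = emeasure lborel {x::'a. x \<noteq> 0 \<and> sgn x \<in> A \<and> norm x \<in> B}"
    if B: "B \<in> sets borel" for B
  proof -
    have "emeasure N B = emeasure (restrict_space lborel {x::'a. x \<noteq> 0 \<and> sgn x \<in> A})
        (norm -` B \<inter> {x. x \<noteq> 0 \<and> sgn x \<in> A})"
      unfolding N_def using B
      by (subst emeasure_distr) (auto intro: measurable_restrict_space1 simp: space_restrict_space)
    also have "\<dots> = emeasure lborel (norm -` B \<inter> {x::'a. x \<noteq> 0 \<and> sgn x \<in> A})"
      using R by (intro emeasure_restrict_space) auto
    also have "norm -` B \<inter> {x::'a. x \<noteq> 0 \<and> sgn x \<in> A} = {x. x \<noteq> 0 \<and> sgn x \<in> A \<and> norm x \<in> B}"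
      by auto
    finally show ?thesis .
  qed
  have c_fin: "?c \<noteq> \<infinity>"
    using finite_measure.emeasure_finite[OF finite_sphere_measure] by auto
  have "scale_measure ?c (radial_measure DIM('a)) = N"
  proof (rule measure_eqI_generator_eq[where \<Omega>=UNIV and E="range (\<lambda>a. {..a})" and A="\<lambda>n. {..real n}"])
    show "Int_stable (range (\<lambda>a::real. {..a}))"
      by (auto simp: Int_stable_def)
    show "sets (scale_measure ?c (radial_measure DIM('a))) = sigma_sets UNIV (range (\<lambda>a::real. {..a}))"
      "sets N = sigma_sets UNIV (range (\<lambda>a::real. {..a}))"
      by (auto simp: borel_eq_atMost N_def sets_scale_measure)
    show "(\<Union>i. {..real i}) = UNIV"
      by (auto simp: real_arch_simple)
    show "emeasure (scale_measure ?c (radial_measure DIM('a))) {..real i} \<noteq> \<infinity>" for i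
      using c_fin by (auto simp: emeasure_radial_measure_atMost ennreal_mult_eq_top_iff)
    fix X :: "real set" assume "X \<in> range (\<lambda>a. {..a})"
    then obtain r where X: "X = {..r}" by auto
    show "emeasure (scale_measure ?c (radial_measure DIM('a))) X = emeasure N X"
    proof (cases "r \<le> 0")
      case True
      then have "{x::'a. x \<noteq> 0 \<and> sgn x \<in> A \<and> norm x \<in> {..r}} = {}"
        by auto (metis norm_le_zero_iff order_trans)
      then have "emeasure N X = 0"
        unfolding X by (subst N) (simp_all only: atMost_borel emeasure_empty)
      then show ?thesis
        using True by (simp add: X emeasure_radial_measure_atMost)
    next
      case False
      have "emeasure N X = emeasure lborel (cone_part A r)"
        by (simp add: X N cone_part_def conj_commute)
      also have "\<dots> = ennreal (r ^ DIM('a)) * emeasure lborel (cone_part A 1)"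
        using False by (intro emeasure_cone_part) auto
      \<comment> \<open>The factor d in the normalisation of \<open>sphere_measure\<close>
        compensates the 1/d from integrating r^(d-1).\<close>
      also have "r ^ DIM('a) = r ^ DIM('a) / real DIM('a) * real DIM('a)"
        by simp
      also have "ennreal \<dots> * emeasure lborel (cone_part A 1)
          = ennreal (r ^ DIM('a) / real DIM('a)) * (of_nat DIM('a) * emeasure lborel (cone_part A 1))"
        using False by (subst ennreal_mult) (auto simp: mult_ac ennreal_of_nat_eq_real_of_nat)
      also have "\<dots> = emeasure (scale_measure ?c (radial_measure DIM('a))) X"
        using False by (simp add: X emeasure_radial_measure_atMost emeasure_sphere_measure[OF A] mult.commute)
      finally show ?thesis ..
    qed
  qed auto
  then have "emeasure (scale_measure ?c (radial_measure DIM('a))) B = emeasure N B"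
    by simp
  then show ?thesis
    using B by (simp add: N)
qed

lemma measurable_polar_map:
  "(\<lambda>x::'a::euclidean_space. (sgn x, norm x))
    \<in> restrict_space lborel (- {0}) \<rightarrow>\<^sub>M sphere_measure \<Otimes>\<^sub>M radial_measure DIM('a)"
proof (rule measurable_Pair)
  have "sgn \<in> restrict_space lborel (- {0}) \<rightarrow>\<^sub>M restrict_space borel (sphere 0 1 :: 'a set)"
    by (intro measurable_restrict_space3) (auto simp: norm_sgn)
  then show "sgn \<in> restrict_space lborel (- {0}) \<rightarrow>\<^sub>M (sphere_measure :: 'a measure)"
    by (simp add: measurable_cong_sets[OF refl sets_sphere_measure])
  show "norm \<in> restrict_space lborel (- {0::'a}) \<rightarrow>\<^sub>M radial_measure DIM('a)"
    by (simp add: measurable_cong_sets[OF refl sets_radial_measure] measurable_restrict_space1)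
qed

text \<open>Rectangles determine a product of sigma-finite measures. The origin is removed because
  \<open>sgn 0 = 0\<close> lies off the sphere; it is a null set, so integrals do not
  notice.\<close>

lemma polar_decomposition:
  "sphere_measure \<Otimes>\<^sub>M radial_measure DIM('a)
    = distr (restrict_space lborel (- {0})) (sphere_measure \<Otimes>\<^sub>M radial_measure DIM('a))
        (\<lambda>x::'a::euclidean_space. (sgn x, norm x))"
    (is "?P = distr ?L ?P ?T")
proof (rule pair_measure_eqI)
  show "sigma_finite_measure (sphere_measure :: 'a measure)"
    using finite_sphere_measure by (rule finite_measure.axioms(1))
  show "sigma_finite_measure (radial_measure DIM('a))"
    by (rule sigma_finite_radial_measure)
  fix A :: "'a set" and B assume A: "A \<in> sets sphere_measure" and B: "B \<in> sets (radial_measure DIM('a))"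
  then have "emeasure (distr ?L ?P ?T) (A \<times> B) = emeasure ?L (?T -` (A \<times> B) \<inter> space ?L)"
    by (intro emeasure_distr measurable_polar_map pair_measureI)
  also have "\<dots> = emeasure lborel (?T -` (A \<times> B) \<inter> space ?L)"
    by (intro emeasure_restrict_space) (auto simp: space_restrict_space)
  also have "?T -` (A \<times> B) \<inter> space ?L = {x. x \<noteq> 0 \<and> sgn x \<in> A \<and> norm x \<in> B}"
    by (auto simp: space_restrict_space)
  finally show "emeasure sphere_measure A * emeasure (radial_measure DIM('a)) B = emeasure (distr ?L ?P ?T) (A \<times> B)"
    using sphere_measure_times_radial_measure[OF A] B by simp
qed auto

lemma measurable_sphere_borel: "(\<lambda>x. x) \<in> sphere_measure \<rightarrow>\<^sub>M borel"
  unfolding measurable_cong_sets[OF sets_sphere_measure refl] by (rule measurable_restrict_space1) simp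

lemma sigma_finite_pair_polar:
  "pair_sigma_finite (sphere_measure :: 'a::euclidean_space measure) (radial_measure d)"
  using finite_measure.axioms(1)[OF finite_sphere_measure] sigma_finite_radial_measure
  by (rule pair_sigma_finite.intro)

lemma AE_indicator_punctured:
  "AE x in lborel. indicator (- {0}) (x::'a::euclidean_space) *\<^sub>R f x = (f x :: 'b::real_vector)"
  using AE_lborel_singleton[of "0::'a"] by eventually_elim simp

lemma integrable_punctured_iff:
  fixes f :: "'a::euclidean_space \<Rightarrow> 'b::{banach, second_countable_topology}"
  assumes [measurable]: "f \<in> borel_measurable borel"
  shows "integrable (restrict_space lborel (- {0})) f \<longleftrightarrow> integrable lborel f"
proof -
  have "integrable (restrict_space lborel (- {0})) f \<longleftrightarrow> integrable lborel (\<lambda>x. indicator (- {0}) x *\<^sub>R f x)"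
    by (rule integrable_restrict_space) auto
  also have "\<dots> \<longleftrightarrow> integrable lborel f"
    by (rule integrable_cong_AE) (auto intro: AE_indicator_punctured)
  finally show ?thesis .
qed

lemma integral_punctured:
  fixes f :: "'a::euclidean_space \<Rightarrow> 'b::{banach, second_countable_topology}"
  assumes [measurable]: "f \<in> borel_measurable borel"
  shows "(\<integral>x. f x \<partial>restrict_space lborel (- {0})) = (\<integral>x. f x \<partial>lborel)"
proof -
  have "(\<integral>x. f x \<partial>restrict_space lborel (- {0})) = (\<integral>x. indicator (- {0}) x *\<^sub>R f x \<partial>lborel)"
    by (rule integral_restrict_space) auto
  also have "\<dots> = (\<integral>x. f x \<partial>lborel)"
    by (rule integral_cong_AE) (auto intro: AE_indicator_punctured)
  finally show ?thesis .
qed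

lemma integral_radial_measure:
  fixes g :: "real \<Rightarrow> 'b::{banach, second_countable_topology}"
  assumes "g \<in> borel_measurable borel"
  shows "(\<integral>r. g r \<partial>radial_measure d) = (\<integral>r. (indicator {0<..} r * r ^ (d - 1)) *\<^sub>R g r \<partial>lborel)"
  unfolding radial_measure_def
  using assms by (intro integral_density) (auto split: split_indicator)

text \<open>Fubini on the product side of \<open>polar_decomposition\<close>. Integrability of the
  spherical function is recorded because the backprojection integral will be split into two such
  terms.\<close>

lemma integral_polar:
  fixes f :: "'a::euclidean_space \<Rightarrow> 'b::{banach, second_countable_topology}"
  assumes f: "integrable lborel f"
  defines "g \<equiv> \<lambda>\<omega>. \<integral>r. (indicator {0<..} r * r ^ (DIM('a) - 1)) *\<^sub>R f (r *\<^sub>R \<omega>) \<partial>lborel"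
  shows "integrable sphere_measure g" "(\<integral>\<omega>. g \<omega> \<partial>sphere_measure) = (\<integral>x. f x \<partial>lborel)"
proof -
  let ?P = "(sphere_measure :: 'a measure) \<Otimes>\<^sub>M radial_measure DIM('a)"
  let ?L = "restrict_space lborel (- {0::'a})"
  let ?T = "\<lambda>x::'a. (sgn x, norm x)"
  let ?h = "\<lambda>(\<omega>, r). f (r *\<^sub>R \<omega>)"
  interpret pair_sigma_finite "sphere_measure :: 'a measure" "radial_measure DIM('a)"
    by (rule sigma_finite_pair_polar)
  have [measurable]: "f \<in> borel_measurable borel"
    using f by auto
  have [measurable]: "fst \<in> ?P \<rightarrow>\<^sub>M borel" "snd \<in> ?P \<rightarrow>\<^sub>M borel"
    using measurable_compose[OF measurable_fst measurable_sphere_borel]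
      measurable_compose[OF measurable_snd, of "\<lambda>x. x" "radial_measure DIM('a)" borel]
    by auto
  have h: "?h \<in> borel_measurable ?P"
    unfolding split_beta' by measurable
  have hT: "?h (?T x) = f x" for x
    by (cases "x = 0") (auto simp: sgn_div_norm)
  have "integrable (distr ?L ?P ?T) ?h"
    unfolding integrable_distr_eq[OF measurable_polar_map h] hT
    using f by (simp add: integrable_punctured_iff)
  then have int: "integrable ?P ?h"
    by (simp only: polar_decomposition[symmetric])
  have g: "g = (\<lambda>\<omega>. \<integral>r. ?h (\<omega>, r) \<partial>radial_measure DIM('a))"
    unfolding g_def by (simp add: integral_radial_measure)
  show "integrable sphere_measure g"
    unfolding g by (rule integrable_fst'[OF int])
  have "(\<integral>\<omega>. g \<omega> \<partial>sphere_measure) = integral\<^sup>L ?P ?h"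
    unfolding g by (rule integral_fst'[OF int])
  also have "\<dots> = integral\<^sup>L (distr ?L ?P ?T) ?h"
    by (simp only: polar_decomposition[symmetric])
  also have "\<dots> = (\<integral>x. f x \<partial>?L)"
    unfolding integral_distr[OF measurable_polar_map h] hT ..
  also have "\<dots> = (\<integral>x. f x \<partial>lborel)"
    by (simp add: integral_punctured)
  finally show "(\<integral>\<omega>. g \<omega> \<partial>sphere_measure) = (\<integral>x. f x \<partial>lborel)" .
qed

text \<open>Reduces integrability of a radial function to the half-line; the sphere contributes only
  its finite total measure.\<close>

lemma integrable_radial:
  fixes h :: "real \<Rightarrow> real"
  assumes [measurable]: "h \<in> borel_measurable borel" 
    and int: "integrable lborel (\<lambda>r. (indicator {0<..} r * r ^ (DIM('a) - 1)) * h r)"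
  shows "integrable lborel (\<lambda>x::'a::euclidean_space. h (norm x))"
proof -
  let ?P = "(sphere_measure :: 'a measure) \<Otimes>\<^sub>M radial_measure DIM('a)"
  let ?L = "restrict_space lborel (- {0::'a})"
  let ?T = "\<lambda>x::'a. (sgn x, norm x)"
  interpret pair_sigma_finite "sphere_measure :: 'a measure" "radial_measure DIM('a)"
    by (rule sigma_finite_pair_polar)
  interpret S: finite_measure "sphere_measure :: 'a measure"
    by (rule finite_sphere_measure)
  have "integrable (radial_measure DIM('a)) h"
    unfolding radial_measure_def using int
    by (subst integrable_density) (auto split: split_indicator)
  then have "integrable ?P (\<lambda>(\<omega>, r). h r)"
    by (intro Fubini_integrable) auto
  then have "integrable (distr ?L ?P ?T) (\<lambda>(\<omega>, r). h r)"
    by (simp only: polar_decomposition[symmetric])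
  then have "integrable ?L (\<lambda>x. h (norm x))"
    by (subst (asm) integrable_distr_eq[OF measurable_polar_map]) auto
  then show ?thesis
    by (simp add: integrable_punctured_iff)
qed

subsection \<open>Fourier slice theorem and Fourier inversion\<close>

lemma integral_lborel_affine:
  fixes f :: "'a::euclidean_space \<Rightarrow> 'b::{banach, second_countable_topology}"
  assumes [measurable]: "f \<in> borel_measurable borel" and c: "c \<noteq> 0"
  shows "(\<integral>x. f x \<partial>lborel) = \<bar>c\<bar> ^ DIM('a) *\<^sub>R (\<integral>x. f (t + c *\<^sub>R x) \<partial>lborel)"
  by (subst lborel_affine[OF c, of t])
    (simp add: integral_density integral_distr ennreal_power)

lemma integrable_lborel_affine_iff:
  fixes f :: "'a::euclidean_space \<Rightarrow> 'b::{banach, second_countable_topology}"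
  assumes [measurable]: "f \<in> borel_measurable borel" and c: "c \<noteq> 0"
  shows "integrable lborel (\<lambda>x. f (t + c *\<^sub>R x)) \<longleftrightarrow> integrable lborel f"
proof -
  have "integrable lborel f \<longleftrightarrow> integrable lborel (\<lambda>x. \<bar>c\<bar> ^ DIM('a) *\<^sub>R f (t + c *\<^sub>R x))"
    by (subst lborel_affine[OF c, of t])
      (use c in \<open>simp add: integrable_density integrable_distr_eq ennreal_power\<close>)
  also have "\<dots> \<longleftrightarrow> integrable lborel (\<lambda>x. f (t + c *\<^sub>R x))"
    using integrable_scaleR_right[of "1 / \<bar>c\<bar> ^ DIM('a)" lborel "\<lambda>x. \<bar>c\<bar> ^ DIM('a) *\<^sub>R f (t + c *\<^sub>R x)"] c
    by auto
  finally show ?thesis ..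
qed

text \<open>The character with frequency \<open>s *\<^sub>R \<omega>\<close> is constant on each
  hyperplane orthogonal to \<open>\<omega>\<close>, so it leaves the inner integral when Fubini is
  applied over the hyperplanes. Integrability of the projection makes its classical transform a
  distributional one.\<close>

lemma fourier_slice:
  fixes f :: "'a::euclidean_space \<Rightarrow> real"
  assumes \<omega>: "norm \<omega> = 1" and f: "decaying f"
  shows "integrable lborel (radon f \<omega>)"
    and "fourier (\<lambda>p. complex_of_real (radon f \<omega> p)) s = fourier (\<lambda>x. complex_of_real (f x)) (s *\<^sub>R \<omega>)"
proof -
  define J where "J = {1..DIM('a) - 1}"
  obtain b where b: "orthonormal_basis b" "b 0 = \<omega>"
    "\<And>(f :: 'a \<Rightarrow> real) p. f \<in> borel_measurable borel \<Longrightarrow> radon f \<omega> p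
      = (\<integral>t. f (p *\<^sub>R \<omega> + frame_sum b J t) \<partial>leb_prod J)"
    unfolding J_def using radon_eq_frame_integral[OF \<omega>] by blast
  let ?P = "lborel \<Otimes>\<^sub>M leb_prod J"
  let ?T = "\<lambda>(p, t). p *\<^sub>R \<omega> + frame_sum b J t"
  have lb: "distr ?P borel ?T = lborel"
    using distr_hyperplanes_eq_lborel[OF b(1)] by (simp only: b(2) J_def)
  interpret J: sigma_finite_measure "leb_prod J"
    by (rule sigma_finite_leb_prod) (simp add: J_def)
  interpret pair_sigma_finite "lborel :: real measure" "leb_prod J" ..
  have [measurable]: "f \<in> borel_measurable borel"
    by (rule decaying_measurable[OF f])
  have T: "?T \<in> borel_measurable ?P"
    by measurable
  have fin: "integrable lborel f"
    by (rule integrable_decaying[OF f])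
  have radon: "radon f \<omega> = (\<lambda>p. \<integral>t. f (?T (p, t)) \<partial>leb_prod J)"
    by (simp add: b(3) fun_eq_iff)
  have "integrable ?P (\<lambda>z. f (?T z))"
    using fin unfolding lb[symmetric] by (subst (asm) integrable_distr_eq[OF T]) auto
  then show "integrable lborel (radon f \<omega>)"
    unfolding radon by (rule integrable_fst')
  define h where "h x = exp (- \<i> * of_real (x \<bullet> (s *\<^sub>R \<omega>))) * complex_of_real (f x)" for x
  have [measurable]: "h \<in> borel_measurable borel"
    unfolding h_def by measurable
  have "integrable lborel h"
    by (rule Bochner_Integration.integrable_bound[OF fin]) (auto simp: h_def norm_mult)
  then have hint: "integrable ?P (\<lambda>z. h (?T z))"
    unfolding lb[symmetric] by (subst (asm) integrable_distr_eq[OF T]) auto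
  have inner: "?T (p, t) \<bullet> \<omega> = p" for p t
  proof -
    have "frame_sum b J t \<bullet> \<omega> = (\<Sum>k\<in>J. t k * (b k \<bullet> b 0))"
      by (simp add: inner_sum_left b(2))
    also have "\<dots> = 0"
      by (intro sum.neutral) (auto simp: orthonormal_basis_inner[OF b(1)] J_def)
    finally show ?thesis
      using \<omega> by (simp add: inner_add_left norm_eq_1)
  qed
  have "fourier (\<lambda>x. complex_of_real (f x)) (s *\<^sub>R \<omega>) = (\<integral>x. h x \<partial>distr ?P borel ?T)"
    unfolding lb fourier_def h_def ..
  also have "\<dots> = (\<integral>z. h (?T z) \<partial>?P)"
    by (rule integral_distr[OF T]) simp
  also have "\<dots> = (\<integral>p. \<integral>t. h (?T (p, t)) \<partial>leb_prod J \<partial>lborel)"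
    by (rule integral_fst'[OF hint, symmetric])
  also have "\<dots> = (\<integral>p. exp (- \<i> * of_real (p \<bullet> s)) * complex_of_real (radon f \<omega> p) \<partial>lborel)"
  proof (rule Bochner_Integration.integral_cong[OF refl])
    fix p
    have "(\<integral>t. h (?T (p, t)) \<partial>leb_prod J)
        = (\<integral>t. exp (- \<i> * of_real (p \<bullet> s)) * complex_of_real (f (?T (p, t))) \<partial>leb_prod J)"
      unfolding h_def inner_scaleR_right inner by (simp add: mult.commute)
    then show "(\<integral>t. h (?T (p, t)) \<partial>leb_prod J) = exp (- \<i> * of_real (p \<bullet> s)) * complex_of_real (radon f \<omega> p)"
      by (simp add: radon)
  qed
  finally show "fourier (\<lambda>p. complex_of_real (radon f \<omega> p)) s = fourier (\<lambda>x. complex_of_real (f x)) (s *\<^sub>R \<omega>)"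
    by (simp add: fourier_def)
qed

section \<open>The multiplication formula, Gaussians and Fourier inversion\<close>

abbreviation (input) fourier_kernel :: "'a::euclidean_space \<Rightarrow> 'a \<Rightarrow> complex" where
  "fourier_kernel x \<xi> \<equiv> exp (- \<i> * of_real (x \<bullet> \<xi>))"

lemma norm_fourier_kernel: "norm (fourier_kernel x \<xi>) = 1"
  by (simp add: norm_exp_i_times[of "- (x \<bullet> \<xi>)", simplified])

lemma integrable_kernel_mult:
  fixes f :: "'a::euclidean_space \<Rightarrow> complex"
  assumes "integrable lborel f"
  shows "integrable lborel (\<lambda>x. fourier_kernel x \<xi> * f x)"
  by (rule Bochner_Integration.integrable_bound[OF assms]) (use assms in \<open>auto simp: norm_mult norm_fourier_kernel simp del: exp_of_real\<close>)

lemma fourier_measurable [measurable]: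
  fixes f :: "'a::euclidean_space \<Rightarrow> complex"
  assumes [measurable]: "f \<in> borel_measurable borel"
  shows "fourier f \<in> borel_measurable borel"
  unfolding fourier_def by measurable

lemma norm_fourier_le:
  fixes f :: "'a::euclidean_space \<Rightarrow> complex"
  shows "norm (fourier f \<xi>) \<le> (\<integral>x. norm (f x) \<partial>lborel)"
proof -
  have "norm (fourier f \<xi>) \<le> (\<integral>x. norm (fourier_kernel x \<xi> * f x) \<partial>lborel)"
    unfolding fourier_def by (rule integral_norm_bound)
  also have "\<dots> = (\<integral>x. norm (f x) \<partial>lborel)"
    by (simp only: norm_mult norm_fourier_kernel mult_1)
  finally show ?thesis .
qed

lemma integrable_mult_bounded:
  fixes f g :: "'a::euclidean_space \<Rightarrow> complex"
  assumes f: "integrable lborel f" and [measurable]: "g \<in> borel_measurable borel"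
    and g: "\<And>x. norm (g x) \<le> C"
  shows "integrable lborel (\<lambda>x. f x * g x)"
proof (rule Bochner_Integration.integrable_bound)
  show "integrable lborel (\<lambda>x. C * norm (f x))"
    using f by simp
  have "norm (f x * g x) \<le> norm (C * norm (f x))" for x
  proof -
    have "norm (f x) * norm (g x) \<le> norm (f x) * C"
      by (intro mult_left_mono g) auto
    then show ?thesis
      by (simp add: norm_mult mult.commute)
  qed
  then show "AE x in lborel. norm (f x * g x) \<le> norm (C * norm (f x))"
    by simp
qed (use f in measurable)

text \<open>Fubini with a kernel symmetric in its two arguments. For Schwartz \<open>g\<close> it
  says that the classical transform is the distributional one; for a Gaussian \<open>g\<close> it
  leads to inversion.\<close>

lemma multiplication_formula:
  fixes f g :: "'a::euclidean_space \<Rightarrow> complex"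
  assumes f: "integrable lborel f" and g: "integrable lborel g"
  shows "integrable lborel (\<lambda>x. f x * fourier g x)"
    and "integrable lborel (\<lambda>\<xi>. fourier f \<xi> * g \<xi>)"
    and "(\<integral>x. f x * fourier g x \<partial>lborel) = (\<integral>\<xi>. fourier f \<xi> * g \<xi> \<partial>lborel)"
proof -
  have [measurable]: "f \<in> borel_measurable borel" "g \<in> borel_measurable borel"
    using f g by auto
  have int: "integrable (lborel \<Otimes>\<^sub>M lborel) (\<lambda>(x, \<xi>). fourier_kernel x \<xi> * (f x * g \<xi>))"
  proof (rule lborel_pair.Fubini_integrable)
    show "integrable lborel (\<lambda>x. \<integral>\<xi>. norm (case (x, \<xi>) of (x, \<xi>) \<Rightarrow> fourier_kernel x \<xi> * (f x * g \<xi>)) \<partial>lborel)"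
      using f by (simp add: norm_mult norm_fourier_kernel[simplified])
    show "AE x in lborel. integrable lborel (\<lambda>\<xi>. case (x, \<xi>) of (x, \<xi>) \<Rightarrow> fourier_kernel x \<xi> * (f x * g \<xi>))"
    proof (rule AE_I2, unfold split_conv)
      fix x
      show "integrable lborel (\<lambda>\<xi>. fourier_kernel x \<xi> * (f x * g \<xi>))"
        using integrable_kernel_mult[of "\<lambda>\<xi>. f x * g \<xi>" x] g
        by (simp add: inner_commute)
    qed
  qed measurable
  show "integrable lborel (\<lambda>x. f x * fourier g x)"
    using f norm_fourier_le[of g] by (intro integrable_mult_bounded) auto
  show "integrable lborel (\<lambda>\<xi>. fourier f \<xi> * g \<xi>)"
    unfolding mult.commute[of "fourier f _"]
    using g norm_fourier_le[of f] by (intro integrable_mult_bounded) auto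
  have "(\<integral>x. f x * fourier g x \<partial>lborel) = (\<integral>x. \<integral>\<xi>. fourier_kernel x \<xi> * (f x * g \<xi>) \<partial>lborel \<partial>lborel)"
    unfolding fourier_def
    by (simp add: integral_mult_right_zero[symmetric] mult_ac inner_commute del: integral_mult_right_zero)
  also have "\<dots> = (\<integral>\<xi>. \<integral>x. fourier_kernel x \<xi> * (f x * g \<xi>) \<partial>lborel \<partial>lborel)"
    by (rule lborel_pair.Fubini_integral[OF int, symmetric])
  also have "\<dots> = (\<integral>\<xi>. fourier f \<xi> * g \<xi> \<partial>lborel)"
    unfolding fourier_def by (simp add: mult.assoc[symmetric])
  finally show "(\<integral>x. f x * fourier g x \<partial>lborel) = (\<integral>\<xi>. fourier f \<xi> * g \<xi> \<partial>lborel)" .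
qed

lemma integral_lborel_prod:
  fixes f :: "'a::euclidean_space \<Rightarrow> real \<Rightarrow> 'b::{real_normed_field, banach, second_countable_topology}"
  assumes f: "\<And>b. b \<in> Basis \<Longrightarrow> integrable lborel (f b)"
  shows "integrable lborel (\<lambda>x. \<Prod>b\<in>Basis. f b (x \<bullet> b))"
    and "(\<integral>x. (\<Prod>b\<in>Basis. f b (x \<bullet> b)) \<partial>lborel) = (\<Prod>b\<in>Basis. \<integral>t. f b t \<partial>lborel)"
proof -
  interpret product_sigma_finite "\<lambda>_::'a. lborel :: real measure" ..
  have meas: "(\<lambda>x::'a. \<Prod>b\<in>Basis. f b (x \<bullet> b)) \<in> borel_measurable borel"
  proof (rule borel_measurable_prod)
    fix b :: 'a assume "b \<in> Basis"
    then have "f b \<in> borel_measurable borel"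
      using f by auto
    then show "(\<lambda>x. f b (x \<bullet> b)) \<in> borel_measurable borel"
      by measurable
  qed
  have T: "(\<lambda>t. \<Sum>b\<in>Basis. t b *\<^sub>R b) \<in> borel_measurable (Pi\<^sub>M Basis (\<lambda>_::'a. lborel))"
    by measurable
  have eq: "(\<Prod>b\<in>Basis. f b ((\<Sum>b\<in>Basis. t b *\<^sub>R b) \<bullet> b)) = (\<Prod>b\<in>Basis. f b (t b))" for t
    by (intro prod.cong) auto
  show "integrable lborel (\<lambda>x. \<Prod>b\<in>Basis. f b (x \<bullet> b))"
    unfolding lborel_eq[where 'a='a] integrable_distr_eq[OF T meas] eq
    by (intro product_integrable_prod f) auto
  show "(\<integral>x. (\<Prod>b\<in>Basis. f b (x \<bullet> b)) \<partial>lborel) = (\<Prod>b\<in>Basis. \<integral>t. f b t \<partial>lborel)"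
    unfolding lborel_eq[where 'a='a] integral_distr[OF T meas] eq
    by (intro product_integral_prod f) auto
qed

definition gauss :: "'a::euclidean_space \<Rightarrow> complex" where
  "gauss x = of_real (exp (- (norm x)\<^sup>2 / 2))"

text \<open>The characteristic function of the standard normal distribution, rescaled by the
  normalising constant of its density; the argument \<open>- s\<close> accounts for the opposite
  sign in the exponent of \<open>char\<close>.\<close>

lemma gauss_real_integral:
  "integrable lborel (\<lambda>t::real. exp (- \<i> * of_real (t * s)) * of_real (exp (- t\<^sup>2 / 2)))"
  "(\<integral>t. exp (- \<i> * of_real (t * s)) * of_real (exp (- t\<^sup>2 / 2)) \<partial>lborel)
    = complex_of_real (sqrt (2 * pi) * exp (- s\<^sup>2 / 2))"
proof -
  have dens: "exp (- t\<^sup>2 / 2) = sqrt (2 * pi) * std_normal_density t" for t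
    by (simp add: std_normal_density_def)
  have "integrable lborel (\<lambda>t::real. complex_of_real (exp (- t\<^sup>2 / 2)))"
    unfolding dens by (intro integrable_of_real integrable_mult_right integrable_normal_density) simp
  then show "integrable lborel (\<lambda>t::real. exp (- \<i> * of_real (t * s)) * of_real (exp (- t\<^sup>2 / 2)))"
    using integrable_kernel_mult[of _ s] by simp
  have "(\<integral>t. exp (- \<i> * of_real (t * s)) * of_real (exp (- t\<^sup>2 / 2)) \<partial>lborel)
      = (\<integral>t. of_real (sqrt (2 * pi)) * (std_normal_density t *\<^sub>R exp (\<i> * of_real (- s * t))) \<partial>lborel)"
    unfolding dens by (intro Bochner_Integration.integral_cong) (auto simp: scaleR_conv_of_real mult_ac)
  also have "\<dots> = of_real (sqrt (2 * pi)) * char std_normal_distribution (- s)"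
    unfolding char_def integral_mult_right_zero by (subst integral_density) auto
  also have "\<dots> = complex_of_real (sqrt (2 * pi) * exp (- s\<^sup>2 / 2))"
    by (simp add: char_std_normal_distribution)
  finally show "(\<integral>t. exp (- \<i> * of_real (t * s)) * of_real (exp (- t\<^sup>2 / 2)) \<partial>lborel)
    = complex_of_real (sqrt (2 * pi) * exp (- s\<^sup>2 / 2))" .
qed

lemma prod_exp_half: "(\<Prod>b\<in>Basis. exp (- (x \<bullet> b)\<^sup>2 / 2)) = exp (- (norm x)\<^sup>2 / 2)"
  unfolding norm_square_Basis sum_negf[symmetric] sum_divide_distrib by (rule exp_sum[symmetric]) simp

lemma kernel_gauss_prod:
  fixes x \<xi> :: "'a::euclidean_space"
  shows "fourier_kernel x \<xi> * gauss x
    = (\<Prod>b\<in>Basis. exp (- \<i> * of_real ((x \<bullet> b) * (\<xi> \<bullet> b))) * of_real (exp (- (x \<bullet> b)\<^sup>2 / 2)))"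
proof -
  have "(\<Prod>b\<in>Basis. exp (- \<i> * of_real ((x \<bullet> b) * (\<xi> \<bullet> b)))) = fourier_kernel x \<xi>"
    unfolding euclidean_inner[of x \<xi>] of_real_sum sum_distrib_left by (rule exp_sum[symmetric]) simp
  then show ?thesis
    unfolding gauss_def prod.distrib of_real_prod[symmetric] prod_exp_half by simp
qed

lemma integrable_gauss: "integrable lborel (gauss :: 'a::euclidean_space \<Rightarrow> complex)"
  using integral_lborel_prod(1)[of "\<lambda>b t. exp (- \<i> * of_real (t * ((0::'a) \<bullet> b))) * of_real (exp (- t\<^sup>2 / 2))",
      OF gauss_real_integral(1)]
  unfolding kernel_gauss_prod[symmetric] by simp

lemma fourier_gauss:
  fixes \<xi> :: "'a::euclidean_space"
  shows "fourier gauss \<xi> = of_real (sqrt (2 * pi) ^ DIM('a)) * gauss \<xi>"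
proof -
  have "fourier gauss \<xi> = (\<Prod>b\<in>Basis. complex_of_real (sqrt (2 * pi) * exp (- (\<xi> \<bullet> b)\<^sup>2 / 2)))"
    unfolding fourier_def kernel_gauss_prod
    by (subst integral_lborel_prod(2)[OF gauss_real_integral(1)]) (simp only: gauss_real_integral(2))
  also have "\<dots> = of_real (sqrt (2 * pi) ^ DIM('a)) * gauss \<xi>"
    unfolding of_real_prod[symmetric] prod.distrib prod_exp_half by (simp add: gauss_def)
  finally show ?thesis .
qed

lemma integral_gauss: "(\<integral>(x::'a::euclidean_space). gauss x \<partial>lborel) = of_real (sqrt (2 * pi) ^ DIM('a))"
  using fourier_gauss[of "0::'a"] by (simp add: fourier_def gauss_def)

lemma measurable_gauss [measurable]: "gauss \<in> borel_measurable borel"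
  unfolding gauss_def by measurable

text \<open>
  Both sides of the multiplication formula for \<open>f (x + \<epsilon> z)\<close> and the Gaussian converge as
  \<open>\<epsilon> \<rightarrow> 0\<close>.
\<close>

lemma fourier_inversion:
  fixes f :: "'a::euclidean_space \<Rightarrow> complex"
  assumes f: "integrable lborel f" and ff: "integrable lborel (fourier f)"
    and cont: "continuous_on UNIV f" and bound: "\<And>x. norm (f x) \<le> C"
  shows "inverse_fourier (fourier f) x = f x"
proof -
  have [measurable]: "f \<in> borel_measurable borel"
    using f by auto
  let ?c = "complex_of_real (sqrt (2 * pi) ^ DIM('a))"
  define \<epsilon> where "\<epsilon> n = 1 / real (Suc n)" for n
  have \<epsilon>: "0 < \<epsilon> n" for n
    by (simp add: \<epsilon>_def)
  have \<epsilon>0: "\<epsilon> \<longlonglongrightarrow> 0"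
    unfolding \<epsilon>_def by (rule LIMSEQ_Suc[OF lim_1_over_n])
  have eq: "(\<integral>z. f (x + \<epsilon> n *\<^sub>R z) * (?c * gauss z) \<partial>lborel)
      = (\<integral>\<xi>. exp (\<i> * of_real (x \<bullet> \<xi>)) * fourier f \<xi> * gauss (\<epsilon> n *\<^sub>R \<xi>) \<partial>lborel)" for n
  proof -
    have fourier_affine: "fourier (\<lambda>z. f (x + \<epsilon> n *\<^sub>R z)) (\<epsilon> n *\<^sub>R \<eta>) * of_real (\<epsilon> n ^ DIM('a))
        = exp (\<i> * of_real (x \<bullet> \<eta>)) * fourier f \<eta>" for \<eta>
    proof -
      have "exp (\<i> * of_real (x \<bullet> \<eta>)) * fourier f \<eta>
          = (\<integral>y. exp (\<i> * of_real (x \<bullet> \<eta>)) * (fourier_kernel y \<eta> * f y) \<partial>lborel)"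
        by (simp add: fourier_def)
      also have "\<dots> = \<bar>\<epsilon> n\<bar> ^ DIM('a) *\<^sub>R (\<integral>z. exp (\<i> * of_real (x \<bullet> \<eta>)) *
          (fourier_kernel (x + \<epsilon> n *\<^sub>R z) \<eta> * f (x + \<epsilon> n *\<^sub>R z)) \<partial>lborel)"
        by (rule integral_lborel_affine) (use \<epsilon>[of n] in auto)
      also have "(\<lambda>z. exp (\<i> * of_real (x \<bullet> \<eta>)) * (fourier_kernel (x + \<epsilon> n *\<^sub>R z) \<eta> * f (x + \<epsilon> n *\<^sub>R z)))
          = (\<lambda>z. fourier_kernel z (\<epsilon> n *\<^sub>R \<eta>) * f (x + \<epsilon> n *\<^sub>R z))"
      proof
        fix z
        have "exp (\<i> * of_real (x \<bullet> \<eta>)) * fourier_kernel (x + \<epsilon> n *\<^sub>R z) \<eta> = fourier_kernel z (\<epsilon> n *\<^sub>R \<eta>)"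
          unfolding exp_add[symmetric] by (simp add: inner_add_left ring_distribs)
        then show "exp (\<i> * of_real (x \<bullet> \<eta>)) * (fourier_kernel (x + \<epsilon> n *\<^sub>R z) \<eta> * f (x + \<epsilon> n *\<^sub>R z))
            = fourier_kernel z (\<epsilon> n *\<^sub>R \<eta>) * f (x + \<epsilon> n *\<^sub>R z)"
          by (simp only: mult.assoc[symmetric])
      qed
      finally show ?thesis
        using \<epsilon>[of n] by (simp add: fourier_def scaleR_conv_of_real mult.commute)
    qed
    have int: "integrable lborel (\<lambda>z. f (x + \<epsilon> n *\<^sub>R z))"
      using f \<epsilon>[of n] by (subst integrable_lborel_affine_iff) auto
    then have [measurable]: "(\<lambda>z. f (x + \<epsilon> n *\<^sub>R z)) \<in> borel_measurable borel"
      by auto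
    have "(\<integral>z. f (x + \<epsilon> n *\<^sub>R z) * (?c * gauss z) \<partial>lborel)
        = (\<integral>z. f (x + \<epsilon> n *\<^sub>R z) * fourier gauss z \<partial>lborel)"
      by (simp add: fourier_gauss)
    also have "\<dots> = (\<integral>\<eta>. fourier (\<lambda>z. f (x + \<epsilon> n *\<^sub>R z)) \<eta> * gauss \<eta> \<partial>lborel)"
      by (rule multiplication_formula(3)[OF int integrable_gauss])
    \<comment> \<open>Rescaling the frequency moves the dilation from \<open>f\<close> to the
      Gaussian, which then tends to 1; by \<open>fourier_affine\<close> the volume factor is
      absorbed and only the phase of the translation by \<open>x\<close> remains.\<close>
    also have "\<dots> = \<bar>\<epsilon> n\<bar> ^ DIM('a) *\<^sub>R
        (\<integral>\<eta>. fourier (\<lambda>z. f (x + \<epsilon> n *\<^sub>R z)) (0 + \<epsilon> n *\<^sub>R \<eta>) * gauss (0 + \<epsilon> n *\<^sub>R \<eta>) \<partial>lborel)"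
      by (rule integral_lborel_affine) (use \<epsilon>[of n] in auto)
    also have "\<dots> = (\<integral>\<eta>. of_real (\<epsilon> n ^ DIM('a)) * (fourier (\<lambda>z. f (x + \<epsilon> n *\<^sub>R z)) (\<epsilon> n *\<^sub>R \<eta>)
        * gauss (\<epsilon> n *\<^sub>R \<eta>)) \<partial>lborel)"
      using \<epsilon>[of n] by (simp add: scaleR_conv_of_real)
    also have "\<dots> = (\<integral>\<xi>. exp (\<i> * of_real (x \<bullet> \<xi>)) * fourier f \<xi> * gauss (\<epsilon> n *\<^sub>R \<xi>) \<partial>lborel)"
      unfolding fourier_affine[symmetric] by (simp add: mult_ac)
    finally show ?thesis .
  qed
  have "(\<lambda>n. \<integral>z. f (x + \<epsilon> n *\<^sub>R z) * (?c * gauss z) \<partial>lborel) \<longlonglongrightarrow> (\<integral>(z::'a). f x * (?c * gauss z) \<partial>lborel)"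
  proof (rule integral_dominated_convergence)
    show "integrable lborel (\<lambda>z::'a. C * norm (?c * gauss z))"
      by (intro integrable_mult_right integrable_norm integrable_gauss)
    have "isCont f x"
      using cont by (simp add: continuous_on_eq_continuous_at)
    have "(\<lambda>n. f (x + \<epsilon> n *\<^sub>R z)) \<longlonglongrightarrow> f x" for z
    proof -
      have "(\<lambda>n. x + \<epsilon> n *\<^sub>R z) \<longlonglongrightarrow> x + 0 *\<^sub>R z"
        by (intro tendsto_intros \<epsilon>0)
      then show ?thesis
        using isCont_tendsto_compose[OF \<open>isCont f x\<close>] by simp
    qed
    then show "AE z in lborel. (\<lambda>n. f (x + \<epsilon> n *\<^sub>R z) * (?c * gauss z)) \<longlonglongrightarrow> f x * (?c * gauss z)"
      by (intro AE_I2 tendsto_mult tendsto_const)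
    show "AE z::'a in lborel. norm (f (x + \<epsilon> n *\<^sub>R z) * (?c * gauss z)) \<le> C * norm (?c * gauss z)" for n
      unfolding norm_mult[of "f _"] by (intro AE_I2 mult_right_mono bound) auto
  qed measurable
  moreover have "(\<lambda>n. \<integral>\<xi>. exp (\<i> * of_real (x \<bullet> \<xi>)) * fourier f \<xi> * gauss (\<epsilon> n *\<^sub>R \<xi>) \<partial>lborel)
      \<longlonglongrightarrow> (\<integral>\<xi>. exp (\<i> * of_real (x \<bullet> \<xi>)) * fourier f \<xi> \<partial>lborel)"
  proof (rule integral_dominated_convergence)
    show "integrable lborel (\<lambda>\<xi>. norm (fourier f \<xi>))"
      using ff by simp
    have "(\<lambda>n. gauss (\<epsilon> n *\<^sub>R \<xi>)) \<longlonglongrightarrow> 1" for \<xi> :: 'a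
    proof -
      have "(\<lambda>n. gauss (\<epsilon> n *\<^sub>R \<xi>)) \<longlonglongrightarrow> of_real (exp (- (norm (0 *\<^sub>R \<xi>))\<^sup>2 / 2))"
        unfolding gauss_def by (intro tendsto_intros \<epsilon>0) simp
      then show ?thesis
        by simp
    qed
    then have "(\<lambda>n. exp (\<i> * of_real (x \<bullet> \<xi>)) * fourier f \<xi> * gauss (\<epsilon> n *\<^sub>R \<xi>))
        \<longlonglongrightarrow> exp (\<i> * of_real (x \<bullet> \<xi>)) * fourier f \<xi> * 1" for \<xi>
      by (intro tendsto_mult tendsto_const)
    then show "AE \<xi> in lborel. (\<lambda>n. exp (\<i> * of_real (x \<bullet> \<xi>)) * fourier f \<xi> * gauss (\<epsilon> n *\<^sub>R \<xi>))
        \<longlonglongrightarrow> exp (\<i> * of_real (x \<bullet> \<xi>)) * fourier f \<xi>"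
      by simp
    show "AE \<xi> in lborel. norm (exp (\<i> * of_real (x \<bullet> \<xi>)) * fourier f \<xi> * gauss (\<epsilon> n *\<^sub>R \<xi>))
        \<le> norm (fourier f \<xi>)" for n
      by (intro AE_I2) (auto simp: norm_mult gauss_def intro!: mult_left_le)
  qed measurable
  ultimately have "(\<integral>\<xi>. exp (\<i> * of_real (x \<bullet> \<xi>)) * fourier f \<xi> \<partial>lborel) = (\<integral>(z::'a). f x * (?c * gauss z) \<partial>lborel)"
    unfolding eq using LIMSEQ_unique by blast
  \<comment> \<open>One \<open>?c\<close> comes from the transform of the Gaussian, the other from
    its integral; their product is the normalisation in \<open>inverse_fourier\<close>.\<close>
  also have "\<dots> = f x * (?c * ?c)"
    by (simp add: integral_gauss)
  also have "?c * ?c = of_real ((2 * pi) ^ DIM('a))"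
    by (simp only: of_real_mult[symmetric] power_mult_distrib[symmetric] real_sqrt_mult_self abs_of_nonneg) simp
  finally show ?thesis
    by (simp add: inverse_fourier_def)
qed

section \<open>Decay of the Fourier transform of a Schwartz function\<close>

lemma has_derivative_fourier_kernel:
  fixes x \<xi> :: "'a::euclidean_space"
  shows "((\<lambda>x. fourier_kernel x \<xi>) has_derivative (\<lambda>h. (- \<i> * of_real (h \<bullet> \<xi>)) * fourier_kernel x \<xi>)) (at x)"
proof -
  have "bounded_linear (\<lambda>x. - \<i> * complex_of_real (x \<bullet> \<xi>))"
    by (intro bounded_linear_const_mult bounded_linear_compose[OF bounded_linear_of_real] bounded_linear_inner_left)
  then have "((\<lambda>x. - \<i> * complex_of_real (x \<bullet> \<xi>)) has_derivative (\<lambda>h. - \<i> * complex_of_real (h \<bullet> \<xi>))) (at x)"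
    by (rule bounded_linear_imp_has_derivative)
  moreover have "(exp has_derivative (*) (fourier_kernel x \<xi>)) (at (- \<i> * complex_of_real (x \<bullet> \<xi>)))"
    using DERIV_exp by (simp only: has_field_derivative_def)
  ultimately show ?thesis
    by (rule has_derivative_eq_rhs[OF has_derivative_compose]) (simp add: fun_eq_iff)
qed

lemma decaying_kernel_mult:
  assumes "decaying f"
  shows "decaying (\<lambda>x. fourier_kernel x \<xi> * f x)"
proof -
  have "continuous_on UNIV (\<lambda>x. fourier_kernel x \<xi>)"
    using has_derivative_fourier_kernel has_derivative_continuous
    by (intro continuous_at_imp_continuous_on ballI) blast
  then show ?thesis
    using assms by (auto simp: decaying_def norm_mult norm_fourier_kernel[simplified] intro!: continuous_on_mult)
qed

text \<open>Integration by parts: the derivative of the kernel times \<open>f\<close> integrates to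
  zero, and the product rule gives the two terms to be compared.\<close>

lemma fourier_derivative:
  fixes f :: "'a::euclidean_space \<Rightarrow> complex"
  assumes f: "schwartz f"
  shows "fourier (\<lambda>x. frechet_derivative f (at x) v) \<xi> = \<i> * of_real (v \<bullet> \<xi>) * fourier f \<xi>"
proof -
  let ?K = "\<lambda>x. fourier_kernel x \<xi>"
  let ?f' = "\<lambda>x. frechet_derivative f (at x) v"
  let ?g' = "\<lambda>x h. ?K x * frechet_derivative f (at x) h + (- \<i> * of_real (h \<bullet> \<xi>)) * ?K x * f x"
  have f': "schwartz ?f'"
    by (rule schwartz_frechet_derivative_direction[OF f])
  have dec: "decaying (\<lambda>x. ?K x * ?f' x)" "decaying (\<lambda>x. (- \<i> * of_real (v \<bullet> \<xi>)) * (?K x * f x))"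
    by (intro decaying_bounded_linear[OF bounded_linear_mult_right] decaying_kernel_mult schwartz_decaying f f')+
  have "(\<integral>x. ?g' x v \<partial>lborel) = 0"
  proof (rule integral_lborel_derivative_eq_0[where f = "\<lambda>x. ?K x * f x" and f' = ?g'])
    show "decaying (\<lambda>x. ?K x * f x)"
      by (intro decaying_kernel_mult schwartz_decaying f)
    show "((\<lambda>x. ?K x * f x) has_derivative ?g' x) (at x)" for x
      by (rule has_derivative_mult[OF has_derivative_fourier_kernel schwartz_has_derivative[OF f]])
    show "decaying (\<lambda>x. ?g' x v)"
      using decaying_add[OF dec] by (simp add: mult.assoc)
  qed
  also have "(\<integral>x. ?g' x v \<partial>lborel) = (\<integral>x. ?K x * ?f' x \<partial>lborel) + (\<integral>x. (- \<i> * of_real (v \<bullet> \<xi>)) * (?K x * f x) \<partial>lborel)"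
    unfolding mult.assoc[of "- \<i> * of_real (v \<bullet> \<xi>)"]
    by (intro Bochner_Integration.integral_add integrable_decaying dec)
  finally show ?thesis
    by (simp add: fourier_def mult.assoc)
qed

lemma fourier_rapid_direction:
  fixes f :: "'a::euclidean_space \<Rightarrow> complex"
  assumes "schwartz f"
  shows "\<exists>C. \<forall>\<xi>. \<bar>v \<bullet> \<xi>\<bar> ^ m * norm (fourier f \<xi>) \<le> C"
  using assms
proof (induction m arbitrary: f)
  case 0
  then show ?case
    using norm_fourier_le[of f] by auto
next
  case (Suc m)
  obtain C where "\<And>\<xi>. \<bar>v \<bullet> \<xi>\<bar> ^ m * norm (fourier (\<lambda>x. frechet_derivative f (at x) v) \<xi>) \<le> C"
    using Suc.IH[OF schwartz_frechet_derivative_direction[OF Suc.prems]] by blast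
  then have "\<bar>v \<bullet> \<xi>\<bar> ^ Suc m * norm (fourier f \<xi>) \<le> C" for \<xi>
    unfolding fourier_derivative[OF Suc.prems] by (simp add: norm_mult mult_ac)
  then show ?case
    by blast
qed

text \<open>Directional bounds suffice since the norm is at most d times the largest coordinate.
  Which coordinate is largest depends on \<open>\<xi>\<close>, so the constants of all basis
  directions are added up.\<close>

lemma fourier_rapid:
  fixes f :: "'a::euclidean_space \<Rightarrow> complex"
  assumes "schwartz f"
  shows "\<exists>C. \<forall>\<xi>. norm \<xi> ^ m * norm (fourier f \<xi>) \<le> C"
proof -
  obtain C where C: "\<And>v \<xi>. \<bar>v \<bullet> \<xi>\<bar> ^ m * norm (fourier f \<xi>) \<le> C v"
    using fourier_rapid_direction[OF assms, of _ m] by metis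
  let ?d = "real DIM('a)"
  have C0: "0 \<le> C v" for v
    using C[of v 0] by (rule order_trans[rotated]) simp
  have "norm \<xi> ^ m * norm (fourier f \<xi>) \<le> ?d ^ m * (\<Sum>v\<in>Basis. C v)" for \<xi>
  proof -
    let ?M = "Max ((\<lambda>v. \<bar>\<xi> \<bullet> v\<bar>) ` Basis)"
    have "?M \<in> (\<lambda>v. \<bar>\<xi> \<bullet> v\<bar>) ` Basis"
      by (rule Max_in) auto
    then obtain v where v: "?M = \<bar>\<xi> \<bullet> v\<bar>" "v \<in> Basis"
      by (rule imageE)
    have "norm \<xi> \<le> (\<Sum>v\<in>Basis. \<bar>\<xi> \<bullet> v\<bar>)"
      by (rule norm_le_l1)
    also have "\<dots> \<le> (\<Sum>v\<in>(Basis::'a set). ?M)"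
      by (intro sum_mono Max_ge) auto
    finally have "norm \<xi> \<le> ?d * \<bar>v \<bullet> \<xi>\<bar>"
      by (simp only: v(1) sum_constant inner_commute[of v])
    then have "norm \<xi> ^ m * norm (fourier f \<xi>) \<le> (?d * \<bar>v \<bullet> \<xi>\<bar>) ^ m * norm (fourier f \<xi>)"
      by (intro mult_right_mono power_mono) auto
    also have "\<dots> = ?d ^ m * (\<bar>v \<bullet> \<xi>\<bar> ^ m * norm (fourier f \<xi>))"
      by (simp add: power_mult_distrib)
    also have "\<dots> \<le> ?d ^ m * C v"
      by (intro mult_left_mono C) auto
    also have "\<dots> \<le> ?d ^ m * (\<Sum>v\<in>Basis. C v)"
      using v(2) C0 by (intro mult_left_mono member_le_sum) auto
    finally show ?thesis .
  qed
  then show ?thesis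
    by blast
qed

lemma integrable_schwartz:
  fixes f :: "'a::euclidean_space \<Rightarrow> complex"
  shows "schwartz f \<Longrightarrow> integrable lborel f"
  by (intro integrable_decaying schwartz_decaying)

lemma continuous_fourier:
  fixes f :: "'a::euclidean_space \<Rightarrow> complex"
  assumes f: "integrable lborel f"
  shows "continuous_on UNIV (fourier f)"
proof -
  have [measurable]: "f \<in> borel_measurable borel"
    using f by auto
  have "(\<lambda>n. fourier f (X n)) \<longlonglongrightarrow> fourier f \<xi>" if X: "X \<longlonglongrightarrow> \<xi>" for X \<xi>
    unfolding fourier_def
  proof (rule integral_dominated_convergence)
    show "integrable lborel (\<lambda>x. norm (f x))"
      using f by simp
    have "(\<lambda>n. fourier_kernel x (X n) * f x) \<longlonglongrightarrow> fourier_kernel x \<xi> * f x" for x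
      by (intro tendsto_intros X)
    then show "AE x in lborel. (\<lambda>n. fourier_kernel x (X n) * f x) \<longlonglongrightarrow> fourier_kernel x \<xi> * f x"
      by simp
    show "AE x in lborel. norm (fourier_kernel x (X n) * f x) \<le> norm (f x)" for n
      unfolding norm_mult norm_fourier_kernel by simp
  qed measurable
  then show ?thesis
    by (auto simp: continuous_on_sequentially comp_def)
qed

lemma decaying_fourier:
  fixes f :: "'a::euclidean_space \<Rightarrow> complex"
  assumes "schwartz f"
  shows "decaying (fourier f)"
  using continuous_fourier[OF integrable_schwartz[OF assms]] fourier_rapid[OF assms]
  by (rule decaying_if_rapid)

lemma schwartz_fourier_inversion:
  fixes f :: "'a::euclidean_space \<Rightarrow> complex"
  assumes f: "schwartz f"
  shows "inverse_fourier (fourier f) x = f x"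
proof -
  obtain C where C: "\<And>x. norm x ^ 0 * norm (f x) \<le> C"
    using schwartz_bound[OF f, of "[]" 0] by auto
  show ?thesis
    by (rule fourier_inversion[OF integrable_schwartz[OF f] integrable_decaying[OF decaying_fourier[OF f]]
        schwartz_continuous[OF f], of C]) (use C in simp)
qed

section \<open>Gaussians as Schwartz functions\<close>

lemma real_polynomial_directional_derivative:
  assumes "real_polynomial_function p"
  obtains p' where "real_polynomial_function p'" "\<And>x. \<exists>D. (p has_derivative D) (at x) \<and> D v = p' x"
proof -
  have "\<exists>p'. real_polynomial_function p' \<and> (\<forall>x. \<exists>D. (p has_derivative D) (at x) \<and> D v = p' x)"
    using assms
  proof induction
    case (linear f)
    then show ?case
      by (intro exI[of _ "\<lambda>x. f v"]) (auto intro: bounded_linear_imp_has_derivative)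
  next
    case (const c)
    then show ?case
      by (intro exI[of _ "\<lambda>x. 0"]) (auto intro!: exI[of _ "\<lambda>h. 0"])
  next
    case (add f g)
    then obtain f' g' where p: "real_polynomial_function f'" "real_polynomial_function g'"
      and *: "\<forall>x. \<exists>D. (f has_derivative D) (at x) \<and> D v = f' x"
        "\<forall>x. \<exists>D. (g has_derivative D) (at x) \<and> D v = g' x"
      by blast
    show ?case
    proof (rule exI[of _ "\<lambda>x. f' x + g' x"], intro conjI allI)
      show "real_polynomial_function (\<lambda>x. f' x + g' x)"
        using p by blast
      fix x
      obtain D E where "(f has_derivative D) (at x)" "D v = f' x" "(g has_derivative E) (at x)" "E v = g' x"
        using * by blast
      then show "\<exists>D. ((\<lambda>x. f x + g x) has_derivative D) (at x) \<and> D v = f' x + g' x"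
        by (intro exI[of _ "\<lambda>h. D h + E h"]) (auto intro: has_derivative_add)
    qed
  next
    case (mult f g)
    then obtain f' g' where p: "real_polynomial_function f'" "real_polynomial_function g'"
      and *: "\<forall>x. \<exists>D. (f has_derivative D) (at x) \<and> D v = f' x"
        "\<forall>x. \<exists>D. (g has_derivative D) (at x) \<and> D v = g' x"
      by blast
    show ?case
    proof (rule exI[of _ "\<lambda>x. f x * g' x + f' x * g x"], intro conjI allI)
      show "real_polynomial_function (\<lambda>x. f x * g' x + f' x * g x)"
        by (intro real_polynomial_function.intros(3,4) p mult.hyps)
      fix x
      obtain D E where "(f has_derivative D) (at x)" "D v = f' x" "(g has_derivative E) (at x)" "E v = g' x"
        using * by blast
      then show "\<exists>D. ((\<lambda>x. f x * g x) has_derivative D) (at x) \<and> D v = f x * g' x + f' x * g x"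
        by (intro exI[of _ "\<lambda>h. f x * E h + D h * g x"]) (auto intro: has_derivative_mult)
    qed
  qed
  then show ?thesis
    using that by blast
qed

lemma real_polynomial_growth:
  assumes "real_polynomial_function p"
  obtains C m where "0 \<le> C" "\<And>x. \<bar>p x\<bar> \<le> C * (1 + norm x) ^ m"
proof -
  have "\<exists>C m. 0 \<le> C \<and> (\<forall>x. \<bar>p x\<bar> \<le> C * (1 + norm x) ^ m)"
    using assms
  proof induction
    case (linear f)
    then obtain K where K: "0 \<le> K" "\<And>x. norm (f x) \<le> norm x * K"
      using bounded_linear.nonneg_bounded by blast
    have "\<bar>f x\<bar> \<le> K * (1 + norm x) ^ 1" for x
      using K by (smt (verit) mult.commute mult_left_mono norm_ge_zero power_one_right real_norm_def)
    with K(1) show ?case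
      by blast
  next
    case (const c)
    have "\<bar>c\<bar> \<le> \<bar>c\<bar> * (1 + norm x) ^ 0" for x :: 'a
      by simp
    then show ?case
      using abs_ge_zero by blast
  next
    case (add f g)
    then obtain C D m n where *: "0 \<le> C" "0 \<le> D" "\<And>x. \<bar>f x\<bar> \<le> C * (1 + norm x) ^ m" "\<And>x. \<bar>g x\<bar> \<le> D * (1 + norm x) ^ n"
      by blast
    have "\<bar>f x + g x\<bar> \<le> (C + D) * (1 + norm x) ^ (m + n)" for x
    proof -
      have "\<bar>f x + g x\<bar> \<le> C * (1 + norm x) ^ m + D * (1 + norm x) ^ n"
        using *(3,4)[of x] by linarith
      also have "\<dots> \<le> C * (1 + norm x) ^ (m + n) + D * (1 + norm x) ^ (m + n)"
        using *(1,2) by (intro add_mono mult_left_mono power_increasing) auto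
      finally show ?thesis
        by (simp add: distrib_right)
    qed
    then show ?case
      using *(1,2) add_nonneg_nonneg by blast
  next
    case (mult f g)
    then obtain C D m n where *: "0 \<le> C" "0 \<le> D" "\<And>x. \<bar>f x\<bar> \<le> C * (1 + norm x) ^ m" "\<And>x. \<bar>g x\<bar> \<le> D * (1 + norm x) ^ n"
      by blast
    have "\<bar>f x * g x\<bar> \<le> (C * D) * (1 + norm x) ^ (m + n)" for x
      using mult_mono[OF *(3,4)[of x]] *(1,2) by (simp add: abs_mult power_add mult_ac)
    then show ?case
      using *(1,2) mult_nonneg_nonneg by blast
  qed
  then show ?thesis
    using that by blast
qed

text \<open>Centre and width are free because these functions serve as the test functions that
  separate distributional transforms. With the inner product in place of a norm, differentiation at
  the centre needs no special case.\<close>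

definition gaussian :: "real \<Rightarrow> 'a::euclidean_space \<Rightarrow> 'a \<Rightarrow> real" where
  "gaussian a c x = exp (- a * ((x - c) \<bullet> (x - c)))"

lemma has_derivative_gaussian:
  "(gaussian a c has_derivative (\<lambda>h. (- 2 * a * ((x - c) \<bullet> h)) * gaussian a c x)) (at x)"
  unfolding gaussian_def
  by (auto intro!: derivative_eq_intros simp: inner_commute algebra_simps)

text \<open>Each derivative multiplies the Gaussian by a linear function and differentiates the
  polynomial in front, so the form persists and \<open>real_polynomial_growth\<close> controls all
  derivatives at once.\<close>

lemma iterated_deriv_gaussian:
  assumes "vs \<in> lists Basis"
  shows "\<exists>p. real_polynomial_function p \<and> iterated_deriv vs (gaussian a c) = (\<lambda>x. p x * gaussian a c x)"
  using assms
proof induction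
  case Nil
  then show ?case
    by (intro exI[of _ "\<lambda>x. 1"]) auto
next
  case (Cons v vs)
  then obtain p where p: "real_polynomial_function p"
    "iterated_deriv vs (gaussian a c) = (\<lambda>x. p x * gaussian a c x)"
    by blast
  obtain p' where p': "real_polynomial_function p'" "\<And>x. \<exists>D. (p has_derivative D) (at x) \<and> D v = p' x"
    using real_polynomial_directional_derivative[OF p(1)] by blast
  define q where "q x = p x * (- 2 * a * ((x \<bullet> v) + (- (c \<bullet> v)))) + p' x" for x
  have "real_polynomial_function (\<lambda>x. x \<bullet> v)"
    by (intro real_polynomial_function.intros(1) bounded_linear_inner_left)
  then have "real_polynomial_function q"
    unfolding q_def using p(1) p'(1) by (intro real_polynomial_function.intros(2-)) auto
  moreover have "iterated_deriv (v # vs) (gaussian a c) x = q x * gaussian a c x" for x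
  proof -
    obtain D where D: "(p has_derivative D) (at x)" "D v = p' x"
      using p'(2) by blast
    have "iterated_deriv (v # vs) (gaussian a c) x
        = p x * ((- 2 * a * ((x - c) \<bullet> v)) * gaussian a c x) + D v * gaussian a c x"
      using frechet_derivative_at[OF has_derivative_mult[OF D(1) has_derivative_gaussian[of a c x]]] 
      by (simp add: p(2) fun_eq_iff)
    then show ?thesis
      by (simp add: q_def D(2) inner_diff_left algebra_simps)
  qed
  ultimately show ?case
    by blast
qed

lemma power_le_fact_exp: "0 \<le> x \<Longrightarrow> x ^ n \<le> fact n * exp (x::real)"
proof -
  assume "0 \<le> x"
  have "(\<Sum>k\<in>{n}. x ^ k /\<^sub>R fact k) \<le> (\<Sum>k. x ^ k /\<^sub>R fact k)"
    using \<open>0 \<le> x\<close> by (intro sum_le_suminf summable_exp_generic) auto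
  then show ?thesis
    by (simp add: exp_def field_simps)
qed

lemma schwartz_gaussian:
  fixes c :: "'a::euclidean_space"
  assumes a: "0 < a"
  shows "schwartz (gaussian a c)"
proof (rule schwartzI)
  fix vs x m assume "vs \<in> lists (Basis :: 'a set)"
  then obtain p where p: "real_polynomial_function p"
    and eq: "iterated_deriv vs (gaussian a c) = (\<lambda>x. p x * gaussian a c x)"
    using iterated_deriv_gaussian[of vs a c] by blast
  obtain D where "(p has_derivative D) (at x)"
    using real_polynomial_directional_derivative[OF p] by blast
  from has_derivative_mult[OF this has_derivative_gaussian]
  show "iterated_deriv vs (gaussian a c) differentiable at x"
    unfolding eq by (rule differentiableI)
  obtain C k where C: "0 \<le> C" "\<And>x. \<bar>p x\<bar> \<le> C * (1 + norm x) ^ k"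
    using real_polynomial_growth[OF p] by blast
  let ?n = "m + k"
  have "norm x ^ m * norm (p x * gaussian a c x) \<le> C * (1 + norm c) ^ ?n * (fact ?n * exp (1 + 1 / (4 * a)))" for x
  proof -
    let ?r = "norm (x - c)"
    have "norm x \<le> norm c + ?r"
      by (metis add_diff_cancel_left' add.commute norm_triangle_sub)
    then have "1 + norm x \<le> (1 + norm c) * (1 + ?r)"
      using mult_nonneg_nonneg[OF norm_ge_zero[of c] norm_ge_zero[of "x - c"]]
      unfolding distrib_left distrib_right mult_1 mult_1_right by linarith
    have g: "gaussian a c x = exp (- a * ?r\<^sup>2)"
      by (simp add: gaussian_def power2_norm_eq_inner)
    have "norm x ^ m * norm (p x * gaussian a c x) \<le> (1 + norm x) ^ m * (C * (1 + norm x) ^ k * gaussian a c x)"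
      unfolding real_norm_def abs_mult using C
      by (intro mult_mono power_mono) (auto simp: gaussian_def)
    also have "\<dots> = C * ((1 + norm x) ^ ?n * gaussian a c x)"
      by (simp add: power_add)
    also have "\<dots> \<le> C * (((1 + norm c) * (1 + ?r)) ^ ?n * gaussian a c x)"
      using C \<open>1 + norm x \<le> _\<close> by (intro mult_left_mono mult_right_mono power_mono) (auto simp: gaussian_def)
    also have "\<dots> = C * (1 + norm c) ^ ?n * ((1 + ?r) ^ ?n * gaussian a c x)"
      by (simp add: power_mult_distrib)
    also have "(1 + ?r) ^ ?n * gaussian a c x \<le> (fact ?n * exp (1 + ?r)) * exp (- a * ?r\<^sup>2)"
      unfolding g by (intro mult_right_mono power_le_fact_exp) auto
    also have "\<dots> = fact ?n * exp (1 + ?r - a * ?r\<^sup>2)"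
      by (simp add: exp_add[symmetric])
    also have "\<dots> \<le> fact ?n * exp (1 + 1 / (4 * a))"
    proof -
      \<comment> \<open>Completing the square shows that r - a r^2 never exceeds 1 / (4 a), the
        origin of the constant in the claimed bound.\<close>
      have "0 \<le> (2 * a * ?r - 1)\<^sup>2 / (4 * a)"
        using a by simp
      also have "\<dots> = a * ?r\<^sup>2 - ?r + 1 / (4 * a)"
        using a by (simp add: power2_eq_square field_simps)
      finally show ?thesis
        by (intro mult_left_mono) auto
    qed
    finally show ?thesis
      using C by (auto simp: mult_left_mono)
  qed
  then show "\<exists>C. \<forall>x. norm x ^ m * norm (iterated_deriv vs (gaussian a c) x) \<le> C"
    unfolding eq by blast
qed

subsection \<open>Uniqueness of distributional Fourier transforms\<close>

text \<open>The positive and the negative part of \<open>w\<close> are densities of finite measures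
  that agree on boxes, an intersection-stable generator; equal measures have almost everywhere equal
  densities.\<close>

lemma AE_zero_if_box_integrals_zero:
  fixes w :: "'a::euclidean_space \<Rightarrow> real"
  assumes w: "integrable lborel w" and box: "\<And>l u. (\<integral>x. indicator (box l u) x * w x \<partial>lborel) = 0"
  shows "AE x in lborel. w x = 0"
proof -
  have [measurable]: "w \<in> borel_measurable borel"
    using w by auto
  define P where "P x = max 0 (w x)" for x
  define N where "N x = max 0 (- w x)" for x
  have [measurable]: "P \<in> borel_measurable borel" "N \<in> borel_measurable borel"
    unfolding P_def N_def by measurable
  have int: "integrable lborel P" "integrable lborel N"
    by (rule Bochner_Integration.integrable_bound[OF w]; auto simp: P_def N_def)+
  have em: "emeasure (density lborel (\<lambda>x. ennreal (f x))) (box l u) = ennreal (\<integral>x. indicator (box l u) x * f x \<partial>lborel)"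
    if f: "integrable lborel f" "\<And>x. 0 \<le> f x" for f :: "'a \<Rightarrow> real" and l u
  proof -
    have [measurable]: "f \<in> borel_measurable borel"
      using f by auto
    have "emeasure (density lborel (\<lambda>x. ennreal (f x))) (box l u) = (\<integral>\<^sup>+x. ennreal (indicator (box l u) x * f x) \<partial>lborel)"
      by (subst emeasure_density) (auto intro!: nn_integral_cong split: split_indicator)
    also have "\<dots> = ennreal (\<integral>x. indicator (box l u) x * f x \<partial>lborel)"
      using f by (intro nn_integral_eq_integral integrable_real_mult_indicator[where A="box l u", simplified mult.commute[of _ "indicator _ _"]]) auto
    finally show ?thesis .
  qed
  have intb: "integrable lborel (\<lambda>x. indicator (box l u) x * f x)" if "integrable lborel f" for f :: "'a \<Rightarrow> real" and l u
    using integrable_mult_indicator[OF _ that, of "box l u"] by simp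
  have "density lborel (\<lambda>x. ennreal (P x)) = density lborel (\<lambda>x. ennreal (N x))"
  proof (rule measure_eqI_generator_eq)
    let ?E = "range (\<lambda>(a, b). box a b::'a set)"
    let ?A = "\<lambda>n::nat. box (- (real n *\<^sub>R One)) (real n *\<^sub>R One) :: 'a set"
    show "Int_stable ?E"
      by (auto simp: Int_stable_def box_Int_box)
    show "?E \<subseteq> Pow UNIV" "sets (density lborel (\<lambda>x. ennreal (P x))) = sigma_sets UNIV ?E"
      "sets (density lborel (\<lambda>x. ennreal (N x))) = sigma_sets UNIV ?E"
      by (simp_all add: borel_eq_box)
    show "range ?A \<subseteq> ?E" "(\<Union>i. ?A i) = UNIV"
      unfolding UN_box_eq_UNIV by auto
    show "emeasure (density lborel (\<lambda>x. ennreal (P x))) (?A i) \<noteq> \<infinity>" for i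
      by (subst em[OF int(1)]) (auto simp: P_def)
    fix X assume "X \<in> ?E"
    then obtain l u where X: "X = box l u" by auto
    have "(\<integral>x. indicator X x * P x \<partial>lborel) - (\<integral>x. indicator X x * N x \<partial>lborel) = (\<integral>x. indicator X x * w x \<partial>lborel)"
    proof -
      have "(\<lambda>x. indicator X x * w x) = (\<lambda>x. indicator X x * P x - indicator X x * N x)"
        by (auto simp: P_def N_def max_def split: split_indicator)
      then show ?thesis
        unfolding X by (simp add: Bochner_Integration.integral_diff intb int)
    qed
    then have "(\<integral>x. indicator X x * P x \<partial>lborel) = (\<integral>x. indicator X x * N x \<partial>lborel)"
      using box by (simp add: X)
    then show "emeasure (density lborel (\<lambda>x. ennreal (P x))) X = emeasure (density lborel (\<lambda>x. ennreal (N x))) X"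
      unfolding X by (subst (1 2) em) (auto simp: int P_def N_def)
  qed
  then have "AE x in lborel. ennreal (P x) = ennreal (N x)"
    by (subst (asm) sigma_finite_measure.density_unique_iff[OF sigma_finite_lborel]) auto
  then show ?thesis
    by eventually_elim (auto simp: P_def N_def max_def split: if_splits)
qed

lemma gaussian_measurable [measurable]: "gaussian a c \<in> borel_measurable borel"
  unfolding gaussian_def by measurable

lemma gaussian_nonneg: "0 \<le> gaussian a c x"
  by (simp add: gaussian_def)

lemma gaussian_le_1: "0 \<le> a \<Longrightarrow> gaussian a c x \<le> 1"
  by (simp add: gaussian_def)

lemma integrable_gaussian: "0 < a \<Longrightarrow> integrable lborel (gaussian a c)"
  by (intro integrable_decaying schwartz_decaying schwartz_gaussian)

lemma gaussian_scale:
  assumes "0 < n"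
  shows "gaussian (n\<^sup>2) (x + (1 / n) *\<^sub>R z) x = gaussian 1 0 z"
  using assms by (simp add: gaussian_def inner_scaleR_left inner_scaleR_right power2_eq_square)

text \<open>
  Averaging over the centre \<open>c\<close> in a box, \<open>n\<^sup>d \<integral>\<^bsub>box\<^esub> gaussian n\<^sup>2 c x dc\<close> tends to a
  constant multiple of the indicator of the box as \<open>n \<rightarrow> \<infinity>\<close>.
\<close>

lemma box_integral_zero_if_orthogonal_gaussians:
  fixes w :: "'a::euclidean_space \<Rightarrow> real"
  assumes w: "integrable lborel w" and orth: "\<And>a c. 0 < a \<Longrightarrow> (\<integral>x. w x * gaussian a c x \<partial>lborel) = 0"
  shows "(\<integral>x. indicator (box l u) x * w x \<partial>lborel) = 0"
proof -
  have [measurable]: "w \<in> borel_measurable borel"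
    using w by auto
  define \<kappa> where "\<kappa> = (\<integral>(z::'a). gaussian 1 0 z \<partial>lborel)"
  have \<kappa>: "0 < \<kappa>"
  proof -
    have "\<kappa> \<noteq> 0"
    proof
      assume "\<kappa> = 0"
      then have "AE z::'a in lborel. gaussian 1 0 z = 0"
        unfolding \<kappa>_def by (subst (asm) integral_nonneg_eq_0_iff_AE) (auto simp: gaussian_nonneg integrable_gaussian)
      then have "AE z::'a in lborel. False"
        by (simp add: gaussian_def)
      then show False
        by (simp add: eventually_False ae_filter_eq_bot_iff)
    qed
    moreover have "0 \<le> \<kappa>"
      unfolding \<kappa>_def by (intro integral_nonneg_AE AE_I2 gaussian_nonneg)
    ultimately show ?thesis by simp
  qed
  \<comment> \<open>The indicator of the box smeared at scale 1/n. The substitution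
    \<open>c = x + (1 / n) *\<^sub>R z\<close> has moved \<open>n\<close> from the Gaussian into the
    indicator, so the bound and the limit can be read off.\<close>
  define q where "q n x = (\<integral>z. indicator (box l u) (x + (1 / n) *\<^sub>R z) * gaussian 1 0 z \<partial>lborel)" for n :: real and x :: 'a
  have q_bound: "\<bar>q n x\<bar> \<le> \<kappa>" for n x
  proof -
    have "\<bar>q n x\<bar> \<le> (\<integral>z. \<bar>indicator (box l u) (x + (1 / n) *\<^sub>R z) * gaussian 1 0 z\<bar> \<partial>lborel)"
      unfolding q_def by (rule integral_abs_bound)
    also have "\<dots> \<le> \<kappa>"
      unfolding \<kappa>_def
      by (intro integral_mono_AE' AE_I2 integrable_gaussian)
        (auto simp: gaussian_nonneg split: split_indicator)
    finally show ?thesis .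
  qed
  have q_zero: "(\<integral>x. w x * q n x \<partial>lborel) = 0" if n: "0 < n" for n
  proof -
    have q_eq: "q n x = n ^ DIM('a) * (\<integral>c. indicator (box l u) c * gaussian (n\<^sup>2) c x \<partial>lborel)" for x
    proof -
      have "(\<integral>c. indicator (box l u) c * gaussian (n\<^sup>2) c x \<partial>lborel)
          = \<bar>1 / n\<bar> ^ DIM('a) *\<^sub>R (\<integral>z. indicator (box l u) (x + (1 / n) *\<^sub>R z) * gaussian (n\<^sup>2) (x + (1 / n) *\<^sub>R z) x \<partial>lborel)"
        by (rule integral_lborel_affine) (use n in \<open>auto simp: gaussian_def\<close>)
      also have "\<dots> = (1 / n) ^ DIM('a) * q n x"
        unfolding q_def gaussian_scale[OF n] using n by simp
      finally show ?thesis
        using n by (simp add: power_divide)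
    qed
    have int: "integrable (lborel \<Otimes>\<^sub>M lborel) (\<lambda>(x, c). w x * (indicator (box l u) c * gaussian (n\<^sup>2) c x))"
    proof (rule Bochner_Integration.integrable_bound)
      show "integrable (lborel \<Otimes>\<^sub>M lborel) (\<lambda>(x, c). w x * indicator (box l u) (c::'a))"
      proof (rule lborel_pair.Fubini_integrable)
        show "integrable lborel (\<lambda>x. \<integral>c. norm (case (x, c) of (x, c) \<Rightarrow> w x * indicator (box l u) (c::'a)) \<partial>lborel)"
          using w by (simp add: abs_mult)
        show "AE x in lborel. integrable lborel (\<lambda>c. case (x, c) of (x, c) \<Rightarrow> w x * indicator (box l u) (c::'a))"
          using emeasure_lborel_box_finite[of l u] by (simp add: integrable_indicator_iff)
      qed measurable
      show "(\<lambda>(x, c). w x * (indicator (box l u) c * gaussian (n\<^sup>2) c x)) \<in> borel_measurable (lborel \<Otimes>\<^sub>M lborel)"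
        unfolding gaussian_def by measurable
      show "AE z in lborel \<Otimes>\<^sub>M lborel. norm (case z of (x, c) \<Rightarrow> w x * (indicator (box l u) c * gaussian (n\<^sup>2) c x))
          \<le> norm (case z of (x, c) \<Rightarrow> w x * indicator (box l u) c)"
        using gaussian_le_1[of "n\<^sup>2"]
        by (intro AE_I2) (auto simp: abs_mult abs_of_nonneg gaussian_nonneg split: split_indicator intro!: mult_left_le)
    qed
    have "(\<integral>x. w x * q n x \<partial>lborel)
        = n ^ DIM('a) * (\<integral>x. \<integral>c. w x * (indicator (box l u) c * gaussian (n\<^sup>2) c x) \<partial>lborel \<partial>lborel)"
      unfolding q_eq mult.left_commute[of "w _" "n ^ DIM('a)"] by simp
    also have "(\<integral>x. \<integral>c. w x * (indicator (box l u) c * gaussian (n\<^sup>2) c x) \<partial>lborel \<partial>lborel)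
        = (\<integral>c. \<integral>x. w x * (indicator (box l u) c * gaussian (n\<^sup>2) c x) \<partial>lborel \<partial>lborel)"
      by (rule lborel_pair.Fubini_integral[OF int, symmetric])
    also have "\<dots> = (\<integral>c. indicator (box l u) c * (\<integral>x. w x * gaussian (n\<^sup>2) c x \<partial>lborel) \<partial>lborel)"
      unfolding mult.left_commute[of "w _"] by simp
    also have "\<dots> = 0"
      using n by (simp add: orth)
    finally show ?thesis
      by simp
  qed
  define N where "N i = real (Suc i)" for i
  have N: "0 < N i" for i
    by (simp add: N_def)
  have N0: "(\<lambda>i. 1 / N i) \<longlonglongrightarrow> 0"
    unfolding N_def by (rule LIMSEQ_Suc[OF lim_1_over_n])
  \<comment> \<open>Boundary points of the box, where the indicator jumps, are left out; they form a
    null set.\<close>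
  have q_lim: "(\<lambda>i. q (N i) x) \<longlonglongrightarrow> indicator (box l u) x * \<kappa>" if x: "x \<notin> cbox l u - box l u" for x
  proof -
    have "(\<lambda>i. indicator (box l u) (x + (1 / N i) *\<^sub>R z)) \<longlonglongrightarrow> (indicator (box l u) x :: real)" for z
    proof -
      have lim: "(\<lambda>i. x + (1 / N i) *\<^sub>R z) \<longlonglongrightarrow> x"
        using tendsto_add[OF tendsto_const tendsto_scaleR[OF N0 tendsto_const], of x z] by simp
      show ?thesis
      proof (cases "x \<in> box l u")
        case True
        then have "\<forall>\<^sub>F i in sequentially. x + (1 / N i) *\<^sub>R z \<in> box l u"
          using topological_tendstoD[OF lim open_box] by blast
        then have "\<forall>\<^sub>F i in sequentially. indicator (box l u) (x + (1 / N i) *\<^sub>R z) = (1::real)"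
          by eventually_elim simp
        then show ?thesis
          using True by (simp add: tendsto_eventually)
      next
        case False
        then have "x \<in> - cbox l u"
          using x by blast
        then have "\<forall>\<^sub>F i in sequentially. x + (1 / N i) *\<^sub>R z \<in> - cbox l u"
          by (rule topological_tendstoD[OF lim open_Compl[OF closed_cbox]])
        then have "\<forall>\<^sub>F i in sequentially. indicator (box l u) (x + (1 / N i) *\<^sub>R z) = (0::real)"
          by eventually_elim (auto simp: indicator_def dest: subsetD[OF box_subset_cbox])
        then show ?thesis
          using False by (simp add: tendsto_eventually)
      qed
    qed
    then have "(\<lambda>i. q (N i) x) \<longlonglongrightarrow> (\<integral>(z::'a). indicator (box l u) x * gaussian 1 0 z \<partial>lborel)"
      unfolding q_def
      by (intro integral_dominated_convergence[where w="gaussian 1 0"] AE_I2 tendsto_mult tendsto_const integrable_gaussian)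
        (auto simp: gaussian_nonneg split: split_indicator)
    then show ?thesis
      by (simp add: \<kappa>_def)
  qed
  have "(\<lambda>i. \<integral>x. w x * q (N i) x \<partial>lborel) \<longlonglongrightarrow> (\<integral>x. w x * (indicator (box l u) x * \<kappa>) \<partial>lborel)"
  proof (rule integral_dominated_convergence)
    show "integrable lborel (\<lambda>x. \<bar>w x\<bar> * \<kappa>)"
      using w by simp
    have "AE x in lborel. x \<notin> cbox l u - box l u"
      using null_sets_cbox_Diff_box AE_not_in by blast
    then show "AE x in lborel. (\<lambda>i. w x * q (N i) x) \<longlonglongrightarrow> w x * (indicator (box l u) x * \<kappa>)"
      by eventually_elim (intro tendsto_mult tendsto_const q_lim)
    show "AE x in lborel. norm (w x * q (N i) x) \<le> \<bar>w x\<bar> * \<kappa>" for i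
      by (auto simp: abs_mult intro!: mult_left_mono q_bound)
    show "(\<lambda>x. w x * q (N i) x) \<in> borel_measurable lborel" for i
      unfolding q_def by measurable
  qed measurable
  then have "(\<integral>x. w x * (indicator (box l u) x * \<kappa>) \<partial>lborel) = 0"
    by (simp add: q_zero[OF N] LIMSEQ_const_iff)
  then show ?thesis
    using \<kappa> by (simp add: mult.assoc[symmetric] mult.commute[of "w _"])
qed

text \<open>Completing the square, with the new centre the weighted mean of 0 and \<open>c\<close>.
  Hence multiplication by \<open>gaussian 1 0\<close> maps the family of Gaussians into itself up to
  constants.\<close>

lemma gaussian_mult:
  fixes c :: "'a::euclidean_space"
  assumes "0 < a"
  shows "gaussian 1 0 x * gaussian a c x
    = exp (- (a / (1 + a) * (c \<bullet> c))) * gaussian (1 + a) ((a / (1 + a)) *\<^sub>R c) x"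
proof -
  have "x \<bullet> x + a * ((x - c) \<bullet> (x - c))
      = a / (1 + a) * (c \<bullet> c) + (1 + a) * ((x - (a / (1 + a)) *\<^sub>R c) \<bullet> (x - (a / (1 + a)) *\<^sub>R c))"
  proof -
    define k where "k = a / (1 + a)"
    have k: "k + a * k = a"
    proof -
      have "k * (1 + a) = a"
        using assms by (simp add: k_def)
      then show ?thesis
        by (simp add: distrib_left mult.commute)
    qed
    have "k * (c \<bullet> c) + (1 + a) * (x \<bullet> x - 2 * k * (x \<bullet> c) + k * k * (c \<bullet> c))
        = (1 + a) * (x \<bullet> x) - 2 * (k + a * k) * (x \<bullet> c) + (k + (k + a * k) * k) * (c \<bullet> c)"
      by (simp add: algebra_simps)
    also have "(k + (k + a * k) * k) = a"
      using k by (simp add: mult.commute)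
    finally have "x \<bullet> x + a * (x \<bullet> x - 2 * (x \<bullet> c) + c \<bullet> c)
        = k * (c \<bullet> c) + (1 + a) * (x \<bullet> x - 2 * k * (x \<bullet> c) + k * k * (c \<bullet> c))"
      unfolding k by (simp add: algebra_simps)
    then show ?thesis
      unfolding k_def[symmetric]
      by (simp add: inner_diff_left inner_diff_right inner_commute[of c x] algebra_simps)
  qed
  then show ?thesis
    unfolding gaussian_def exp_add[symmetric]
    by (simp only: diff_zero mult_1 mult_minus_left minus_add_distrib[symmetric])
qed

text \<open>A distributional transform, and so \<open>w\<close>, may fail to be integrable. Damping
  by \<open>gaussian 1 0\<close> makes it integrable, preserves orthogonality by
  \<open>gaussian_mult\<close>, and loses nothing because this Gaussian has no zeros.\<close>

lemma AE_zero_if_orthogonal_gaussians: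
  fixes w :: "'a::euclidean_space \<Rightarrow> real"
  assumes int: "\<And>a c. 0 < a \<Longrightarrow> integrable lborel (\<lambda>x. w x * gaussian a c x)"
    and orth: "\<And>a c. 0 < a \<Longrightarrow> (\<integral>x. w x * gaussian a c x \<partial>lborel) = 0"
  shows "AE x in lborel. w x = 0"
proof -
  have "(\<integral>x. (w x * gaussian 1 0 x) * gaussian a c x \<partial>lborel) = 0" if a: "0 < a" for a and c :: 'a
  proof -
    have "(\<integral>x. (w x * gaussian 1 0 x) * gaussian a c x \<partial>lborel)
        = (\<integral>x. exp (- (a / (1 + a) * (c \<bullet> c))) * (w x * gaussian (1 + a) ((a / (1 + a)) *\<^sub>R c) x) \<partial>lborel)"
      unfolding mult.assoc gaussian_mult[OF a] by (simp add: mult.left_commute)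
    then show ?thesis
      using a by (simp add: orth)
  qed
  then have "(\<integral>x. indicator (box l u) x * (w x * gaussian 1 0 x) \<partial>lborel) = 0" for l u
    by (intro box_integral_zero_if_orthogonal_gaussians int) auto
  then have "AE x in lborel. w x * gaussian 1 0 x = 0"
    by (intro AE_zero_if_box_integrals_zero int) auto
  then show ?thesis
    by eventually_elim (simp add: gaussian_def)
qed

lemma schwartz_complex_gaussian:
  "0 < a \<Longrightarrow> schwartz (\<lambda>x. complex_of_real (gaussian a c x))"
  by (rule schwartz_bounded_linear[OF bounded_linear_of_real schwartz_gaussian])

text \<open>Measurability is not part of the definition, yet is wanted for a transform picked by
  SOME. It follows by dividing an integrable product by a Gaussian without zeros.\<close>

lemma has_fourier_transform_measurable:
  fixes u :: "'a::euclidean_space \<Rightarrow> complex"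
  assumes "has_fourier_transform f u"
  shows "u \<in> borel_measurable borel"
proof -
  have "integrable lborel (\<lambda>\<xi>. u \<xi> * complex_of_real (gaussian 1 0 \<xi>))"
    using assms schwartz_complex_gaussian[of 1] by (auto simp: has_fourier_transform_def)
  then have "(\<lambda>\<xi>. u \<xi> * complex_of_real (gaussian 1 0 \<xi>)) \<in> borel_measurable borel"
    by auto
  then have "(\<lambda>\<xi>. (u \<xi> * complex_of_real (gaussian 1 0 \<xi>)) / complex_of_real (gaussian 1 0 \<xi>)) \<in> borel_measurable borel"
    by measurable
  then show ?thesis
    by (simp add: gaussian_def)
qed

text \<open>Real Gaussians suffice as test functions, and being real they let the real and imaginary
  parts of the difference be treated separately.\<close>

lemma has_fourier_transform_unique:
  fixes u v :: "'a::euclidean_space \<Rightarrow> complex"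
  assumes u: "has_fourier_transform f u" and v: "has_fourier_transform f v"
  shows "AE \<xi> in lborel. u \<xi> = v \<xi>"
proof -
  define w where "w \<xi> = u \<xi> - v \<xi>" for \<xi>
  have w: "integrable lborel (\<lambda>\<xi>. w \<xi> * complex_of_real (gaussian a c \<xi>))"
    "(\<integral>\<xi>. w \<xi> * complex_of_real (gaussian a c \<xi>) \<partial>lborel) = 0" if "0 < a" for a c
    using u v schwartz_complex_gaussian[OF that, of c]
    by (auto simp: has_fourier_transform_def w_def left_diff_distrib)
  have "AE \<xi> in lborel. Re (w \<xi>) = 0"
    using integrable_Re[OF w(1)] integral_Re[OF w(1)] w(2)
    by (intro AE_zero_if_orthogonal_gaussians) auto
  moreover have "AE \<xi> in lborel. Im (w \<xi>) = 0"
    using integrable_Im[OF w(1)] integral_Im[OF w(1)] w(2)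
    by (intro AE_zero_if_orthogonal_gaussians) auto
  ultimately show ?thesis
    by eventually_elim (simp add: w_def complex_eq_iff)
qed

subsection \<open>Inversion of the Radon transform\<close>

lemma has_fourier_transform_fourier:
  fixes f :: "'a::euclidean_space \<Rightarrow> complex"
  assumes "integrable lborel f"
  shows "has_fourier_transform f (fourier f)"
  unfolding has_fourier_transform_def
  using multiplication_formula[OF assms integrable_schwartz] by blast

text \<open>Replaces the transform picked by SOME by any explicitly known one: the two agree almost
  everywhere and occur only under an integral.\<close>

lemma riesz_potential_eq:
  fixes f :: "'a::euclidean_space \<Rightarrow> complex"
  assumes u: "has_fourier_transform f u"
  shows "riesz_potential \<beta> f = inverse_fourier (\<lambda>\<xi>. of_real (norm \<xi> powr (- \<beta>)) * u \<xi>)"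
proof
  fix x
  define v where "v = (SOME u. has_fourier_transform f u)"
  have v: "has_fourier_transform f v"
    unfolding v_def by (rule someI[where P = "has_fourier_transform f", OF u])
  have [measurable]: "u \<in> borel_measurable borel" "v \<in> borel_measurable borel"
    using has_fourier_transform_measurable u v by auto
  have "AE \<xi> in lborel. v \<xi> = u \<xi>"
    by (rule has_fourier_transform_unique[OF v u])
  then have "(\<integral>\<xi>. exp (\<i> * of_real (x \<bullet> \<xi>)) * (of_real (norm \<xi> powr (- \<beta>)) * v \<xi>) \<partial>lborel)
      = (\<integral>\<xi>. exp (\<i> * of_real (x \<bullet> \<xi>)) * (of_real (norm \<xi> powr (- \<beta>)) * u \<xi>) \<partial>lborel)"
    by (intro integral_cong_AE) auto
  then show "riesz_potential \<beta> f x = inverse_fourier (\<lambda>\<xi>. of_real (norm \<xi> powr (- \<beta>)) * u \<xi>) x"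
    unfolding riesz_potential_def v_def[symmetric] inverse_fourier_def by simp
qed

lemma integral_reflect:
  fixes f :: "'a::euclidean_space \<Rightarrow> 'b::{banach, second_countable_topology}"
  assumes "f \<in> borel_measurable borel"
  shows "(\<integral>x. f (- x) \<partial>lborel) = (\<integral>x. f x \<partial>lborel)"
  using integral_lborel_affine[OF assms, of "-1" 0] by simp

lemma integrable_reflect:
  fixes f :: "'a::euclidean_space \<Rightarrow> 'b::{banach, second_countable_topology}"
  assumes "integrable lborel f"
  shows "integrable lborel (\<lambda>x. f (- x))"
  using integrable_lborel_affine_iff[of f "-1" 0] assms by simp

lemma inverse_fourier_eq_fourier:
  fixes u :: "'a::euclidean_space \<Rightarrow> complex"
  shows "inverse_fourier u x = of_real (1 / (2 * pi) ^ DIM('a)) * fourier u (- x)"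
  by (simp add: inverse_fourier_def fourier_def inner_commute)

text \<open>This handles backprojections, where only the transform \<open>u\<close> is known to be
  integrable. The multiplication formula is applied to the reflected transform of \<phi>, whose own
  transform is \<phi> up to the constant by Fourier inversion.\<close>

lemma has_fourier_transform_inverse_fourier:
  fixes u :: "'a::euclidean_space \<Rightarrow> complex"
  assumes u: "integrable lborel u"
  shows "has_fourier_transform (inverse_fourier u) u"
  unfolding has_fourier_transform_def
proof (intro allI impI conjI)
  fix \<phi> :: "'a \<Rightarrow> complex" assume \<phi>: "schwartz \<phi>"
  let ?c = "complex_of_real (1 / (2 * pi) ^ DIM('a))"
  let ?g = "\<lambda>x. fourier \<phi> (- x)"
  have [measurable]: "u \<in> borel_measurable borel" "\<phi> \<in> borel_measurable borel"
    using u integrable_schwartz[OF \<phi>] by auto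
  have \<phi>f: "integrable lborel (fourier \<phi>)"
    by (rule integrable_decaying[OF decaying_fourier[OF \<phi>]])
  have g: "integrable lborel ?g"
    by (rule integrable_reflect[OF \<phi>f])
  have inv: "?c * fourier ?g \<xi> = \<phi> \<xi>" for \<xi>
  proof -
    have "fourier ?g \<xi> = (\<integral>x. fourier_kernel (- x) \<xi> * fourier \<phi> x \<partial>lborel)"
      unfolding fourier_def[of ?g]
      using integral_reflect[of "\<lambda>x. fourier_kernel (- x) \<xi> * fourier \<phi> x"] by simp
    also have "\<dots> = fourier (fourier \<phi>) (- \<xi>)"
      by (simp add: fourier_def[of "fourier \<phi>"])
    finally have "?c * fourier ?g \<xi> = inverse_fourier (fourier \<phi>) \<xi>"
      by (simp add: inverse_fourier_eq_fourier)
    then show ?thesis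
      by (simp add: schwartz_fourier_inversion[OF \<phi>])
  qed
  have "integrable lborel (\<lambda>x. ?c * (fourier u x * ?g x))"
    by (intro integrable_mult_right multiplication_formula(2)[OF u g])
  from integrable_reflect[OF this] show "integrable lborel (\<lambda>x. inverse_fourier u x * fourier \<phi> x)"
    by (simp add: inverse_fourier_eq_fourier mult.assoc)
  have "integrable lborel (\<lambda>\<xi>. ?c * (u \<xi> * fourier ?g \<xi>))"
    by (intro integrable_mult_right multiplication_formula(1)[OF u g])
  moreover have eq: "?c * (u \<xi> * fourier ?g \<xi>) = u \<xi> * \<phi> \<xi>" for \<xi>
    by (simp only: mult.left_commute[of ?c] inv)
  ultimately show "integrable lborel (\<lambda>\<xi>. u \<xi> * \<phi> \<xi>)"
    by simp
  have "(\<integral>x. inverse_fourier u x * fourier \<phi> x \<partial>lborel) = (\<integral>x. ?c * (fourier u (- x) * ?g (- x)) \<partial>lborel)"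
    by (simp only: inverse_fourier_eq_fourier mult.assoc minus_minus)
  also have "\<dots> = (\<integral>x. ?c * (fourier u x * ?g x) \<partial>lborel)"
    by (rule integral_reflect[of "\<lambda>x. ?c * (fourier u x * ?g x)"]) measurable
  also have "\<dots> = ?c * (\<integral>\<xi>. u \<xi> * fourier ?g \<xi> \<partial>lborel)"
    by (simp only: integral_mult_right_zero multiplication_formula(3)[OF u g])
  also have "\<dots> = (\<integral>\<xi>. ?c * (u \<xi> * fourier ?g \<xi>) \<partial>lborel)"
    by (rule integral_mult_right_zero[symmetric])
  also have "\<dots> = (\<integral>\<xi>. u \<xi> * \<phi> \<xi> \<partial>lborel)"
    by (simp only: eq)
  finally show "(\<integral>x. inverse_fourier u x * fourier \<phi> x \<partial>lborel) = (\<integral>\<xi>. u \<xi> * \<phi> \<xi> \<partial>lborel)" .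
qed

section \<open>Integrability of powers of the norm against rapidly decreasing functions\<close>

lemma integrable_powr_unit_interval:
  fixes a :: real
  assumes "-1 < a"
  shows "integrable lborel (\<lambda>r. indicator {0..1} r * r powr a)"
proof -
  have "(\<lambda>r. r powr a) integrable_on {0..1}"
    using assms by (intro integrable_on_powr_from_0) auto
  then have "set_integrable lebesgue {0..1} (\<lambda>r. r powr a)"
    by (intro nonnegative_absolutely_integrable_1) auto
  then have "integrable lebesgue (\<lambda>r. indicator {0..1} r * r powr a)"
    by (simp add: set_integrable_def)
  then show ?thesis
    by (subst (asm) integrable_completion) auto
qed

text \<open>The lower bound on \<open>s\<close> makes the total exponent \<open>?a\<close> exceed -1
  at the origin; the bound on \<open>M\<close> leaves decay at least r^(-2) at infinity.\<close>

lemma integrable_radial_powr: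
  fixes s :: real
  assumes s: "- real d < s" and d: "0 < d" and M: "real d + 1 + s \<le> real M"
  shows "integrable lborel (\<lambda>r. (indicator {0<..} r * r ^ (d - 1)) * (r powr s / (1 + \<bar>r\<bar> ^ M)))"
proof (rule Bochner_Integration.integrable_bound)
  let ?a = "s + (real d - 1)"
  show "integrable lborel (\<lambda>r. indicator {0..1} r * r powr ?a + 2 * (1 / (1 + r\<^sup>2)))"
    using s by (intro Bochner_Integration.integrable_add integrable_mult_right integrable_inverse_one_plus_square
        integrable_powr_unit_interval) auto
  have bound: "r ^ (d - 1) * (r powr s / (1 + r ^ M)) \<le> indicator {0..1} r * r powr ?a + 2 * (1 / (1 + r\<^sup>2))"
    if r: "0 < r" for r
  proof -
    have eq: "r ^ (d - 1) * (r powr s / (1 + r ^ M)) = r powr ?a / (1 + r ^ M)"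
      using r d by (simp add: powr_add powr_realpow[symmetric] of_nat_diff)
    show ?thesis
    proof (cases "r \<le> 1")
      case True
      have "r powr ?a / (1 + r ^ M) \<le> r powr ?a / 1"
        using r by (intro divide_left_mono) (auto intro: add_pos_nonneg)
      moreover have "0 \<le> 2 * (1 / (1 + r\<^sup>2))"
        by simp
      ultimately have "r powr ?a / (1 + r ^ M) \<le> r powr ?a + 2 * (1 / (1 + r\<^sup>2))"
        by linarith
      then show ?thesis
        unfolding eq using True r by simp
    next
      case False
      have "r powr ?a / (1 + r ^ M) \<le> r powr ?a / r ^ M"
        using r by (intro divide_left_mono mult_pos_pos) (auto intro: add_pos_nonneg)
      also have "\<dots> = r powr (?a - real M)"
        using r by (simp add: powr_diff powr_realpow)
      also have "\<dots> \<le> r powr (- 2)"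
        using M False by (intro powr_mono) auto
      also have "\<dots> = 1 / r\<^sup>2"
        using r by (simp add: powr_minus powr_numeral divide_inverse)
      also have "\<dots> \<le> 2 * (1 / (1 + r\<^sup>2))"
      proof -
        have "1 \<le> r\<^sup>2"
          using False by simp
        then show ?thesis
          by (simp add: divide_simps)
      qed
      finally show ?thesis
        unfolding eq using False by simp
    qed
  qed
  show "AE r in lborel. norm ((indicator {0<..} r * r ^ (d - 1)) * (r powr s / (1 + \<bar>r\<bar> ^ M)))
      \<le> norm (indicator {0..1} r * r powr ?a + 2 * (1 / (1 + r\<^sup>2)))"
  proof (rule AE_I2)
    fix r :: real
    have "0 \<le> indicator {0..1} r * r powr ?a + 2 * (1 / (1 + r\<^sup>2))"
      by (intro add_nonneg_nonneg) auto
    then show "norm ((indicator {0<..} r * r ^ (d - 1)) * (r powr s / (1 + \<bar>r\<bar> ^ M)))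
      \<le> norm (indicator {0..1} r * r powr ?a + 2 * (1 / (1 + r\<^sup>2)))"
      using bound[of r] by (cases "0 < r") auto
  qed
qed measurable

text \<open>Serves twice: in dimension d with the power -\<alpha>, and on a line with the power d -
  1 - \<alpha>. In both cases the condition on the exponent reads \<alpha> < d.\<close>

lemma integrable_powr_mult_rapid:
  fixes g :: "'a::euclidean_space \<Rightarrow> complex"
  assumes s: "- real DIM('a) < s" and [measurable]: "g \<in> borel_measurable borel"
    and rapid: "\<And>m. \<exists>C. \<forall>x. norm x ^ m * norm (g x) \<le> C"
  shows "integrable lborel (\<lambda>x. of_real (norm x powr s) * g x)"
proof -
  define M where "M = nat \<lceil>real DIM('a) + 1 + s\<rceil>"
  have M: "real DIM('a) + 1 + s \<le> real M"
    unfolding M_def by linarith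
  obtain C where C: "\<And>x. norm x ^ 0 * norm (g x) \<le> C"
    using rapid[of 0] by blast
  obtain D where D: "\<And>x. norm x ^ M * norm (g x) \<le> D"
    using rapid[of M] by blast
  have "integrable lborel (\<lambda>x::'a. norm x powr s / (1 + \<bar>norm x\<bar> ^ M))"
    by (intro integrable_radial integrable_radial_powr s M) auto
  then have int: "integrable lborel (\<lambda>x::'a. (C + D) * (norm x powr s / (1 + norm x ^ M)))"
    unfolding abs_norm_cancel by (rule integrable_mult_right)
  show ?thesis
  proof (rule Bochner_Integration.integrable_bound[OF int])
    show "AE x in lborel. norm (of_real (norm x powr s) * g x)
        \<le> norm ((C + D) * (norm x powr s / (1 + norm x ^ M)))"
    proof (rule AE_I2)
      fix x :: 'a
      have pos: "0 < 1 + norm x ^ M"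
        by (simp add: add_pos_nonneg)
      have "(1 + norm x ^ M) * norm (g x) \<le> C + D"
        using C[of x] D[of x] by (simp add: distrib_right)
      then have "norm (g x) \<le> (C + D) / (1 + norm x ^ M)"
        using pos by (simp add: pos_le_divide_eq mult.commute)
      then have "norm x powr s * norm (g x) \<le> norm x powr s * ((C + D) / (1 + norm x ^ M))"
        by (intro mult_left_mono) auto
      also have "\<dots> = (C + D) * (norm x powr s / (1 + norm x ^ M))"
        by simp
      finally have "norm (of_real (norm x powr s) * g x) \<le> (C + D) * (norm x powr s / (1 + norm x ^ M))"
        by (simp add: norm_mult)
      then show "norm (of_real (norm x powr s) * g x) \<le> norm ((C + D) * (norm x powr s / (1 + norm x ^ M)))"
        unfolding real_norm_def by (rule order_trans) (rule abs_ge_self)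
    qed
  qed measurable
qed

text \<open>The filter integrates over a whole line of frequencies, polar coordinates only over a
  ray; the negative half is reflected to match.\<close>

lemma integral_real_line_split:
  fixes F :: "real \<Rightarrow> complex"
  assumes F: "integrable lborel F"
  shows "(\<integral>s. F s \<partial>lborel)
    = (\<integral>s. indicator {0<..} s *\<^sub>R F s \<partial>lborel) + (\<integral>s. indicator {0<..} s *\<^sub>R F (- s) \<partial>lborel)"
proof -
  have [measurable]: "F \<in> borel_measurable borel"
    using F by auto
  have i: "integrable lborel (\<lambda>s. indicator {0<..} s *\<^sub>R F s)" "integrable lborel (\<lambda>s. indicator {..<0} s *\<^sub>R F s)"
    using F by (auto intro: integrable_mult_indicator)
  have "(\<integral>s. F s \<partial>lborel) = (\<integral>s. indicator {0<..} s *\<^sub>R F s + indicator {..<0} s *\<^sub>R F s \<partial>lborel)"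
  proof (rule integral_cong_AE)
    show "AE s in lborel. F s = indicator {0<..} s *\<^sub>R F s + indicator {..<0} s *\<^sub>R F s"
      using AE_lborel_singleton[of "0::real"] by eventually_elim (auto split: split_indicator)
  qed measurable
  also have "\<dots> = (\<integral>s. indicator {0<..} s *\<^sub>R F s \<partial>lborel) + (\<integral>s. indicator {..<0} s *\<^sub>R F s \<partial>lborel)"
    by (rule Bochner_Integration.integral_add[OF i])
  also have "(\<integral>s. indicator {..<0} s *\<^sub>R F s \<partial>lborel) = (\<integral>s. indicator {..<0} (- s) *\<^sub>R F (- s) \<partial>lborel)"
    by (rule integral_reflect[symmetric]) measurable
  also have "\<dots> = (\<integral>s. indicator {0<..} s *\<^sub>R F (- s) \<partial>lborel)"
    by (intro Bochner_Integration.integral_cong) (auto split: split_indicator)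
  finally show ?thesis .
qed

text \<open>
  By the slice theorem the filtered projections are one-dimensional inverse Fourier integrals of
  \<open>\<bar>s\<bar>\<^bsup>d-1-\<alpha>\<^esup> f^(s \<omega>)\<close>; polar coordinates turn their superposition over the sphere into
  the inverse Fourier transform of \<open>\<bar>\<xi>\<bar>\<^bsup>-\<alpha>\<^esup> f^(\<xi>)\<close>, each half of the line contributing
  once.
\<close>

lemma dual_radon_filtered_radon:
  fixes f :: "'a::euclidean_space \<Rightarrow> real"
  assumes f: "schwartz f" and \<alpha>: "\<alpha> < real DIM('a)"
  defines "fh \<equiv> fourier (\<lambda>x. complex_of_real (f x))"
  shows "dual_radon (\<lambda>\<omega>. riesz_potential (\<alpha> - real DIM('a) + 1) (\<lambda>p. complex_of_real (radon f \<omega> p)))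
    = inverse_fourier (\<lambda>\<xi>. of_real (2 * (2 * pi) ^ (DIM('a) - 1)) * (of_real (norm \<xi> powr (- \<alpha>)) * fh \<xi>))"
    (is "dual_radon ?h = inverse_fourier ?u")
proof
  fix x :: 'a
  have fc: "schwartz (\<lambda>x. complex_of_real (f x))"
    by (rule schwartz_bounded_linear[OF bounded_linear_of_real f])
  have fh_meas [measurable]: "fh \<in> borel_measurable borel"
    unfolding fh_def using integrable_schwartz[OF fc] by measurable
  have rapid: "\<exists>C. \<forall>\<xi>. norm \<xi> ^ m * norm (fh \<xi>) \<le> C" for m
    unfolding fh_def by (rule fourier_rapid[OF fc])
  define U where "U \<xi> = exp (\<i> * of_real (x \<bullet> \<xi>)) * (of_real (norm \<xi> powr (- \<alpha>)) * fh \<xi>)" for \<xi>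
  have [measurable]: "U \<in> borel_measurable borel"
    unfolding U_def by measurable
  have "integrable lborel (\<lambda>\<xi>. of_real (norm \<xi> powr (- \<alpha>)) * fh \<xi>)"
    using \<alpha> by (intro integrable_powr_mult_rapid rapid) auto
  then have U: "integrable lborel U"
    by (rule Bochner_Integration.integrable_bound) (auto simp: U_def norm_mult)
  define G where "G V \<omega> = (\<integral>r. (indicator {0<..} r * r ^ (DIM('a) - 1)) *\<^sub>R V (r *\<^sub>R \<omega>) \<partial>lborel)"
    for V :: "'a \<Rightarrow> complex" and \<omega>
  have h: "?h \<omega> (\<omega> \<bullet> x) = of_real (1 / (2 * pi)) * (G U \<omega> + G (\<lambda>\<xi>. U (- \<xi>)) \<omega>)" if \<omega>: "norm \<omega> = 1" for \<omega>
  proof -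
    define F where "F s = exp (\<i> * of_real ((\<omega> \<bullet> x) * s)) * (of_real (\<bar>s\<bar> powr (real DIM('a) - 1 - \<alpha>)) * fh (s *\<^sub>R \<omega>))" for s
    have [measurable]: "F \<in> borel_measurable borel"
      unfolding F_def by measurable
    note slice = fourier_slice[OF \<omega> schwartz_decaying[OF f]]
    have "fourier (\<lambda>p. complex_of_real (radon f \<omega> p)) = (\<lambda>s. fh (s *\<^sub>R \<omega>))"
      unfolding fh_def by (rule ext) (rule slice(2))
    then have "has_fourier_transform (\<lambda>p. complex_of_real (radon f \<omega> p)) (\<lambda>s. fh (s *\<^sub>R \<omega>))"
      using has_fourier_transform_fourier[OF integrable_of_real[OF slice(1)]] by simp
    from riesz_potential_eq[OF this]
    have h_eq: "?h \<omega> (\<omega> \<bullet> x) = of_real (1 / (2 * pi)) * (\<integral>s. F s \<partial>lborel)"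
      by (simp add: inverse_fourier_def F_def algebra_simps)
    have "integrable lborel (\<lambda>s. of_real (norm s powr (real DIM('a) - 1 - \<alpha>)) * fh (s *\<^sub>R \<omega>))"
    proof (rule integrable_powr_mult_rapid)
      fix m
      obtain C where "\<And>\<xi>. norm \<xi> ^ m * norm (fh \<xi>) \<le> C"
        using rapid by blast
      from this[of "_ *\<^sub>R \<omega>"] show "\<exists>C. \<forall>s. norm s ^ m * norm (fh (s *\<^sub>R \<omega>)) \<le> C"
        using \<omega> by auto
    qed (use \<alpha> in auto)
    then have F: "integrable lborel F"
      by (rule Bochner_Integration.integrable_bound) (auto simp: F_def norm_mult)
    \<comment> \<open>The inner potential of order \<alpha> - d + 1 multiplies by |s|^(d - 1 -
      \<alpha>), which is the polar Jacobian s^(d-1) times the multiplier |\<xi>|^(-\<alpha>) of the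
      resulting function on the whole space.\<close>
    have pw: "s ^ (DIM('a) - 1) * s powr (- \<alpha>) = s powr (real DIM('a) - 1 - \<alpha>)" if "0 < s" for s
      using that by (simp add: powr_realpow[symmetric] powr_add[symmetric] of_nat_diff Suc_leI)
    have F_pos: "F s = s ^ (DIM('a) - 1) *\<^sub>R U (s *\<^sub>R \<omega>)"
      and F_neg: "F (- s) = s ^ (DIM('a) - 1) *\<^sub>R U (- (s *\<^sub>R \<omega>))" if s: "0 < s" for s
    proof -
      have n: "norm (s *\<^sub>R \<omega>) = s"
        using s \<omega> by simp
      have i: "x \<bullet> (s *\<^sub>R \<omega>) = (\<omega> \<bullet> x) * s"
        by (simp add: inner_commute)
      have *: "of_real a * (E * (of_real b * z)) = E * (of_real (a * b) * z)" for a b and E z :: complex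
        by simp
      have "\<bar>s\<bar> = s" "\<bar>- s\<bar> = s"
        using s by auto
      then show "F s = s ^ (DIM('a) - 1) *\<^sub>R U (s *\<^sub>R \<omega>)"
        "F (- s) = s ^ (DIM('a) - 1) *\<^sub>R U (- (s *\<^sub>R \<omega>))"
        by (simp_all only: F_def U_def scaleR_conv_of_real n i * pw[OF s] norm_minus_cancel inner_minus_right
            scaleR_minus_left mult_minus_right)
    qed
    have "indicator {0<..} s *\<^sub>R F s = (indicator {0<..} s * s ^ (DIM('a) - 1)) *\<^sub>R U (s *\<^sub>R \<omega>)" for s
      by (cases "0 < s") (simp_all add: F_pos)
    moreover have "indicator {0<..} s *\<^sub>R F (- s) = (indicator {0<..} s * s ^ (DIM('a) - 1)) *\<^sub>R U (- (s *\<^sub>R \<omega>))" for s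
      by (cases "0 < s") (simp_all add: F_neg)
    ultimately show ?thesis
      unfolding h_eq integral_real_line_split[OF F] G_def by simp
  qed
  have "dual_radon ?h x = (\<integral>\<omega>. of_real (1 / (2 * pi)) * (G U \<omega> + G (\<lambda>\<xi>. U (- \<xi>)) \<omega>) \<partial>sphere_measure)"
    unfolding dual_radon_def by (intro Bochner_Integration.integral_cong refl h) simp
  also have "\<dots> = of_real (1 / (2 * pi)) * ((\<integral>\<omega>. G U \<omega> \<partial>sphere_measure) + (\<integral>\<omega>. G (\<lambda>\<xi>. U (- \<xi>)) \<omega> \<partial>sphere_measure))"
    unfolding integral_mult_right_zero G_def
    by (subst Bochner_Integration.integral_add) (intro integral_polar(1) U integrable_reflect refl)+
  also have "\<dots> = of_real (1 / (2 * pi)) * ((\<integral>\<xi>. U \<xi> \<partial>lborel) + (\<integral>\<xi>. U (- \<xi>) \<partial>lborel))"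
    unfolding G_def integral_polar(2)[OF U] integral_polar(2)[OF integrable_reflect[OF U]] ..
  also have "\<dots> = of_real (1 / pi) * (\<integral>\<xi>. U \<xi> \<partial>lborel)"
    by (subst integral_reflect) (auto simp: divide_simps)
  also have "\<dots> = inverse_fourier ?u x"
  proof -
    have d: "(2 * pi) ^ DIM('a) = 2 * pi * (2 * pi) ^ (DIM('a) - 1)"
      by (rule power_eq_if[of _ "DIM('a)", THEN trans]) simp
    have "inverse_fourier ?u x = of_real (1 / (2 * pi) ^ DIM('a))
        * (\<integral>\<xi>. of_real (2 * (2 * pi) ^ (DIM('a) - 1)) * U \<xi> \<partial>lborel)"
      by (simp only: inverse_fourier_def U_def mult.left_commute)
    also have "\<dots> = of_real (1 / (2 * pi) ^ DIM('a) * (2 * (2 * pi) ^ (DIM('a) - 1))) * (\<integral>\<xi>. U \<xi> \<partial>lborel)"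
      by (simp only: integral_mult_right_zero of_real_mult mult.assoc)
    also have "1 / (2 * pi) ^ DIM('a) * (2 * (2 * pi) ^ (DIM('a) - 1)) = 1 / pi"
      unfolding d by simp
    finally show ?thesis ..
  qed
  finally show "dual_radon ?h x = inverse_fourier ?u x" .
qed

text \<open>After backprojection the multipliers with exponents -\<alpha> and \<alpha> cancel.
  Agreement of \<open>g\<close> with the Radon transform is required on unit vectors alone, the only
  ones that backprojection sees; this allows derivatives of transversal transforms as data.\<close>

theorem radon_inversion:
  fixes f :: "'a::euclidean_space \<Rightarrow> real"
  assumes f: "schwartz f" and \<alpha>: "\<alpha> < real DIM('a)"
    and g: "\<And>\<omega> p. norm \<omega> = 1 \<Longrightarrow> g \<omega> p = radon f \<omega> p"
  shows "radon_inverse \<alpha> (\<lambda>\<omega> p. complex_of_real (g \<omega> p)) x = complex_of_real (f x)"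
proof -
  let ?c = "complex_of_real (2 * (2 * pi) ^ (DIM('a) - 1))"
  define fh where "fh = fourier (\<lambda>x. complex_of_real (f x))"
  define u where "u \<xi> = ?c * (of_real (norm \<xi> powr (- \<alpha>)) * fh \<xi>)" for \<xi>
  have fc: "schwartz (\<lambda>x. complex_of_real (f x))"
    by (rule schwartz_bounded_linear[OF bounded_linear_of_real f])
  have [measurable]: "fh \<in> borel_measurable borel"
    unfolding fh_def using integrable_schwartz[OF fc] by measurable
  have "integrable lborel u"
    unfolding u_def fh_def using \<alpha> integrable_schwartz[OF fc]
    by (intro integrable_mult_right integrable_powr_mult_rapid fourier_rapid[OF fc] fourier_measurable) auto
  then have u: "has_fourier_transform (inverse_fourier u) u"
    by (rule has_fourier_transform_inverse_fourier)
  have "dual_radon (\<lambda>\<omega>. riesz_potential (\<alpha> - real DIM('a) + 1) (\<lambda>p. complex_of_real (g \<omega> p)))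
      = dual_radon (\<lambda>\<omega>. riesz_potential (\<alpha> - real DIM('a) + 1) (\<lambda>p. complex_of_real (radon f \<omega> p)))"
    unfolding dual_radon_def by (intro ext Bochner_Integration.integral_cong refl) (simp add: g)
  also have "\<dots> = inverse_fourier u"
    unfolding u_def fh_def by (rule dual_radon_filtered_radon[OF f \<alpha>])
  finally have "riesz_potential (- \<alpha>) (dual_radon (\<lambda>\<omega>. riesz_potential (\<alpha> - real DIM('a) + 1) (\<lambda>p. complex_of_real (g \<omega> p)))) x
      = inverse_fourier (\<lambda>\<xi>. of_real (norm \<xi> powr \<alpha>) * u \<xi>) x"
    by (simp add: riesz_potential_eq[OF u])
  also have "\<dots> = inverse_fourier (\<lambda>\<xi>. ?c * fh \<xi>) x"
  proof -
    \<comment> \<open>\<open>powr\<close> takes the value 0 at base 0, even for exponent 0, so the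
      two powers cancel only off the origin.\<close>
    have "AE \<xi> in lborel. of_real (norm \<xi> powr \<alpha>) * u \<xi> = ?c * fh \<xi>"
      using AE_lborel_singleton[of "0::'a"]
    proof eventually_elim
      case (elim \<xi>)
      then have "norm \<xi> powr \<alpha> * norm \<xi> powr (- \<alpha>) = 1"
        by (simp add: powr_add[symmetric])
      then have "complex_of_real (norm \<xi> powr \<alpha>) * complex_of_real (norm \<xi> powr (- \<alpha>)) = 1"
        by (simp only: of_real_mult[symmetric] of_real_1)
      then show ?case
        by (simp add: u_def mult.left_commute[of "complex_of_real (norm \<xi> powr \<alpha>)"] mult.assoc[symmetric])
    qed
    then have "(\<integral>\<xi>. exp (\<i> * of_real (x \<bullet> \<xi>)) * (of_real (norm \<xi> powr \<alpha>) * u \<xi>) \<partial>lborel)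
        = (\<integral>\<xi>. exp (\<i> * of_real (x \<bullet> \<xi>)) * (?c * fh \<xi>) \<partial>lborel)"
      by (intro integral_cong_AE) (auto simp: u_def)
    then show ?thesis
      by (simp only: inverse_fourier_def)
  qed
  also have "\<dots> = ?c * inverse_fourier fh x"
    by (simp only: inverse_fourier_def mult.left_commute[of _ ?c] integral_mult_right_zero)
  also have "inverse_fourier fh x = of_real (f x)"
    unfolding fh_def by (rule schwartz_fourier_inversion[OF fc])
  finally have "radon_inverse \<alpha> (\<lambda>\<omega> p. complex_of_real (g \<omega> p)) x
      = of_real (1 / 2 * (2 * pi) powr (1 - real DIM('a)) * (2 * (2 * pi) ^ (DIM('a) - 1))) * of_real (f x)"
    by (simp only: radon_inverse_def of_real_mult mult.assoc)
  also have "1 / 2 * (2 * pi) powr (1 - real DIM('a)) * (2 * (2 * pi) ^ (DIM('a) - 1)) = 1"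
  proof -
    have "(2 * pi) ^ (DIM('a) - 1) = (2 * pi) powr (real DIM('a) - 1)"
      by (subst powr_realpow[symmetric]) (auto simp: of_nat_diff Suc_leI)
    then show ?thesis
      by (simp add: powr_add[symmetric])
  qed
  finally show ?thesis
    by simp
qed

text \<open>Differentiability is asserted alongside the formulas, since \<open>deriv\<close> carries
  no information where a derivative fails to exist. The coercions to complex numbers reflect that
  \<open>radon_inverse\<close> is complex-valued.\<close>

theorem theorem2:
  fixes F :: "real^'n \<Rightarrow> real^'n"
    and e :: "real^'n \<Rightarrow> nat \<Rightarrow> real^'n"
    and \<alpha> :: real
  assumes "CARD('n) \<ge> 2"
    and "smooth F"
    and "\<And>j. schwartz (\<lambda>x. F x $ j)"
    and "\<And>\<omega>. \<omega> \<in> sphere 0 1 \<Longrightarrow> orthonormal_basis (e \<omega>) \<and> e \<omega> 0 = \<omega>"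
    and "\<alpha> < real CARD('n)"
  shows
    "(\<forall>\<omega> \<in> sphere 0 1. \<forall>p. transversal_radon F \<omega> differentiable (at p)) \<and>
     (\<forall>x. complex_of_real (divergence F x) =
        radon_inverse \<alpha> (\<lambda>\<omega> p. complex_of_real (deriv (transversal_radon F \<omega>) p)) x) \<and>
     (\<forall>\<omega> \<in> sphere 0 1. \<forall>p.
        (\<forall>k \<in> {1..CARD('n) - 1}. weighted_transversal_radon e k F \<omega> differentiable (at p)) \<and>
        componentwise_radon F \<omega> p =
          transversal_radon F \<omega> p *\<^sub>R \<omega> +
          (\<Sum>k = 1..CARD('n) - 1.
             (deriv (weighted_transversal_radon e k F \<omega>) p
                - radon (\<lambda>x. (e \<omega> k \<bullet> x) * divergence F x) \<omega> p) *\<^sub>R e \<omega> k)) \<and>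
     (\<forall>j x. complex_of_real (F x $ j) =
        radon_inverse \<alpha> (\<lambda>\<omega> p. complex_of_real (axis j 1 \<bullet> componentwise_radon F \<omega> p)) x)"
proof -
  interpret schwartz_field F
    by standard (rule assms(3))
  have frame: "orthonormal_basis (e \<omega>)" "e \<omega> 0 = \<omega>" if "norm \<omega> = 1" for \<omega>
    using assms(4)[of \<omega>] that by auto
  have \<alpha>: "\<alpha> < real DIM(real^'n)"
    using assms(5) by simp
  have D: "deriv (transversal_radon F \<omega>) p = radon (divergence F) \<omega> p" if "norm \<omega> = 1" for \<omega> p
    using DERIV_imp_deriv[OF transversal_radon_has_derivative[OF that]] radon_divergence[OF frame[OF that]]
    by simp
  have W: "(weighted_transversal_radon e k F \<omega> has_real_derivative
      radon (\<lambda>x. (e \<omega> k \<bullet> x) * (\<omega> \<bullet> field_derivative F x \<omega>)) \<omega> p) (at p)"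
    if "norm \<omega> = 1" "k \<in> {1..CARD('n) - 1}" for \<omega> k p
    using weighted_transversal_has_derivative[OF frame[OF that(1)] that(2)]
    by (simp add: weighted_transversal_radon_def[abs_def])
  show ?thesis
  proof (intro conjI ballI allI)
    show "transversal_radon F \<omega> differentiable (at p)" if "\<omega> \<in> sphere 0 1" for \<omega> p
    proof -
      have "norm \<omega> = 1"
        using that by simp
      from differentiableI[OF has_field_derivative_imp_has_derivative[OF transversal_radon_has_derivative[OF this]]]
      show ?thesis .
    qed
    show "complex_of_real (divergence F x)
        = radon_inverse \<alpha> (\<lambda>\<omega> p. complex_of_real (deriv (transversal_radon F \<omega>) p)) x" for x
      by (rule radon_inversion[OF schwartz_divergence \<alpha> D, symmetric])
    show "complex_of_real (F x $ j)
        = radon_inverse \<alpha> (\<lambda>\<omega> p. complex_of_real (axis j 1 \<bullet> componentwise_radon F \<omega> p)) x" for j x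
      by (rule radon_inversion[OF schwartz_component \<alpha>, symmetric])
        (simp add: componentwise_radon_def inner_axis')
    fix \<omega> :: "real^'n" and p assume "\<omega> \<in> sphere 0 1"
    then have \<omega>: "norm \<omega> = 1" by simp
    show "weighted_transversal_radon e k F \<omega> differentiable (at p)" if "k \<in> {1..CARD('n) - 1}" for k
      by (rule differentiableI[OF has_field_derivative_imp_has_derivative[OF W[OF \<omega> that]]])
    have "deriv (weighted_transversal_radon e k F \<omega>) p - radon (\<lambda>x. (e \<omega> k \<bullet> x) * divergence F x) \<omega> p
        = radon (\<lambda>x. e \<omega> k \<bullet> F x) \<omega> p" if "k \<in> {1..CARD('n) - 1}" for k
      using DERIV_imp_deriv[OF W[OF \<omega> that]] radon_weighted_divergence[OF frame[OF \<omega>] that] by simp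
    then have "(\<Sum>k = 1..CARD('n) - 1. (deriv (weighted_transversal_radon e k F \<omega>) p
          - radon (\<lambda>x. (e \<omega> k \<bullet> x) * divergence F x) \<omega> p) *\<^sub>R e \<omega> k)
        = (\<Sum>k = 1..CARD('n) - 1. radon (\<lambda>x. e \<omega> k \<bullet> F x) \<omega> p *\<^sub>R e \<omega> k)"
      by (intro sum.cong refl) (simp only:)
    then show "componentwise_radon F \<omega> p = transversal_radon F \<omega> p *\<^sub>R \<omega> +
        (\<Sum>k = 1..CARD('n) - 1. (deriv (weighted_transversal_radon e k F \<omega>) p
          - radon (\<lambda>x. (e \<omega> k \<bullet> x) * divergence F x) \<omega> p) *\<^sub>R e \<omega> k)"
      using componentwise_radon_expansion[OF frame[OF \<omega>], of p] by (simp only:)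
  qed
qed

end
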